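(* Let $n\in\mathbb{N}$, let $\psi:\mathbb{N}\to\mathbb{R}_{+}$ be monotonically decreasing with $\psi(q)\to0$ as $q\to\infty$, and let $\gamma:\mathbb{Z}^{n+1}\to[-\frac12,\frac12]^{n}$ satisfy $\|\gamma(\mathbf{p},q)\|\to0$ as $q\to\infty$. Define \[ W^{\gamma}_{n}(\psi)=\left\{\mathbf{x}\in[0,1]^{n} : \|q\mathbf{x}-\mathbf{p}+\gamma(\mathbf{p},q)\|<\psi(q)\ \text{ for infinitely many } (\mathbf{p},q)\in\mathbb{Z}^{n}\times\mathbb{N}\right\}. \] Let $f:\mathbb{R}_{+}\to\mathbb{R}_{+}$ be a dimension function such that $r\mapsto r^{-n}f(r)$ is monotonic, and suppose that \[ \limsup_{q\to\infty,\ \psi(q)\neq0}\ \frac{\max_{1\leq\|\mathbf{p}\|\leq q}\|\gamma(\mathbf{p},q)\|}{q\, f\!\left(\frac{\psi(q)}{q}\right)^{1/n}}<\infty. \] Then $\mathcal{H}^{f}(W^{\gamma}_{n}(\psi))=0$ if $\sum_{q=1}^{\infty}q^{n}f\!\left(\frac{\psi(q)}{q}\right)<\infty$, and $\mathcal{H}^{f}(W^{\gamma}_{n}(\psi))=\mathcal{H}^{f}([0,1]^{n})$ if $\sum_{q=1}^{\infty}q^{n}f\!\left(\frac{\psi(q)}{q}\right)=\infty$.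
   Context: $\|\cdot\|$ is the maximum norm on $\mathbb{R}^{n}$. A dimension function is a continuous nondecreasing $f:\mathbb{R}_{+}\to\mathbb{R}_{+}$ with $f(r)\to0$ as $r\to0$; $\mathcal{H}^{f}$ denotes Hausdorff $f$-measure. *)

theory Defs
  imports "HOL-Analysis.Analysis"
begin

text \<open>Throughout, the maximum norm on \<open>\<real>\<^sup>n\<close> is the library's \<^const>\<open>infnorm\<close>, with \<open>n = CARD('n)\<close>,
  and \<open>\<real>\<^sub>+\<close> is \<open>[0, \<infinity>)\<close>.\<close>

definition int_vec :: "int ^ 'n \<Rightarrow> real ^ 'n" where
  "int_vec p = (\<chi> i. real_of_int (p $ i))"

definition dimension_function :: "(real \<Rightarrow> real) \<Rightarrow> bool" where
  "dimension_function f \<longleftrightarrow>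
     (\<forall>r\<ge>0. f r \<ge> 0) \<and> continuous_on {0..} f \<and> mono_on {0..} f \<and> (f \<longlongrightarrow> 0) (at_right 0)"

text \<open>The library's \<^const>\<open>diameter\<close> with the Euclidean distance replaced by the maximum norm;
  only meaningful for bounded sets.\<close>

definition max_diameter :: "(real ^ 'n) set \<Rightarrow> real" where
  "max_diameter U = (if U = {} then 0 else SUP (x,y)\<in>U \<times> U. infnorm (x - y))"

text \<open>Covers are sequences of arbitrary bounded sets. Finite covers are included by padding with
  empty sets, which contribute \<open>f 0 = 0\<close> for a dimension function \<open>f\<close>.\<close>

definition hausdorff_premeasure ::
    "(real \<Rightarrow> real) \<Rightarrow> real \<Rightarrow> (real ^ 'n) set \<Rightarrow> ennreal" where
  "hausdorff_premeasure f \<delta> A =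
     (INF U \<in> {U :: nat \<Rightarrow> (real ^ 'n) set.
                 A \<subseteq> (\<Union>i. U i) \<and> (\<forall>i. bounded (U i) \<and> max_diameter (U i) \<le> \<delta>)}.
        \<Sum>i. ennreal (f (max_diameter (U i))))"

definition hausdorff_measure :: "(real \<Rightarrow> real) \<Rightarrow> (real ^ 'n) set \<Rightarrow> ennreal" where
  "hausdorff_measure f A = (SUP \<delta> \<in> {0<..}. hausdorff_premeasure f \<delta> A)"

definition W_set ::
    "(int ^ 'n \<Rightarrow> int \<Rightarrow> real ^ 'n) \<Rightarrow> (nat \<Rightarrow> real) \<Rightarrow> (real ^ 'n) set" where
  "W_set \<gamma> \<psi> =
     {x \<in> cbox 0 1. infinite {(p, q). q \<ge> 1 \<and>
        infnorm (real q *\<^sub>R x - int_vec p + \<gamma> p (int q)) < \<psi> q}}"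

text \<open>The series starts at \<open>q = 1\<close>, hence the shift by \<^const>\<open>Suc\<close>; it is a sum of nonnegative
  terms, taken in \<open>[0, \<infinity>]\<close>.\<close>

definition volume_sum :: "nat \<Rightarrow> (real \<Rightarrow> real) \<Rightarrow> (nat \<Rightarrow> real) \<Rightarrow> ennreal" where
  "volume_sum n f \<psi> = (\<Sum>k. let q = Suc k in ennreal (real q ^ n * f (\<psi> q / real q)))"

end

theory Submission
  imports Defs
begin

text \<open>
  In the convergence case the obvious cover by cubes suffices.  For divergence put
  \<open>\<rho> q = f (\<psi> q / q) powr (1 / n)\<close>, which is decreasing with \<open>\<Sum> q\<^sup>n \<rho>(q)\<^sup>n = \<infinity>\<close>.  By Dirichlet's theorem,
  each cube contains about \<open>Q\<^sup>n\<^sup>+\<^sup>1\<close> well separated rationals with denominator of order \<open>Q\<close>;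
  a greedy selection along the scales \<open>Q = b\<^sup>t\<close> yields disjoint cubes of radius at most \<open>\<rho> q\<close> about rationals \<open>p / q\<close> that
  fill a fixed proportion of the given cube.  By the \<open>limsup\<close> hypothesis the shift moves a rational by \<open>O(\<rho> q)\<close>,
  so after a Vitali selection the same is true, with a smaller proportion, for cubes of radius
  \<open>s \<rho> q\<close> about the shifted points, for every \<open>s > 0\<close>; a positive proportion in all cubes means full measure.
  If \<open>f r\<close> is comparable to \<open>r\<^sup>n\<close>, then \<open>\<rho> q\<close> is comparable to \<open>\<psi> q / q\<close>, and \<open>W\<close> itself has full measure.
  If \<open>f r / r\<^sup>n \<rightarrow> \<infinity>\<close>, mass transference gives infinite measure.  Instead of a measure on a Cantor set,
  it is proved by a pigeonhole argument: against any cover of small cost one finds nested cubes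
  of side \<open>\<psi> q / q\<close> such that the sets of the cover meeting the cube cost at most a small multiple of \<open>f (\<psi> q / q)\<close>;
  the common point of these cubes is in \<open>W\<close> but is not covered.  The radius \<open>s \<rho> q\<close> with small \<open>s\<close>
  allows the children of a cube to have arbitrarily large total weight.
\<close>

section \<open>Cubes in the maximum norm\<close>

text \<open>One case is missing from the overview: if f r / r^n has lower limit 0 at 0, fine grids
  show that the unit cube itself is null, and both sides vanish. Otherwise f is positive on the
  positive reals, and since the quotient is monotone it is either bounded near 0 or tends to
  infinity there.

  The obstacle is that f need not be doubling, so no constant may be lost inside f. This is why the
  nested cells have side, not radius, \<psi> q / q: their diameter then costs exactly f (\<psi> q /
  q) = \<rho> q ^ n. All constants go into the radii s * \<rho> q, where they only change volumes by
  a factor.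

  The pigeonhole argument has to cope with covering sets that meet several children. Such a set must
  cross the gaps around them, so the weight of the children it meets is bounded by a multiple of its
  volume. The decreasing quotient makes a set smaller than the parent at least as expensive per
  volume as the parent, so it can pay for that weight.\<close>

lemma infnorm_less_iff: "infnorm (x :: real ^ 'n) < r \<longleftrightarrow> (\<forall>i. \<bar>x $ i\<bar> < r)"
proof -
  have "(\<lambda>i. \<bar>x \<bullet> i\<bar>) ` Basis = range (\<lambda>i. \<bar>x $ i\<bar>)"
    by (auto simp: Basis_vec_def inner_axis image_iff)
  then show ?thesis by (simp add: infnorm_Max)
qed

lemma infnorm_le_iff: "infnorm (x :: real ^ 'n) \<le> r \<longleftrightarrow> (\<forall>i. \<bar>x $ i\<bar> \<le> r)"
proof -
  have "(\<lambda>i. \<bar>x \<bullet> i\<bar>) ` Basis = range (\<lambda>i. \<bar>x $ i\<bar>)"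
    by (auto simp: Basis_vec_def inner_axis image_iff)
  then show ?thesis by (simp add: infnorm_Max)
qed

lemma infnorm_triangle3:
  fixes x y z :: "real ^ 'n"
  shows "infnorm (x - z) \<le> infnorm (x - y) + infnorm (y - z)"
  using infnorm_triangle[of "x - y" "y - z"] by simp

text \<open>The second argument is half the side, so the volume is (2 * r) ^ n. Open cubes carry the
  packings and the limsup sets, closed ones the compactness argument and the covers for Hausdorff
  measure.\<close>

definition ocube :: "real ^ 'n \<Rightarrow> real \<Rightarrow> (real ^ 'n) set" where
  "ocube x r = {y. infnorm (y - x) < r}"

definition ccube :: "real ^ 'n \<Rightarrow> real \<Rightarrow> (real ^ 'n) set" where
  "ccube x r = {y. infnorm (y - x) \<le> r}"

lemma ocube_eq_box: "ocube x r = box (x - vec r) (x + vec r)"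
proof -
  have "(\<forall>i. \<bar>y $ i - x $ i\<bar> < r) \<longleftrightarrow> (\<forall>i. x $ i - r < y $ i \<and> y $ i < x $ i + r)" for y
    by (intro iff_allI) linarith
  then show ?thesis
    by (auto simp: ocube_def infnorm_less_iff mem_box_cart)
qed

lemma ccube_eq_cbox: "ccube x r = cbox (x - vec r) (x + vec r)"
proof -
  have "(\<forall>i. \<bar>y $ i - x $ i\<bar> \<le> r) \<longleftrightarrow> (\<forall>i. x $ i - r \<le> y $ i \<and> y $ i \<le> x $ i + r)" for y
    by (intro iff_allI) linarith
  then show ?thesis
    by (auto simp: ccube_def infnorm_le_iff mem_box_cart)
qed

lemma open_ocube [simp]: "open (ocube x r)"
  by (simp add: ocube_eq_box open_box)

lemma lmeasurable_ocube [simp]: "ocube x r \<in> lmeasurable"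
  by (simp add: ocube_eq_box)

lemma content_ocube:
  fixes x :: "real ^ 'n"
  assumes "0 \<le> r"
  shows "measure lborel (ocube x r) = (2 * r) ^ CARD('n)"
proof -
  have "x - vec r \<in> cbox (x - vec r) (x + vec r)"
    using assms by (simp add: mem_box_cart)
  then have "measure lborel (cbox (x - vec r) (x + vec r)) = (2 * r) ^ CARD('n)"
    by (subst content_cbox_cart) auto
  then show ?thesis
    by (simp add: ocube_eq_box measure_def emeasure_lborel_box_eq emeasure_lborel_cbox_eq)
qed

lemma measure_ocube:
  fixes x :: "real ^ 'n"
  assumes "0 \<le> r"
  shows "measure lebesgue (ocube x r) = (2 * r) ^ CARD('n)"
  using content_ocube[OF assms, of x] by simp

lemma emeasure_lborel_ocube [simp]: "emeasure lborel (ocube x r) \<noteq> top"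
  using emeasure_lborel_box_finite[of "x - vec r" "x + vec r"] by (auto simp: ocube_eq_box)

lemma center_mem_ocube [simp]: "x \<in> ocube x r \<longleftrightarrow> 0 < r"
  by (simp add: ocube_def infnorm_0)

lemma ocube_subset:
  assumes "infnorm (x - y) + r \<le> s"
  shows "ocube x r \<subseteq> ocube y s"
proof
  fix z assume "z \<in> ocube x r"
  then show "z \<in> ocube y s"
    using assms infnorm_triangle3[of z y x] by (simp add: ocube_def)
qed

lemma ocube_mono: "r \<le> s \<Longrightarrow> ocube x r \<subseteq> ocube x s"
  by (auto simp: ocube_def)

lemma ocube_Int_imp:
  assumes "ocube x r \<inter> ocube y s \<noteq> {}"
  shows "infnorm (x - y) < r + s"
proof -
  obtain z where z: "z \<in> ocube x r" "z \<in> ocube y s" using assms by auto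
  then show ?thesis
    using infnorm_triangle3[of x y z] infnorm_sub[of x z] by (simp add: ocube_def)
qed

section \<open>Volume bounds and Vitali selection for finite families of cubes\<close>

lemma sum_cube_packing:
  fixes z :: "'i \<Rightarrow> real ^ 'n"
  assumes "finite J" "disjoint_family_on (\<lambda>j. ocube (z j) (s j)) J"
    and "\<And>j. j \<in> J \<Longrightarrow> 0 \<le> s j"
    and "A \<in> lmeasurable" "\<And>j. j \<in> J \<Longrightarrow> ocube (z j) (s j) \<subseteq> A"
  shows "(\<Sum>j\<in>J. (2 * s j) ^ CARD('n)) \<le> measure lebesgue A"
proof -
  have "(\<Sum>j\<in>J. (2 * s j) ^ CARD('n)) = (\<Sum>j\<in>J. measure lebesgue (ocube (z j) (s j)))"
    using assms by (intro sum.cong) (simp_all add: content_ocube)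
  also have "\<dots> = measure lebesgue (\<Union>j\<in>J. ocube (z j) (s j))"
    using assms
    by (intro measure_finite_Union[symmetric])
      (auto simp: image_subset_iff emeasure_lborel_ocube)
  also have "\<dots> \<le> measure lebesgue A"
    using assms by (intro measure_mono_fmeasurable) auto
  finally show ?thesis .
qed

lemma sum_cube_packing_ocube:
  fixes z :: "'i \<Rightarrow> real ^ 'n"
  assumes "finite J" "disjoint_family_on (\<lambda>j. ocube (z j) (s j)) J"
    and "\<And>j. j \<in> J \<Longrightarrow> 0 \<le> s j"
    and "\<And>j. j \<in> J \<Longrightarrow> ocube (z j) (s j) \<subseteq> ocube x R" and "0 \<le> R"
  shows "(\<Sum>j\<in>J. s j ^ CARD('n)) \<le> R ^ CARD('n)"
proof -
  have "(\<Sum>j\<in>J. (2 * s j) ^ CARD('n)) \<le> (2 * R) ^ CARD('n)"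
    using sum_cube_packing[OF assms(1-3) lmeasurable_ocube assms(4)] assms(5)
    by (simp add: content_ocube)
  then show ?thesis
    by (simp add: power_mult_distrib flip: sum_distrib_left)
qed

lemma measure_UN_ocube_le:
  fixes z :: "'i \<Rightarrow> real ^ 'n"
  assumes "finite J" "\<And>j. j \<in> J \<Longrightarrow> 0 \<le> s j"
  shows "measure lebesgue (\<Union>j\<in>J. ocube (z j) (s j)) \<le> (\<Sum>j\<in>J. (2 * s j) ^ CARD('n))"
proof -
  have "measure lebesgue (\<Union>j\<in>J. ocube (z j) (s j)) \<le> (\<Sum>j\<in>J. measure lebesgue (ocube (z j) (s j)))"
    using assms by (intro measure_UNION_le) (auto intro: fmeasurableD)
  also have "\<dots> = (\<Sum>j\<in>J. (2 * s j) ^ CARD('n))"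
    using assms by (intro sum.cong) (simp_all add: content_ocube)
  finally show ?thesis .
qed

text \<open>Greedy choice by size: a cube of largest radius is kept, every cube that meets it lies
  in its threefold enlargement, and the induction continues with the cubes disjoint from it.\<close>

lemma finite_Vitali_ocube:
  fixes z :: "'i \<Rightarrow> real ^ 'n"
  assumes "finite I" "\<And>i. i \<in> I \<Longrightarrow> 0 < s i"
  obtains J where "J \<subseteq> I" "disjoint_family_on (\<lambda>j. ocube (z j) (s j)) J"
    "(\<Union>i\<in>I. ocube (z i) (s i)) \<subseteq> (\<Union>j\<in>J. ocube (z j) (3 * s j))"
proof -
  have "\<exists>J\<subseteq>I. disjoint_family_on (\<lambda>j. ocube (z j) (s j)) J \<and>
    (\<Union>i\<in>I. ocube (z i) (s i)) \<subseteq> (\<Union>j\<in>J. ocube (z j) (3 * s j))"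
    using assms
  proof (induction I rule: finite_psubset_induct)
    case (psubset I)
    show ?case
    proof (cases "I = {}")
      case False
      obtain m where m: "m \<in> I" "\<And>i. i \<in> I \<Longrightarrow> s i \<le> s m"
      proof -
        have "Max (s ` I) \<in> s ` I" using False \<open>finite I\<close> by simp
        then obtain m where "m \<in> I" "s m = Max (s ` I)" by auto
        then show ?thesis using \<open>finite I\<close> that by auto
      qed
      define I' where "I' = {i \<in> I. ocube (z i) (s i) \<inter> ocube (z m) (s m) = {}}"
      have "m \<notin> I'"
        using m psubset.prems center_mem_ocube[of "z m" "s m"] by (auto simp: I'_def simp del: center_mem_ocube)
      then have "I' \<subset> I" using m by (auto simp: I'_def)
      then obtain J where J: "J \<subseteq> I'" "disjoint_family_on (\<lambda>j. ocube (z j) (s j)) J"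
        "(\<Union>i\<in>I'. ocube (z i) (s i)) \<subseteq> (\<Union>j\<in>J. ocube (z j) (3 * s j))"
        using psubset.IH[of I'] psubset.prems by (meson psubset_imp_subset subsetD)
      have "insert m J \<subseteq> I" using J m by (auto simp: I'_def)
      moreover have "disjoint_family_on (\<lambda>j. ocube (z j) (s j)) (insert m J)"
        using J \<open>m \<notin> I'\<close> by (subst disjoint_family_on_insert) (auto simp: I'_def)
      moreover have "ocube (z i) (s i) \<subseteq> (\<Union>j\<in>insert m J. ocube (z j) (3 * s j))" if "i \<in> I" for i
      proof (cases "i \<in> I'")
        case True
        then show ?thesis using J(3) by auto
      next
        case False
        then have "infnorm (z i - z m) < s i + s m"
          using that by (intro ocube_Int_imp) (auto simp: I'_def)
        then have "ocube (z i) (s i) \<subseteq> ocube (z m) (3 * s m)"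
          using m(2)[OF that] by (intro ocube_subset) simp
        then show ?thesis by auto
      qed
      ultimately show ?thesis by blast
    qed (auto simp: disjoint_family_on_def)
  qed
  then show ?thesis using that by blast
qed

text \<open>This turns a lower bound for a covered volume into one for a sum over disjoint cubes;
  the enlarged cube of radius \<open>3 * s j\<close> has side \<open>6 * s j\<close>.\<close>

lemma finite_Vitali_measure:
  fixes z :: "'i \<Rightarrow> real ^ 'n"
  assumes "finite I" "\<And>i. i \<in> I \<Longrightarrow> 0 < s i"
    and "A \<subseteq> (\<Union>i\<in>I. ocube (z i) (s i))" "A \<in> sets lebesgue"
  obtains J where "J \<subseteq> I" "disjoint_family_on (\<lambda>j. ocube (z j) (s j)) J"
    "measure lebesgue A \<le> (\<Sum>j\<in>J. (6 * s j) ^ CARD('n))"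
proof -
  obtain J where J: "J \<subseteq> I" "disjoint_family_on (\<lambda>j. ocube (z j) (s j)) J"
    "(\<Union>i\<in>I. ocube (z i) (s i)) \<subseteq> (\<Union>j\<in>J. ocube (z j) (3 * s j))"
    by (rule finite_Vitali_ocube[OF assms(1,2), where z = z])
  have fin: "finite J" using J assms finite_subset by blast
  have "measure lebesgue A \<le> measure lebesgue (\<Union>j\<in>J. ocube (z j) (3 * s j))"
    using J(3) assms(3,4) fin by (intro measure_mono_fmeasurable) auto
  also have "\<dots> \<le> (\<Sum>j\<in>J. (2 * (3 * s j)) ^ CARD('n))"
    using J assms fin by (intro measure_UN_ocube_le) (auto intro!: less_imp_le)
  finally show ?thesis using J that by simp
qed

section \<open>Rational points\<close>

definition rat_pt :: "int ^ 'n \<Rightarrow> nat \<Rightarrow> real ^ 'n" where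
  "rat_pt p q = (1 / real q) *\<^sub>R int_vec p"

lemma rat_pt_nth [simp]: "rat_pt p q $ i = real_of_int (p $ i) / real q"
  by (simp add: rat_pt_def int_vec_def)

lemma rat_pt_separated:
  assumes "p \<noteq> p'" "1 \<le> q"
  shows "1 / real q \<le> infnorm (rat_pt p q - rat_pt p' q)"
proof -
  obtain i where "p $ i \<noteq> p' $ i" using assms by (auto simp: vec_eq_iff)
  then have "1 \<le> \<bar>p $ i - p' $ i\<bar>" by linarith
  then have "1 \<le> \<bar>real_of_int (p $ i) - real_of_int (p' $ i)\<bar>" by linarith
  then have "1 / real q \<le> \<bar>real_of_int (p $ i) - real_of_int (p' $ i)\<bar> / real q"
    using assms by (intro divide_right_mono) auto
  also have "\<dots> = \<bar>(rat_pt p q - rat_pt p' q) $ i\<bar>"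
    by (simp add: abs_divide diff_divide_distrib[symmetric])
  also have "\<dots> \<le> infnorm (rat_pt p q - rat_pt p' q)"
    by (rule component_le_infnorm_cart)
  finally show ?thesis .
qed

text \<open>Distinct rationals with denominator q are at distance at least 1 / q, so the cubes of
  radius 1 / (2 q) about them are disjoint; they fit into the cube of radius R + 1 / (2 q) about
  x.\<close>

lemma card_rat_pt_le:
  fixes x :: "real ^ 'n"
  assumes "1 \<le> q" "0 \<le> R" "finite P"
    and "\<And>p. p \<in> P \<Longrightarrow> infnorm (rat_pt p q - x) \<le> R"
  shows "real (card P) \<le> (2 * real q * R + 1) ^ CARD('n)"
proof -
  have q: "real q > 0" using assms by simp
  have "(\<Sum>p\<in>P. (1 / (2 * real q)) ^ CARD('n)) \<le> (R + 1 / (2 * real q)) ^ CARD('n)"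
  proof (rule sum_cube_packing_ocube)
    show "disjoint_family_on (\<lambda>p. ocube (rat_pt p q) (1 / (2 * real q))) P"
      unfolding disjoint_family_on_def
    proof (intro ballI impI, rule ccontr)
      fix p p' assume "p \<noteq> p'"
        "ocube (rat_pt p q) (1 / (2 * real q)) \<inter> ocube (rat_pt p' q) (1 / (2 * real q)) \<noteq> {}"
      then have "infnorm (rat_pt p q - rat_pt p' q) < 1 / (2 * real q) + 1 / (2 * real q)"
        by (intro ocube_Int_imp)
      moreover have "1 / (2 * real q) + 1 / (2 * real q) = 1 / real q" by (simp add: field_simps)
      ultimately show False using rat_pt_separated[OF \<open>p \<noteq> p'\<close> assms(1)] by simp
    qed
    show "ocube (rat_pt p q) (1 / (2 * real q)) \<subseteq> ocube x (R + 1 / (2 * real q))" if "p \<in> P" for p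
      using assms(4)[OF that] by (intro ocube_subset) simp
  qed (use assms in auto)
  then have "real (card P) * (1 / (2 * real q)) ^ CARD('n) * (2 * real q) ^ CARD('n)
      \<le> (R + 1 / (2 * real q)) ^ CARD('n) * (2 * real q) ^ CARD('n)"
    by (intro mult_right_mono) auto
  also have "(R + 1 / (2 * real q)) ^ CARD('n) * (2 * real q) ^ CARD('n)
      = ((R + 1 / (2 * real q)) * (2 * real q)) ^ CARD('n)"
    by (simp add: power_mult_distrib)
  also have "(R + 1 / (2 * real q)) * (2 * real q) = 2 * real q * R + 1"
    using q by (simp add: field_simps)
  finally show ?thesis using q by (simp add: power_divide)
qed

lemma finite_rat_pt:
  fixes x :: "real ^ 'n"
  assumes "1 \<le> q"
  shows "finite {p. infnorm (rat_pt p q - x) \<le> R}"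
proof (cases "0 \<le> R")
  case True
  \<comment> \<open>The packing bound is about finite sets only; being uniform over all finite
    subsets, it yields finiteness.\<close>
  show ?thesis
  proof (rule finite_if_finite_subsets_card_bdd[of _ "nat \<lceil>(2 * real q * R + 1) ^ CARD('n)\<rceil>", THEN conjunct1])
    fix P assume "P \<subseteq> {p. infnorm (rat_pt p q - x) \<le> R}" "finite P"
    then have "real (card P) \<le> (2 * real q * R + 1) ^ CARD('n)"
      using assms True by (intro card_rat_pt_le[where x = x]) auto
    then show "card P \<le> nat \<lceil>(2 * real q * R + 1) ^ CARD('n)\<rceil>" by linarith
  qed
next
  case False
  then have "{p. infnorm (rat_pt p q - x) \<le> R} = {}"
    using infnorm_pos_le order_trans by blast
  then show ?thesis by simp
qed

section \<open>Well separated rationals from simultaneous approximation\<close>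

lemma Dirichlet_approx_vec:
  fixes y :: "real ^ 'n"
  assumes "0 < N"
  obtains p q where "1 \<le> q" "q \<le> N ^ CARD('n)" "infnorm (y - rat_pt p q) < 1 / (real q * real N)"
proof -
  \<comment> \<open>The simultaneous approximation theorem numbers its reals by 0, ..., n - 1;
    \<open>h\<close> transports it to the index type.\<close>
  obtain h where h: "bij_betw h {0..<CARD('n)} (UNIV :: 'n set)"
    using ex_bij_betw_nat_finite[of "UNIV :: 'n set"] by auto
  obtain a b where ab: "0 < a" "a \<le> int (N ^ CARD('n))"
    "\<And>i. i < CARD('n) \<Longrightarrow> \<bar>of_int a * (y $ h i) - of_int (b i)\<bar> < 1 / real N"
    by (rule Dirichlet_approx_simult[OF assms, of "CARD('n)" "\<lambda>i. y $ h i"]) (blast intro: that)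
  define p :: "int ^ 'n" where "p = (\<chi> j. b (inv_into {0..<CARD('n)} h j))"
  have "\<bar>(y - rat_pt p (nat a)) $ j\<bar> < 1 / (real (nat a) * real N)" for j
  proof -
    define i where "i = inv_into {0..<CARD('n)} h j"
    have i: "i < CARD('n)" "h i = j"
      using h by (auto simp: i_def bij_betw_def f_inv_into_f inv_into_into
          intro: inv_into_into[of j h "{0..<CARD('n)}", simplified])
    have "\<bar>(y - rat_pt p (nat a)) $ j\<bar> = \<bar>of_int a * (y $ h i) - of_int (b i)\<bar> / of_int a"
      using ab i by (simp add: p_def flip: i_def) (simp add: abs_if field_simps)
    also have "\<dots> < 1 / real N / of_int a"
      using ab i by (intro divide_strict_right_mono) auto
    finally show ?thesis using ab by (simp add: mult.commute)
  qed
  then have "infnorm (y - rat_pt p (nat a)) < 1 / (real (nat a) * real N)"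
    by (simp add: infnorm_less_iff)
  moreover have "1 \<le> nat a" "nat a \<le> N ^ CARD('n)" using ab by linarith+
  ultimately show ?thesis using that by blast
qed

text \<open>By Dirichlet, the cubes of radius \<open>1 / (q N)\<close> about the rationals with \<open>q \<le> N\<^sup>n\<close> cover.
  Those with \<open>k q \<le> N\<^sup>n\<close> have small total volume, so the others, which all have comparable radii,
  cover at least half; the points come from a Vitali selection among the latter.\<close>

lemma many_separated_rationals:
  fixes x :: "real ^ 'n"
  defines "n \<equiv> CARD('n)"
  defines "k \<equiv> 4 * 6 ^ n"
  assumes r: "0 < r"
  obtains N\<^sub>0 where "1 \<le> N\<^sub>0"
    "\<And>N :: nat. N\<^sub>0 \<le> N \<Longrightarrow> \<exists>P. finite P \<and>
       (\<forall>(p, q) \<in> P. Q\<^sub>0 \<le> q \<and> 1 \<le> q \<and> q \<le> N ^ n \<and> rat_pt p q \<in> ocube x r) \<and>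
       disjoint_family_on (\<lambda>(p, q). ocube (rat_pt p q) (real k / real N ^ (n + 1))) P \<and>
       r ^ n * real N ^ (n * (n + 1)) \<le> 2 * (6 * real k) ^ n * real (card P)"
proof -
  have n: "1 \<le> n" by (simp add: n_def Suc_le_eq)
  have k: "0 < real k" by (simp add: k_def)
  \<comment> \<open>Denominators q \<ge> q0 satisfy 1 / q < r, so the +1 in the count (2 q r + 1)^n
    is harmless; the finitely many smaller ones are absorbed by a large N. The bound 2 / r below
    keeps the approximants to points of the half-size cube \<open>G\<close> inside the given
    cube.\<close>
  obtain q0 :: nat where q0: "1 / r < real q0" using reals_Archimedean2 by blast
  have "\<exists>N1 :: nat. max (2 / r) (4 * real q0 * (4 * r + 2) ^ n / r ^ n) < real N1"
    using reals_Archimedean2 by blast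
  then obtain N1 :: nat where N1: "2 / r < real N1" "4 * real q0 * (4 * r + 2) ^ n / r ^ n < real N1"
    by auto
  show ?thesis
  proof (rule that[of "max 1 (max N1 (k * Q\<^sub>0))"])
    fix N assume "max 1 (max N1 (k * Q\<^sub>0)) \<le> N"
    then have N: "1 \<le> N" "N1 \<le> N" "k * Q\<^sub>0 \<le> N" by auto
    define Q where "Q = N ^ n"
    have NQ: "N \<le> Q" using N n by (simp add: Q_def self_le_power)
    have Q: "0 < real Q" "real Q = real N ^ n" using N by (auto simp: Q_def)
    define S where "S = (SIGMA q:{1..Q}. {p. rat_pt p q \<in> ocube x r})"
    have finS: "finite {p. rat_pt p q \<in> ocube x r}" if "1 \<le> q" for q
      by (rule finite_subset[OF _ finite_rat_pt[OF that, of x r]]) (auto simp: ocube_def)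
    have "finite S" using finS by (auto simp: S_def)
    define G where "G = ocube x (r / 2)"
    define B where "B = {(q, p) \<in> S. k * q \<le> Q}"
    define I where "I = {(q, p) \<in> S. Q < k * q}"
    define U where "U = (\<Union>(q, p)\<in>B. ocube (rat_pt p q) (1 / (real q * real N)))"
    have cover: "\<exists>(q, p) \<in> S. y \<in> ocube (rat_pt p q) (1 / (real q * real N))" if "y \<in> G" for y
    proof -
      have "0 < N" using N by simp
      then obtain p q where pq: "1 \<le> q" "q \<le> N ^ CARD('n)" "infnorm (y - rat_pt p q) < 1 / (real q * real N)"
        by (rule Dirichlet_approx_vec)
      have "1 / (real q * real N) \<le> 1 / real N"
        using pq N by (intro divide_left_mono) (auto simp: mult_le_cancel_right1)
      also have "\<dots> \<le> r / 2"
        using N N1 r by (simp add: field_simps) (smt (verit) mult_left_mono of_nat_mono)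
      finally have "infnorm (rat_pt p q - x) < r"
        using pq that infnorm_triangle3[of "rat_pt p q" x y] infnorm_sub[of y "rat_pt p q"]
        by (simp add: G_def ocube_def)
      then show ?thesis using pq by (auto simp: S_def Q_def n_def ocube_def intro!: bexI[of _ "(q, p)"])
    qed
    have finB: "finite B" "finite I"
      using \<open>finite S\<close> by (auto intro: finite_subset simp: B_def I_def)
    have U_meas: "U \<in> lmeasurable"
      unfolding U_def using finB by (intro fmeasurable.finite_UN) auto
    have B_eq: "B = (SIGMA q:{q \<in> {1..Q}. k * q \<le> Q}. {p. rat_pt p q \<in> ocube x r})"
      by (auto simp: B_def S_def)
    have "card {q \<in> {1..Q}. k * q \<le> Q} \<le> card {1..Q div k}"
      using k by (intro card_mono) (auto simp: less_eq_div_iff_mult_less_eq mult.commute k_def)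
    also have "real \<dots> \<le> real Q / real k" by (simp add: of_nat_div_le_of_nat)
    finally have cardq: "real (card {q \<in> {1..Q}. k * q \<le> Q}) \<le> real Q / real k" by simp
    \<comment> \<open>Denominator q contributes at most (4 r + 2 / q)^n / Q, almost the same for
      every large q, and there are at most Q / k denominators. The choice k = 4 * 6^n makes the main
      part r^n / 4.\<close>
    have "measure lebesgue U \<le> (\<Sum>(q, p)\<in>B. (2 * (1 / (real q * real N))) ^ n)"
      unfolding U_def n_def case_prod_unfold using finB by (intro measure_UN_ocube_le) auto
    also have "\<dots> = (\<Sum>q | q \<in> {1..Q} \<and> k * q \<le> Q.
        real (card {p. rat_pt p q \<in> ocube x r}) * (2 * (1 / (real q * real N))) ^ n)"
      unfolding B_eq by (subst sum.Sigma[symmetric]) (use finS in auto)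
    also have "\<dots> \<le> (\<Sum>q | q \<in> {1..Q} \<and> k * q \<le> Q.
        (6 * r) ^ n / real Q + (if q < q0 then (4 * r + 2) ^ n / real Q else 0))"
    proof (rule sum_mono)
      fix q assume "q \<in> {q. q \<in> {1..Q} \<and> k * q \<le> Q}"
      then have q: "1 \<le> q" "0 < real q" by auto
      have "real (card {p. rat_pt p q \<in> ocube x r}) \<le> (2 * real q * r + 1) ^ n"
        unfolding n_def using q r finS by (intro card_rat_pt_le[where x = x]) (auto simp: ocube_def)
      then have "real (card {p. rat_pt p q \<in> ocube x r}) * (2 * (1 / (real q * real N))) ^ n
          \<le> (2 * real q * r + 1) ^ n * (2 * (1 / (real q * real N))) ^ n"
        by (intro mult_right_mono) auto
      also have "\<dots> = ((4 * r + 2 / real q) / real N) ^ n"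
        using q N unfolding power_mult_distrib[symmetric]
        by (intro arg_cong[of _ _ "\<lambda>u. u ^ n"]) (simp add: field_simps)
      also have "\<dots> = (4 * r + 2 / real q) ^ n / real Q"
        by (simp add: power_divide Q)
      also have "\<dots> \<le> (6 * r) ^ n / real Q + (if q < q0 then (4 * r + 2) ^ n / real Q else 0)"
      proof (cases "q < q0")
        case True
        have "2 / real q \<le> 2" using q by (simp add: field_simps)
        then have "(4 * r + 2 / real q) ^ n \<le> (4 * r + 2) ^ n"
          using r by (intro power_mono) auto
        then have "(4 * r + 2 / real q) ^ n / real Q \<le> (4 * r + 2) ^ n / real Q"
          using Q by (intro divide_right_mono) auto
        moreover have "0 \<le> (6 * r) ^ n / real Q" using r by simp
        ultimately show ?thesis using True by simp
      next
        case False
        then have "1 / r < real q" using q0 by linarith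
        then have "1 / real q < r" using r q by (simp add: field_simps)
        then have "4 * r + 2 / real q \<le> 6 * r" by simp
        then have "(4 * r + 2 / real q) ^ n \<le> (6 * r) ^ n"
          using r by (intro power_mono) auto
        then have "(4 * r + 2 / real q) ^ n / real Q \<le> (6 * r) ^ n / real Q"
          using Q by (intro divide_right_mono) auto
        then show ?thesis using False by simp
      qed
      finally show "real (card {p. rat_pt p q \<in> ocube x r}) * (2 * (1 / (real q * real N))) ^ n
          \<le> (6 * r) ^ n / real Q + (if q < q0 then (4 * r + 2) ^ n / real Q else 0)" .
    qed
    also have "\<dots> \<le> r ^ n / 4 + r ^ n / 4"
      unfolding sum.distrib
    proof (rule add_mono)
      have "(\<Sum>q | q \<in> {1..Q} \<and> k * q \<le> Q. (6 * r) ^ n / real Q)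
          = real (card {q \<in> {1..Q}. k * q \<le> Q}) * ((6 * r) ^ n / real Q)"
        by simp
      also have "\<dots> \<le> real Q / real k * ((6 * r) ^ n / real Q)"
        using cardq r by (intro mult_right_mono) auto
      also have "\<dots> = r ^ n / 4"
        using Q r by (simp add: k_def power_mult_distrib)
      finally show "(\<Sum>q | q \<in> {1..Q} \<and> k * q \<le> Q. (6 * r) ^ n / real Q) \<le> r ^ n / 4" .
      have "(\<Sum>q | q \<in> {1..Q} \<and> k * q \<le> Q. if q < q0 then (4 * r + 2) ^ n / real Q else 0)
          = real (card {q. (q \<in> {1..Q} \<and> k * q \<le> Q) \<and> q < q0}) * ((4 * r + 2) ^ n / real Q)"
        by (subst sum.If_cases) (auto simp: Collect_conj_eq[symmetric] Int_def)
      also have "\<dots> \<le> real (card {..<q0}) * ((4 * r + 2) ^ n / real Q)"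
        using r by (intro mult_right_mono of_nat_mono card_mono) auto
      also have "\<dots> \<le> r ^ n / 4"
      proof -
        have "4 * real q0 * (4 * r + 2) ^ n / r ^ n \<le> real Q"
          using N1 N NQ by linarith
        then show ?thesis using r Q by (simp add: field_simps)
      qed
      finally show "(\<Sum>q | q \<in> {1..Q} \<and> k * q \<le> Q. if q < q0 then (4 * r + 2) ^ n / real Q else 0)
          \<le> r ^ n / 4" .
    qed
    finally have U_le: "measure lebesgue U \<le> r ^ n / 2" by simp
    \<comment> \<open>For k q > Q the radius 1 / (q N) is at most k / (Q N) =
      \<open>\<delta>\<close>, so one radius serves all remaining rationals.\<close>
    define \<delta> where "\<delta> = real k / real N ^ (n + 1)"
    have "0 < \<delta>" using k N by (simp add: \<delta>_def)
    have "G - U \<subseteq> (\<Union>i\<in>I. ocube (case i of (q, p) \<Rightarrow> rat_pt p q) \<delta>)"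
    proof
      fix y assume "y \<in> G - U"
      then obtain q p where qp: "(q, p) \<in> S" "y \<in> ocube (rat_pt p q) (1 / (real q * real N))"
        using cover by blast
      then have "(q, p) \<notin> B" using \<open>y \<in> G - U\<close> by (auto simp: U_def)
      then have qpI: "(q, p) \<in> I" "Q < k * q" using qp by (auto simp: I_def B_def)
      then have "real Q \<le> real k * real q" by (metis less_imp_le of_nat_le_iff of_nat_mult)
      moreover have "0 < q" using qp by (auto simp: S_def)
      ultimately have "1 / (real q * real N) \<le> \<delta>"
        using N Q by (simp add: \<delta>_def field_simps)
      then have "y \<in> ocube (rat_pt p q) \<delta>" using qp ocube_mono by blast
      then show "y \<in> (\<Union>i\<in>I. ocube (case i of (q, p) \<Rightarrow> rat_pt p q) \<delta>)"
        using qpI by force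
    qed
    moreover have "G - U \<in> sets lebesgue" using U_meas by (auto simp: G_def)
    ultimately obtain J where J: "J \<subseteq> I"
      "disjoint_family_on (\<lambda>i. ocube (case i of (q, p) \<Rightarrow> rat_pt p q) \<delta>) J"
      "measure lebesgue (G - U) \<le> (\<Sum>j\<in>J. (6 * \<delta>) ^ CARD('n))"
      using finite_Vitali_measure[OF finB(2), of "\<lambda>_. \<delta>" "G - U" "\<lambda>i. case i of (q, p) \<Rightarrow> rat_pt p q"]
        \<open>0 < \<delta>\<close> by metis
    have "r ^ n = measure lebesgue G"
      unfolding G_def n_def using r by (subst measure_ocube) auto
    also have "\<dots> \<le> measure lebesgue ((G - U) \<union> U)"
      using U_meas by (intro measure_mono_fmeasurable fmeasurable.Un fmeasurable.Diff) (auto simp: G_def)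
    also have "\<dots> \<le> measure lebesgue (G - U) + measure lebesgue U"
      using U_meas by (intro measure_Un_le) (auto simp: G_def)
    finally have "r ^ n / 2 \<le> measure lebesgue (G - U)" using U_le by simp
    also have "\<dots> \<le> real (card J) * (6 * \<delta>) ^ n" using J(3) by (simp add: n_def)
    also have "\<dots> = (6 * real k) ^ n * real (card J) / real N ^ (n * (n + 1))"
      by (simp add: \<delta>_def power_divide power_mult_distrib power_add power_mult[symmetric] mult.commute)
    finally have cardJ: "r ^ n * real N ^ (n * (n + 1)) \<le> 2 * (6 * real k) ^ n * real (card J)"
      using N by (simp add: field_simps)
    let ?P = "prod.swap ` J"
    have "finite J" using J(1) finB finite_subset by blast
    have cardP: "card ?P = card J" by (simp add: card_image)
    have dis: "disjoint_family_on (\<lambda>(p, q). ocube (rat_pt p q) \<delta>) ?P"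
      using J(2) unfolding disjoint_family_on_def by force
    have mem: "\<forall>(p, q) \<in> ?P. Q\<^sub>0 \<le> q \<and> 1 \<le> q \<and> q \<le> N ^ n \<and> rat_pt p q \<in> ocube x r"
    proof
      fix j assume "j \<in> ?P"
      then obtain p q where j: "j = (p, q)" "(q, p) \<in> J" by auto
      then have qp: "(q, p) \<in> S" "Q < k * q" using J by (auto simp: I_def)
      then have "k * Q\<^sub>0 < k * q" using N NQ by linarith
      then have "Q\<^sub>0 \<le> q" by simp
      then show "case j of (p, q) \<Rightarrow> Q\<^sub>0 \<le> q \<and> 1 \<le> q \<and> q \<le> N ^ n \<and> rat_pt p q \<in> ocube x r"
        using qp j by (auto simp: S_def Q_def)
    qed
    show "\<exists>P. finite P \<and>
       (\<forall>(p, q) \<in> P. Q\<^sub>0 \<le> q \<and> 1 \<le> q \<and> q \<le> N ^ n \<and> rat_pt p q \<in> ocube x r) \<and>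
       disjoint_family_on (\<lambda>(p, q). ocube (rat_pt p q) (real k / real N ^ (n + 1))) P \<and>
       r ^ n * real N ^ (n * (n + 1)) \<le> 2 * (6 * real k) ^ n * real (card P)"
      by (rule exI[of _ ?P]) (use \<open>finite J\<close> cardP dis mem cardJ in \<open>simp add: \<delta>_def\<close>)
  qed simp
qed

section \<open>From a divergent series to disjoint cubes about rationals\<close>

text \<open>Cauchy condensation with base B: on the block from B^T to B^(T+1) - 1 the power is
  bounded by its value at the right end, \<open>a\<close> by its value at the left end, and the
  number of terms by B^(T+1). The loss is a factor B^(d+1).\<close>

lemma condensation_summable:
  fixes a :: "nat \<Rightarrow> real"
  assumes "antimono_on {1..} a" "\<And>q. 1 \<le> q \<Longrightarrow> 0 \<le> a q" and B: "2 \<le> B"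
    and sm: "summable (\<lambda>t. real (B ^ t) ^ Suc d * a (B ^ t))"
  shows "summable (\<lambda>k. real (Suc k) ^ d * a (Suc k))"
proof -
  have block: "(\<Sum>q = 1..<B ^ T. real q ^ d * a q)
      \<le> real B ^ Suc d * (\<Sum>t<T. real (B ^ t) ^ Suc d * a (B ^ t))" for T
  proof (induction T)
    case (Suc T)
    have pos: "1 \<le> B ^ T" "B ^ T \<le> B ^ Suc T" using B by simp_all
    have "(\<Sum>q = B ^ T..<B ^ Suc T. real q ^ d * a q)
        \<le> (\<Sum>q = B ^ T..<B ^ Suc T. real (B ^ Suc T) ^ d * a (B ^ T))"
    proof (rule sum_mono)
      fix q assume "q \<in> {B ^ T..<B ^ Suc T}"
      then have q: "B ^ T \<le> q" "q \<le> B ^ Suc T" by auto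
      then have "a q \<le> a (B ^ T)"
        using pos by (intro monotone_onD[OF assms(1)]) auto
      moreover have "real q ^ d \<le> real (B ^ Suc T) ^ d"
        using q by (intro power_mono of_nat_mono) auto
      ultimately show "real q ^ d * a q \<le> real (B ^ Suc T) ^ d * a (B ^ T)"
        using assms(2) q pos by (intro mult_mono) auto
    qed
    also have "\<dots> = real (B ^ Suc T - B ^ T) * (real (B ^ Suc T) ^ d * a (B ^ T))"
      by simp
    also have "\<dots> \<le> real (B ^ Suc T) * (real (B ^ Suc T) ^ d * a (B ^ T))"
      using assms(2) pos by (intro mult_right_mono of_nat_mono) auto
    also have "\<dots> = real B ^ Suc d * (real (B ^ T) ^ Suc d * a (B ^ T))"
      by (simp add: power_mult_distrib mult_ac)
    finally have "(\<Sum>q = B ^ T..<B ^ Suc T. real q ^ d * a q)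
      \<le> real B ^ Suc d * (real (B ^ T) ^ Suc d * a (B ^ T))" .
    moreover have "(\<Sum>q = 1..<B ^ Suc T. real q ^ d * a q)
      = (\<Sum>q = 1..<B ^ T. real q ^ d * a q) + (\<Sum>q = B ^ T..<B ^ Suc T. real q ^ d * a q)"
      using pos by (intro sum.atLeastLessThan_concat[symmetric]) auto
    ultimately show ?case
      using Suc.IH by (simp add: distrib_left)
  qed simp
  show ?thesis
  proof (rule summableI_nonneg_bounded)
    show "0 \<le> real (Suc k) ^ d * a (Suc k)" for k using assms(2) by simp
    fix K
    have "K < B ^ K" using B by (intro power_gt_expt) simp
    have "(\<Sum>k<K. real (Suc k) ^ d * a (Suc k)) = (\<Sum>q = 1..K. real q ^ d * a q)"
      by (simp add: sum.atLeast1_atMost_eq)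
    also have "\<dots> \<le> (\<Sum>q = 1..<B ^ K. real q ^ d * a q)"
      using \<open>K < B ^ K\<close> assms(2) by (intro sum_mono2) auto
    also have "\<dots> \<le> real B ^ Suc d * (\<Sum>t<K. real (B ^ t) ^ Suc d * a (B ^ t))"
      by (rule block)
    also have "\<dots> \<le> real B ^ Suc d * (\<Sum>t. real (B ^ t) ^ Suc d * a (B ^ t))"
      using sm assms(2) B by (intro mult_left_mono sum_le_suminf) auto
    finally show "(\<Sum>k<K. real (Suc k) ^ d * a (Suc k))
      \<le> real B ^ Suc d * (\<Sum>t. real (B ^ t) ^ Suc d * a (B ^ t))" .
  qed
qed

text \<open>The packing bound (s / \<delta> + 2)^n is split crudely into two terms so that, summed
  over the cubes chosen earlier, the first is charged to their volume and the second to their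
  number; the greedy selection controls these two quantities separately.\<close>

lemma card_ocube_meet_le:
  fixes z :: "'i \<Rightarrow> real ^ 'n"
  assumes "finite P" "disjoint_family_on (\<lambda>e. ocube (z e) \<delta>) P" "0 < \<delta>" "\<sigma> \<le> \<delta>" "0 \<le> s"
  shows "real (card {e \<in> P. ocube (z e) \<sigma> \<inter> ocube y s \<noteq> {}})
    \<le> 2 ^ CARD('n) * (s / \<delta>) ^ CARD('n) + 4 ^ CARD('n)"
proof -
  let ?E = "{e \<in> P. ocube (z e) \<sigma> \<inter> ocube y s \<noteq> {}}"
  have "(\<Sum>e\<in>?E. \<delta> ^ CARD('n)) \<le> (s + 2 * \<delta>) ^ CARD('n)"
  proof (rule sum_cube_packing_ocube)
    show "disjoint_family_on (\<lambda>e. ocube (z e) \<delta>) ?E"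
      using assms(2) by (rule disjoint_family_on_mono[rotated]) auto
    fix e assume "e \<in> ?E"
    then have "infnorm (z e - y) < \<sigma> + s" by (intro ocube_Int_imp) auto
    then show "ocube (z e) \<delta> \<subseteq> ocube y (s + 2 * \<delta>)"
      using assms by (intro ocube_subset) simp
  qed (use assms in auto)
  moreover have "s + 2 * \<delta> = (s / \<delta> + 2) * \<delta>" using assms by (simp add: field_simps)
  ultimately have "real (card ?E) * \<delta> ^ CARD('n) \<le> (s / \<delta> + 2) ^ CARD('n) * \<delta> ^ CARD('n)"
    by (simp add: power_mult_distrib)
  then have "real (card ?E) \<le> (s / \<delta> + 2) ^ CARD('n)"
    using assms by (subst (asm) mult_le_cancel_right_pos) auto
  also have "\<dots> \<le> (2 * max (s / \<delta>) 2) ^ CARD('n)"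
    using assms by (intro power_mono) auto
  also have "\<dots> \<le> 2 ^ CARD('n) * (s / \<delta>) ^ CARD('n) + 4 ^ CARD('n)"
  proof (cases "s / \<delta> \<le> 2")
    case True
    then show ?thesis using assms by (simp add: max_def)
  next
    case False
    then show ?thesis unfolding power_mult_distrib by (simp add: max_def)
  qed
  finally show ?thesis .
qed

text \<open>Suppose that no admissible family reaches the required volume. Then at every scale the
  cubes chosen so far block at most half of the new rationals: their volume is small by assumption,
  and their number is small because the scales grow geometrically. So each scale adds a fixed
  multiple of its term of a condensed series, while the total volume stays bounded; hence the series
  converges.\<close>

lemma rational_packing:
  fixes x :: "real ^ 'n" and \<rho> :: "nat \<Rightarrow> real"
  defines "n \<equiv> CARD('n)"
  assumes r: "0 < r" and \<rho>_pos: "\<And>q. 1 \<le> q \<Longrightarrow> 0 < \<rho> q" and \<rho>_mono: "antimono_on {1..} \<rho>"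
    and div: "\<not> summable (\<lambda>k. real (Suc k) ^ n * \<rho> (Suc k) ^ n)"
  obtains F :: "((int ^ 'n) \<times> nat) set" and s where "finite F"
    "\<And>p q. (p, q) \<in> F \<Longrightarrow> Q\<^sub>0 \<le> q \<and> 1 \<le> q \<and> rat_pt p q \<in> ocube x r \<and> 0 < s (p, q) \<and> s (p, q) \<le> \<rho> q"
    "disjoint_family_on (\<lambda>e. ocube (case_prod rat_pt e) (s e)) F"
    "r ^ n \<le> 8 * 12 ^ n * (\<Sum>e\<in>F. s e ^ n)"
proof (rule ccontr)
  assume "\<not> thesis"
  note found = that
  define valid where "valid F s \<longleftrightarrow> finite F \<and>
    (\<forall>(p, q)\<in>F. Q\<^sub>0 \<le> q \<and> 1 \<le> q \<and> rat_pt p q \<in> ocube x r \<and> 0 < s (p, q) \<and> s (p, q) \<le> \<rho> q) \<and>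
    disjoint_family_on (\<lambda>e. ocube (case_prod rat_pt e) (s e)) F" for F :: "((int ^ 'n) \<times> nat) set" and s
  \<comment> \<open>The negated conclusion, read as an upper bound for the volume of every
    admissible family. The factor 8 * 12^n makes the part of the blocked rationals charged to volume
    come out as \<open>c / 4 * X\<close>.\<close>
  have small: "8 * 12 ^ n * (\<Sum>e\<in>F. s e ^ n) < r ^ n" if "valid F s" for F s
  proof (rule ccontr)
    assume "\<not> 8 * 12 ^ n * (\<Sum>e\<in>F. s e ^ n) < r ^ n"
    then have "r ^ n \<le> 8 * 12 ^ n * (\<Sum>e\<in>F. s e ^ n)" by simp
    moreover have "Q\<^sub>0 \<le> q \<and> 1 \<le> q \<and> rat_pt p q \<in> ocube x r \<and> 0 < s (p, q) \<and> s (p, q) \<le> \<rho> q"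
      if "(p, q) \<in> F" for p q
      using \<open>valid F s\<close> that unfolding valid_def by blast
    moreover have "finite F" "disjoint_family_on (\<lambda>e. ocube (case_prod rat_pt e) (s e)) F"
      using \<open>valid F s\<close> unfolding valid_def by blast+
    ultimately show False using found[of F s] \<open>\<not> thesis\<close> by blast
  qed
  define k :: nat where "k = 4 * 6 ^ n"
  define m where "m = n * (n + 1)"
  define c where "c = 1 / (2 * (6 * real k) ^ n)"
  have n: "1 \<le> n" by (simp add: n_def Suc_le_eq)
  have k: "1 \<le> k" "0 < real k" by (simp_all add: k_def)
  have c: "0 < c" using k by (simp add: c_def)
  obtain N\<^sub>0 where N\<^sub>0: "1 \<le> N\<^sub>0" "\<And>N :: nat. N\<^sub>0 \<le> N \<Longrightarrow> \<exists>P. finite P \<and>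
       (\<forall>(p, q) \<in> P. Q\<^sub>0 \<le> q \<and> 1 \<le> q \<and> q \<le> N ^ n \<and> rat_pt p q \<in> ocube x r) \<and>
       disjoint_family_on (\<lambda>(p, q). ocube (rat_pt p q) (real k / real N ^ (n + 1))) P \<and>
       r ^ n * real N ^ m \<le> 2 * (6 * real k) ^ n * real (card P)"
  proof (rule many_separated_rationals[OF r, where x = x and Q\<^sub>0 = Q\<^sub>0, folded n_def, folded k_def, folded m_def])
  qed (rule that)
  \<comment> \<open>The next scale multiplies \<open>X\<close> by \<open>b ^ m\<close>. This is
    large enough for the new points, at most \<open>(2 / real k) ^ n * X\<close> in number and
    weighted by \<open>4 ^ (n + 1)\<close>, to fit into the cardinality invariant.\<close>
  obtain b0 :: nat where b0: "1 + 4 ^ (n + 1) * (2 / real k) ^ n / c < real b0"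
    using reals_Archimedean2 by blast
  define b where "b = max 2 b0"
  have b: "2 \<le> b" by (simp add: b_def)
  have "m \<ge> 1" using n by (simp add: m_def)
  then have "b \<le> b ^ m" using b by (intro self_le_power) auto
  then have "real b0 \<le> real b ^ m" unfolding b_def of_nat_power[symmetric] of_nat_le_iff by simp
  then have "1 + 4 ^ (n + 1) * (2 / real k) ^ n / c \<le> real b ^ m" using b0 by linarith
  then have "c * (1 + 4 ^ (n + 1) * (2 / real k) ^ n / c) \<le> c * real b ^ m"
    using c by (intro mult_left_mono) auto
  then have bm: "c + 4 ^ (n + 1) * (2 / real k) ^ n \<le> c * real b ^ m"
    using c by (simp add: distrib_left)
  obtain t\<^sub>0' :: nat where "max (real N\<^sub>0) (real k / r) < real t\<^sub>0'" using reals_Archimedean2 by blast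
  then obtain t\<^sub>0 where t\<^sub>0: "N\<^sub>0 \<le> t\<^sub>0" "real k / r \<le> real t\<^sub>0" by (intro that[of t\<^sub>0']) auto
  define N where "N t = b ^ t" for t
  define \<delta> where "\<delta> t = real k / real (N t) ^ (n + 1)" for t
  \<comment> \<open>Denominators at scale t are at most \<open>N t ^ n\<close>, so by monotonicity
    the radius \<open>\<rho> (N t ^ n)\<close> is admissible for all of them; the minimum with
    \<open>\<delta> t\<close> keeps the new cubes disjoint from each other.\<close>
  define \<sigma> where "\<sigma> t = min (\<rho> (N t ^ n)) (\<delta> t)" for t
  have N_pos: "1 \<le> N t" for t using b by (simp add: N_def)
  have N_ge: "t \<le> N t" for t using b power_gt_expt[of b t] by (simp add: N_def)
  have \<delta>_pos: "0 < \<delta> t" for t using N_pos[of t] k by (simp add: \<delta>_def)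
  have \<sigma>_pos: "0 < \<sigma> t" for t using N_pos[of t] \<delta>_pos[of t] \<rho>_pos by (simp add: \<sigma>_def)
  have N\<delta>: "real (N t) ^ m * \<delta> t ^ n = real k ^ n" for t
  proof -
    have "real (N t) ^ m = (real (N t) ^ (n + 1)) ^ n"
      unfolding m_def power_mult[symmetric] by (simp only: mult.commute)
    then show ?thesis using N_pos[of t] unfolding \<delta>_def power_divide by simp
  qed
  have \<delta>_le: "\<delta> t \<le> r" if "t\<^sub>0 \<le> t" for t
  proof -
    have "real k / r \<le> real (N t)" using t\<^sub>0 that N_ge[of t] by linarith
    also have "\<dots> \<le> real (N t) ^ (n + 1)" using N_pos[of t] by (intro self_le_power) auto
    finally show ?thesis using N_pos[of t] r by (simp add: \<delta>_def field_simps)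
  qed
  \<comment> \<open>The number of cubes is part of the invariant because the bound for the rationals
    blocked by one cube contains the constant 4^n, however small that cube is.\<close>
  have greedy: "\<exists>F s. valid F s \<and> real (card F) * 4 ^ (n + 1) \<le> c * r ^ n * real (N (t\<^sub>0 + T)) ^ m \<and>
      c / 2 * r ^ n * (\<Sum>t<T. real (N (t\<^sub>0 + t)) ^ m * \<sigma> (t\<^sub>0 + t) ^ n) \<le> (\<Sum>e\<in>F. s e ^ n)" for T
  proof (induction T)
    case 0
    have "valid {} s" for s by (simp add: valid_def disjoint_family_on_def)
    then show ?case using c r by (intro exI[of _ "{}"]) auto
  next
    case (Suc T)
    then obtain F s where F: "valid F s" "real (card F) * 4 ^ (n + 1) \<le> c * r ^ n * real (N (t\<^sub>0 + T)) ^ m"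
      "c / 2 * r ^ n * (\<Sum>t<T. real (N (t\<^sub>0 + t)) ^ m * \<sigma> (t\<^sub>0 + t) ^ n) \<le> (\<Sum>e\<in>F. s e ^ n)"
      by blast
    define t where "t = t\<^sub>0 + T"
    define X where "X = r ^ n * real (N t) ^ m"
    have "N\<^sub>0 \<le> N t" using t\<^sub>0 N_ge[of t] by (simp add: t_def)
    from N\<^sub>0(2)[OF this, folded \<delta>_def X_def] obtain P where P0: "finite P"
       "\<forall>(p, q) \<in> P. Q\<^sub>0 \<le> q \<and> 1 \<le> q \<and> q \<le> N t ^ n \<and> rat_pt p q \<in> ocube x r"
       "disjoint_family_on (\<lambda>(p, q). ocube (rat_pt p q) (\<delta> t)) P"
       "X \<le> 2 * (6 * real k) ^ n * real (card P)"
      by (elim exE conjE)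
    have P: "finite P"
       "\<And>p q. (p, q) \<in> P \<Longrightarrow> Q\<^sub>0 \<le> q \<and> 1 \<le> q \<and> q \<le> N t ^ n \<and> rat_pt p q \<in> ocube x r"
       "disjoint_family_on (\<lambda>(p, q). ocube (rat_pt p q) (\<delta> t)) P"
       "X \<le> 2 * (6 * real k) ^ n * real (card P)"
      using P0(1,3,4) bspec[OF P0(2)] by auto
    have P3: "disjoint_family_on (\<lambda>e. ocube (case_prod rat_pt e) (\<delta> t)) P"
      using P(3) by (simp add: case_prod_unfold)
    have P4: "c * X \<le> real (card P)" using P(4) k by (simp add: c_def field_simps)
    have finF: "finite F" using F by (simp add: valid_def)
    have s_pos: "0 < s e" if "e \<in> F" for e using F(1) that unfolding valid_def by (cases e) auto
    define M where "M g = {e \<in> P. ocube (case_prod rat_pt e) (\<sigma> t) \<inter> ocube (case_prod rat_pt g) (s g) \<noteq> {}}" for g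
    define E where "E = P - (\<Union>g\<in>F. M g)"
    have "real (card (\<Union>g\<in>F. M g)) \<le> (\<Sum>g\<in>F. real (card (M g)))"
      using card_UN_le[OF finF, of M] by (metis of_nat_le_iff of_nat_sum)
    also have "\<dots> \<le> (\<Sum>g\<in>F. 2 ^ n * (s g / \<delta> t) ^ n + 4 ^ n)"
      unfolding M_def n_def using s_pos \<delta>_pos[of t]
      by (intro sum_mono card_ocube_meet_le P(1) P3) (auto simp: \<sigma>_def less_imp_le)
    also have "\<dots> = 2 ^ n / \<delta> t ^ n * (\<Sum>g\<in>F. s g ^ n) + 4 ^ n * real (card F)"
      by (simp add: sum.distrib sum_distrib_left power_divide)
    also have "\<dots> \<le> c / 4 * X + c / 4 * X"
    proof (rule add_mono)
      have "2 ^ n / \<delta> t ^ n * (\<Sum>g\<in>F. s g ^ n) \<le> 2 ^ n / \<delta> t ^ n * (r ^ n / (8 * 12 ^ n))"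
        using small[OF F(1)] \<delta>_pos[of t] by (intro mult_left_mono) (auto simp: field_simps)
      also have "\<dots> = 2 ^ n * real (N t) ^ m / real k ^ n * (r ^ n / (8 * 12 ^ n))"
        using N\<delta>[of t] \<delta>_pos[of t] k by (simp add: field_simps)
      also have "\<dots> = c / 4 * X"
      proof -
        have "(12 :: real) ^ n = 2 ^ n * 6 ^ n" by (simp add: power_mult_distrib[symmetric])
        then show ?thesis by (simp add: c_def X_def power_mult_distrib mult_ac)
      qed
      finally show "2 ^ n / \<delta> t ^ n * (\<Sum>g\<in>F. s g ^ n) \<le> c / 4 * X" .
      show "4 ^ n * real (card F) \<le> c / 4 * X"
        using F(2) by (simp add: X_def t_def mult_ac)
    qed
    also have "\<dots> = c / 2 * X" by (simp add: field_simps)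
    finally have "real (card (\<Union>g\<in>F. M g)) \<le> c / 2 * X" .
    moreover have "card P \<le> card (E \<union> (\<Union>g\<in>F. M g))"
      using P(1) finF by (intro card_mono) (auto simp: E_def M_def)
    then have "real (card P) \<le> real (card E) + real (card (\<Union>g\<in>F. M g))"
      unfolding of_nat_add[symmetric] of_nat_le_iff by (rule order_trans[OF _ card_Un_le])
    ultimately have cardE: "c / 2 * X \<le> real (card E)" using P4 by simp
    define s' where "s' e = (if e \<in> F then s e else \<sigma> t)" for e
    have finE: "finite E" using P(1) by (simp add: E_def)
    have disEF: "E \<inter> F = {}"
    proof (rule ccontr)
      assume "E \<inter> F \<noteq> {}"
      then obtain e where e: "e \<in> E" "e \<in> F" by blast
      then have "case_prod rat_pt e \<in> ocube (case_prod rat_pt e) (\<sigma> t) \<inter> ocube (case_prod rat_pt e) (s e)"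
        using \<sigma>_pos s_pos by simp
      then show False using e unfolding E_def M_def by blast
    qed
    have "valid (E \<union> F) s'"
      unfolding valid_def
    proof (intro conjI)
      show "\<forall>(p, q)\<in>E \<union> F. Q\<^sub>0 \<le> q \<and> 1 \<le> q \<and> rat_pt p q \<in> ocube x r \<and> 0 < s' (p, q) \<and> s' (p, q) \<le> \<rho> q"
      proof clarify
        fix p q assume "(p, q) \<in> E \<union> F"
        show "Q\<^sub>0 \<le> q \<and> 1 \<le> q \<and> rat_pt p q \<in> ocube x r \<and> 0 < s' (p, q) \<and> s' (p, q) \<le> \<rho> q"
        proof (cases "(p, q) \<in> F")
          case True
          then show ?thesis using F(1) unfolding valid_def s'_def by fastforce
        next
          case False
          then have "(p, q) \<in> P" using \<open>(p, q) \<in> E \<union> F\<close> by (auto simp: E_def)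
          then have pq: "Q\<^sub>0 \<le> q \<and> 1 \<le> q \<and> q \<le> N t ^ n \<and> rat_pt p q \<in> ocube x r" by (rule P(2))
          then have "\<rho> (N t ^ n) \<le> \<rho> q"
            by (intro monotone_onD[OF \<rho>_mono]) auto
          then have "\<sigma> t \<le> \<rho> q" by (simp add: \<sigma>_def)
          then show ?thesis using pq False \<sigma>_pos by (simp add: s'_def)
        qed
      qed
      have EE: "ocube (case_prod rat_pt e) (\<sigma> t) \<inter> ocube (case_prod rat_pt g) (\<sigma> t) = {}"
        if "e \<in> E" "g \<in> E" "e \<noteq> g" for e g
      proof -
        have "ocube (case_prod rat_pt e) (\<delta> t) \<inter> ocube (case_prod rat_pt g) (\<delta> t) = {}"
          using P3 that unfolding disjoint_family_on_def E_def by blast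
        moreover have "ocube y (\<sigma> t) \<subseteq> ocube y (\<delta> t)" for y :: "real ^ 'n"
          by (rule ocube_mono) (simp add: \<sigma>_def)
        ultimately show ?thesis by blast
      qed
      have EF: "ocube (case_prod rat_pt e) (\<sigma> t) \<inter> ocube (case_prod rat_pt g) (s g) = {}"
        if "e \<in> E" "g \<in> F" for e g
        using that unfolding E_def M_def by blast
      have FF: "ocube (case_prod rat_pt e) (s e) \<inter> ocube (case_prod rat_pt g) (s g) = {}"
        if "e \<in> F" "g \<in> F" "e \<noteq> g" for e g
        using F(1) that unfolding valid_def disjoint_family_on_def by blast
      show "disjoint_family_on (\<lambda>e. ocube (case_prod rat_pt e) (s' e)) (E \<union> F)"
        unfolding disjoint_family_on_def s'_def using EE EF FF disEF by (simp add: Int_commute) blast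
    qed (use finE finF in auto)
    moreover have "real (card (E \<union> F)) * 4 ^ (n + 1) \<le> c * r ^ n * real (N (t\<^sub>0 + Suc T)) ^ m"
    proof -
      have "(\<Sum>e\<in>P. \<delta> t ^ n) \<le> (2 * r) ^ n"
        unfolding n_def
      proof (rule sum_cube_packing_ocube[OF P(1) P3])
        fix e assume "e \<in> P"
        then have "case_prod rat_pt e \<in> ocube x r" using P(2) by (cases e) auto
        then show "ocube (case_prod rat_pt e) (\<delta> t) \<subseteq> ocube x (2 * r)"
          using \<delta>_le[of t] by (intro ocube_subset) (auto simp: ocube_def t_def)
      qed (use \<delta>_pos[of t] r in auto)
      then have "real (card P) * \<delta> t ^ n * real (N t) ^ m \<le> (2 * r) ^ n * real (N t) ^ m"
        by (intro mult_right_mono) auto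
      then have "real (card P) * real k ^ n \<le> (2 * r) ^ n * real (N t) ^ m"
        using N\<delta>[of t] by (metis mult.commute mult.left_commute)
      then have "real (card P) \<le> (2 / real k) ^ n * X"
        using k by (simp add: field_simps power_mult_distrib X_def power_divide)
      moreover have "real (card E) \<le> real (card P)"
        unfolding of_nat_le_iff using P(1) by (intro card_mono) (auto simp: E_def)
      ultimately have "real (card (E \<union> F)) * 4 ^ (n + 1) \<le> ((2 / real k) ^ n * X + real (card F)) * 4 ^ (n + 1)"
        using card_Un_le[of E F] by (intro mult_right_mono) auto
      also have "\<dots> = 4 ^ (n + 1) * (2 / real k) ^ n * X + real (card F) * 4 ^ (n + 1)"
        by (subst distrib_right) (simp only: mult_ac)
      also have "\<dots> \<le> 4 ^ (n + 1) * (2 / real k) ^ n * X + c * X"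
        using F(2) by (simp only: X_def t_def mult.assoc add_left_mono)
      also have "\<dots> = (c + 4 ^ (n + 1) * (2 / real k) ^ n) * X"
        by (simp only: distrib_right add.commute)
      also have "\<dots> \<le> c * real b ^ m * X"
        using bm r by (intro mult_right_mono) (auto simp: X_def)
      also have "\<dots> = c * r ^ n * real (N (t\<^sub>0 + Suc T)) ^ m"
        by (simp add: X_def t_def N_def power_mult_distrib)
      finally show ?thesis .
    qed
    moreover have "c / 2 * r ^ n * (\<Sum>t<Suc T. real (N (t\<^sub>0 + t)) ^ m * \<sigma> (t\<^sub>0 + t) ^ n) \<le> (\<Sum>e\<in>E \<union> F. s' e ^ n)"
    proof -
      have "(\<Sum>e\<in>E \<union> F. s' e ^ n) = (\<Sum>e\<in>E. s' e ^ n) + (\<Sum>e\<in>F. s' e ^ n)"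
        using finE finF disEF by (rule sum.union_disjoint)
      also have "(\<Sum>e\<in>E. s' e ^ n) = (\<Sum>e\<in>E. \<sigma> t ^ n)"
        using disEF by (intro sum.cong) (auto simp: s'_def)
      also have "\<dots> = real (card E) * \<sigma> t ^ n" by simp
      also have "(\<Sum>e\<in>F. s' e ^ n) = (\<Sum>e\<in>F. s e ^ n)"
        by (intro sum.cong) (auto simp: s'_def)
      finally have "(\<Sum>e\<in>E \<union> F. s' e ^ n) = real (card E) * \<sigma> t ^ n + (\<Sum>e\<in>F. s e ^ n)" .
      moreover have "c / 2 * X * \<sigma> t ^ n \<le> real (card E) * \<sigma> t ^ n"
        using cardE \<sigma>_pos[of t] by (intro mult_right_mono) auto
      ultimately show ?thesis
        using F(3) by (simp add: distrib_left X_def t_def mult_ac)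
    qed
    ultimately show ?case by blast
  qed
  have "(\<Sum>t<T. real (N (t + t\<^sub>0)) ^ m * \<sigma> (t + t\<^sub>0) ^ n) \<le> 2 / c" for T
  proof -
    obtain F s where F: "valid F s"
      "c / 2 * r ^ n * (\<Sum>t<T. real (N (t\<^sub>0 + t)) ^ m * \<sigma> (t\<^sub>0 + t) ^ n) \<le> (\<Sum>e\<in>F. s e ^ n)"
      using greedy by blast
    have "0 \<le> (\<Sum>e\<in>F. s e ^ n)"
      using F(1) unfolding valid_def by (intro sum_nonneg zero_le_power) (fastforce intro: less_imp_le)
    moreover have "1 * 1 \<le> 8 * (12 :: real) ^ n" by (intro mult_mono one_le_power) auto
    ultimately have "(\<Sum>e\<in>F. s e ^ n) \<le> 8 * 12 ^ n * (\<Sum>e\<in>F. s e ^ n)"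
      using mult_right_mono[of 1 "8 * 12 ^ n" "\<Sum>e\<in>F. s e ^ n"] by simp
    then have "c / 2 * r ^ n * (\<Sum>t<T. real (N (t\<^sub>0 + t)) ^ m * \<sigma> (t\<^sub>0 + t) ^ n) \<le> r ^ n"
      using F(2) small[OF F(1)] by linarith
    then show ?thesis using c r by (simp add: field_simps add.commute)
  qed
  then have "summable (\<lambda>t. real (N (t + t\<^sub>0)) ^ m * \<sigma> (t + t\<^sub>0) ^ n)"
    using \<sigma>_pos by (intro summableI_nonneg_bounded) (auto simp: less_imp_le)
  then have sm: "summable (\<lambda>t. real (N t) ^ m * \<sigma> t ^ n)"
    by (subst (asm) summable_iff_shift)
  \<comment> \<open>As \<open>N t ^ m * \<delta> t ^ n = k ^ n\<close> is at least 1, a term below 1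
    has \<open>\<sigma> t = \<rho> (N t ^ n)\<close>. With Q = (b^n)^t it is then Q^(n+1) *
    \<rho>(Q)^n, a term of the condensed series with base b^n.\<close>
  have "\<forall>\<^sub>F t in sequentially. real (N t) ^ m * \<sigma> t ^ n < 1"
    using summable_LIMSEQ_zero[OF sm] by (rule order_tendstoD) simp
  then have "\<forall>\<^sub>F t in sequentially. real (N t) ^ m * \<sigma> t ^ n = real (N t) ^ m * \<rho> (N t ^ n) ^ n"
  proof eventually_elim
    case (elim t)
    have "1 \<le> real k ^ n" using k by (intro one_le_power) simp
    then have "\<sigma> t \<noteq> \<delta> t" using elim N\<delta>[of t] by auto
    then show ?case by (auto simp: \<sigma>_def min_def)
  qed
  from summable_cong[OF this] sm have "summable (\<lambda>t. real (N t) ^ m * \<rho> (N t ^ n) ^ n)"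
    by simp
  moreover have "N t ^ n = (b ^ n) ^ t" "real (N t) ^ m = real (N t ^ n) ^ Suc n" for t
    by (simp_all add: N_def m_def power_mult[symmetric] power_add[symmetric] distrib_left mult_ac)
  ultimately have "summable (\<lambda>t. real ((b ^ n) ^ t) ^ Suc n * \<rho> ((b ^ n) ^ t) ^ n)"
    by simp
  moreover have "antimono_on {1..} (\<lambda>q. \<rho> q ^ n)"
    using \<rho>_pos by (intro monotone_onI power_mono monotone_onD[OF \<rho>_mono]) (auto simp: less_imp_le)
  moreover have "2 \<le> b ^ n" using b n self_le_power[of b n] by linarith
  ultimately have "summable (\<lambda>k. real (Suc k) ^ n * \<rho> (Suc k) ^ n)"
    using \<rho>_pos by (intro condensation_summable[of "\<lambda>q. \<rho> q ^ n" "b ^ n"]) (auto simp: less_imp_le)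
  then show False using div by simp
qed

section \<open>Density of neighbourhoods of shifted rationals\<close>

text \<open>Packed cubes are enlarged to radius \<open>(C + s + 1) * \<rho> q\<close>: C accounts
  for the shift, s for the target cube, and 1 makes the enlargement contain the packed cube. After a
  Vitali selection among the enlargements the target cubes inside them are disjoint as well, and
  their volume is a fixed fraction. The shift is bounded only for rationals inside the given cube,
  which is what the limsup hypothesis provides; the resulting proportion is the same for all
  cubes.\<close>

lemma shifted_rational_density:
  fixes x :: "real ^ 'n" and \<rho> :: "nat \<Rightarrow> real" and z :: "int ^ 'n \<Rightarrow> nat \<Rightarrow> real ^ 'n"
  defines "n \<equiv> CARD('n)"
  assumes r: "0 < r" and \<rho>_pos: "\<And>q. 1 \<le> q \<Longrightarrow> 0 < \<rho> q" and \<rho>_mono: "antimono_on {1..} \<rho>"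
    and div: "\<not> summable (\<lambda>k. real (Suc k) ^ n * \<rho> (Suc k) ^ n)"
    and lim: "\<rho> \<longlonglongrightarrow> 0"
    and C: "0 \<le> C" and s: "0 < s"
    and near: "\<And>p q. Q\<^sub>1 \<le> q \<Longrightarrow> rat_pt p q \<in> ocube x r \<Longrightarrow> infnorm (z p q - rat_pt p q) \<le> C * \<rho> q"
  shows "(s / (36 * (C + s + 1))) ^ n / 8 * r ^ n
    \<le> measure lebesgue (ocube x r \<inter> (\<Union>q\<in>{Q\<^sub>0..}. \<Union>p. ocube (z p q) (s * \<rho> q)))"
proof -
  define U where "U = (\<Union>q\<in>{Q\<^sub>0..}. \<Union>p. ocube (z p q) (s * \<rho> q))"
  define H where "H = C + s + 1"
  have H: "1 \<le> H" using C s by (simp add: H_def)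
  have "\<forall>\<^sub>F q in sequentially. \<rho> q < r / 2 / H"
    using lim r H by (intro order_tendstoD) auto
  then obtain Q\<^sub>2 where Q\<^sub>2: "\<And>q. Q\<^sub>2 \<le> q \<Longrightarrow> \<rho> q < r / 2 / H"
    by (auto simp: eventually_sequentially)
  \<comment> \<open>The packing is taken in the half-size cube so that the enlargements, of radius
    at most r / 2, stay inside the whole one.\<close>
  obtain F and t where F: "finite F"
    "\<And>p q. (p, q) \<in> F \<Longrightarrow> max Q\<^sub>0 (max Q\<^sub>1 Q\<^sub>2) \<le> q \<and> 1 \<le> q \<and> rat_pt p q \<in> ocube x (r / 2) \<and> 0 < t (p, q) \<and> t (p, q) \<le> \<rho> q"
    "disjoint_family_on (\<lambda>e. ocube (case_prod rat_pt e) (t e)) F"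
    "(r / 2) ^ n \<le> 8 * 12 ^ n * (\<Sum>e\<in>F. t e ^ n)"
  proof (rule rational_packing[of "r / 2" \<rho> "max Q\<^sub>0 (max Q\<^sub>1 Q\<^sub>2)" x, folded n_def])
  qed (use r \<rho>_pos \<rho>_mono div that in auto)
  have F2: "max Q\<^sub>0 (max Q\<^sub>1 Q\<^sub>2) \<le> snd e" "1 \<le> snd e" "case_prod rat_pt e \<in> ocube x (r / 2)"
    "0 < t e" "t e \<le> \<rho> (snd e)" if "e \<in> F" for e
    using F(2)[of "fst e" "snd e"] that by (auto simp: case_prod_unfold)
  define A where "A = (\<Union>e\<in>F. ocube (case_prod rat_pt e) (t e))"
  have A: "A \<in> lmeasurable"
    unfolding A_def using F(1) by (intro fmeasurable.finite_UN) auto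
  have "(\<Sum>e\<in>F. (2 * t e) ^ n) \<le> measure lebesgue A"
    unfolding n_def using F2(4) by (intro sum_cube_packing[OF F(1) F(3) _ A]) (auto simp: A_def less_imp_le)
  then have A_ge: "2 ^ n * (\<Sum>e\<in>F. t e ^ n) \<le> measure lebesgue A"
    by (simp add: power_mult_distrib sum_distrib_left)
  have rho: "0 < \<rho> (snd e)" if "e \<in> F" for e using \<rho>_pos F2(2)[OF that] by simp
  have \<rho>H: "\<rho> (snd e) \<le> H * \<rho> (snd e)" if "e \<in> F" for e
    using H rho[OF that] by (simp add: mult_le_cancel_right1)
  have sub: "A \<subseteq> (\<Union>e\<in>F. ocube (case_prod rat_pt e) (H * \<rho> (snd e)))"
    unfolding A_def by (intro UN_mono ocube_mono order_trans[OF F2(5) \<rho>H] order_refl)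
  obtain J where J: "J \<subseteq> F" "disjoint_family_on (\<lambda>e. ocube (case_prod rat_pt e) (H * \<rho> (snd e))) J"
    "measure lebesgue A \<le> (\<Sum>e\<in>J. (6 * (H * \<rho> (snd e))) ^ n)"
    unfolding n_def
    by (rule finite_Vitali_measure[OF F(1) _ sub]) (use A rho H in \<open>auto intro!: mult_pos_pos\<close>)
  have finJ: "finite J" using J(1) F(1) finite_subset by blast
  define W where "W e = z (fst e) (snd e)" for e
  have W_sub: "ocube (W e) (s * \<rho> (snd e)) \<subseteq> ocube (case_prod rat_pt e) (H * \<rho> (snd e))" if "e \<in> F" for e
  proof (rule ocube_subset)
    have "ocube x (r / 2) \<subseteq> ocube x r" using r by (intro ocube_mono) simp
    then have "infnorm (W e - case_prod rat_pt e) \<le> C * \<rho> (snd e)"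
      using near[of "snd e" "fst e"] F2[OF that] by (auto simp: W_def case_prod_unfold)
    then show "infnorm (W e - case_prod rat_pt e) + s * \<rho> (snd e) \<le> H * \<rho> (snd e)"
      using rho[OF that] by (simp add: H_def distrib_right)
  qed
  have UW: "ocube x r \<inter> U \<in> lmeasurable"
    by (intro lmeasurable_open bounded_Int) (auto simp: U_def ocube_eq_box intro!: bounded_Int bounded_box)
  have "(\<Sum>e\<in>J. (2 * (s * \<rho> (snd e))) ^ n) \<le> measure lebesgue (ocube x r \<inter> U)"
    unfolding n_def
  proof (rule sum_cube_packing[OF finJ _ _ UW])
    show "disjoint_family_on (\<lambda>e. ocube (W e) (s * \<rho> (snd e))) J"
      using J(2) W_sub J(1) unfolding disjoint_family_on_def by blast
    fix e assume "e \<in> J"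
    then have e: "e \<in> F" using J by auto
    show "0 \<le> s * \<rho> (snd e)" using s rho[OF e] by simp
    have "\<rho> (snd e) < r / 2 / H" using F2(1)[OF e] Q\<^sub>2 by simp
    then have "H * \<rho> (snd e) \<le> r / 2" using H by (simp add: field_simps)
    then have "ocube (case_prod rat_pt e) (H * \<rho> (snd e)) \<subseteq> ocube x r"
      using F2(3)[OF e] by (intro ocube_subset) (simp add: ocube_def)
    moreover have "ocube (W e) (s * \<rho> (snd e)) \<subseteq> U"
      using F2(1)[OF e] unfolding U_def W_def by fastforce
    ultimately show "ocube (W e) (s * \<rho> (snd e)) \<subseteq> ocube x r \<inter> U"
      using W_sub[OF e] by blast
  qed
  then have fin: "(2 * s) ^ n * (\<Sum>e\<in>J. \<rho> (snd e) ^ n) \<le> measure lebesgue (ocube x r \<inter> U)"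
    by (simp add: power_mult_distrib sum_distrib_left mult_ac)
  have "r ^ n = 2 ^ n * (r / 2) ^ n" by (simp flip: power_mult_distrib)
  also have "\<dots> \<le> 2 ^ n * (8 * 12 ^ n * (\<Sum>e\<in>F. t e ^ n))"
    using F(4) by (intro mult_left_mono) auto
  also have "\<dots> = 8 * 12 ^ n * (2 ^ n * (\<Sum>e\<in>F. t e ^ n))" by simp
  also have "\<dots> \<le> 8 * 12 ^ n * (\<Sum>e\<in>J. (6 * (H * \<rho> (snd e))) ^ n)"
    using A_ge J(3) by (intro mult_left_mono) auto
  also have "\<dots> = 8 * (12 ^ n * (6 * H) ^ n) * (\<Sum>e\<in>J. \<rho> (snd e) ^ n)"
    by (simp add: power_mult_distrib sum_distrib_left mult_ac)
  also have "12 ^ n * (6 * H) ^ n = (72 * H) ^ n" unfolding power_mult_distrib[symmetric] by simp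
  finally have "(s / (36 * H)) ^ n / 8 * r ^ n
      \<le> (s / (36 * H)) ^ n / 8 * (8 * (72 * H) ^ n * (\<Sum>e\<in>J. \<rho> (snd e) ^ n))"
    using s H by (intro mult_left_mono) auto
  also have "\<dots> = ((s / (36 * H)) ^ n * (72 * H) ^ n) * (\<Sum>e\<in>J. \<rho> (snd e) ^ n)" by simp
  also have "(s / (36 * H)) ^ n * (72 * H) ^ n = (2 * s) ^ n"
    unfolding power_mult_distrib[symmetric] using H by simp
  finally show ?thesis using fin by (simp add: U_def H_def)
qed

section \<open>From a positive proportion in every cube to full measure\<close>

lemma interior_ccube [simp]: "interior (ccube x r) = ocube x r"
  by (simp add: ocube_eq_box ccube_eq_cbox)

lemma lmeasurable_ccube [simp]: "ccube x r \<in> lmeasurable"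
  by (simp add: ccube_eq_cbox)

lemma measure_ccube:
  fixes x :: "real ^ 'n"
  assumes "0 \<le> r"
  shows "measure lebesgue (ccube x r) = (2 * r) ^ CARD('n)"
  using content_ocube[OF assms, of x]
  by (simp add: ccube_eq_cbox ocube_eq_box measure_def emeasure_lborel_box_eq emeasure_lborel_cbox_eq)

text \<open>A repackaging of \<open>covering_lemma\<close>: all sides of one of its boxes have the
  same length 2^(-m), so the box is a cube of radius 2^(-m-1). The gauge serves to keep the cubes
  small or inside an open set.\<close>

lemma countable_cube_cover:
  fixes E :: "(real ^ 'n) set"
  assumes "E \<subseteq> cbox 0 1" "gauge g"
  obtains D :: "((real ^ 'n) \<times> real) set" where "countable D"
    "\<And>x r. (x, r) \<in> D \<Longrightarrow> 0 < r \<and> ccube x r \<subseteq> cbox 0 1 \<and> (\<exists>y\<in>E. ccube x r \<subseteq> g y)"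
    "disjoint_family_on (\<lambda>(x, r). ocube x r) D" "E \<subseteq> (\<Union>(x, r)\<in>D. ccube x r)"
proof -
  have "(1 / 2) *\<^sub>R 1 \<in> box 0 (1 :: real ^ 'n)" by (simp add: mem_box_cart)
  then have ne: "box 0 (1 :: real ^ 'n) \<noteq> {}" by blast
  obtain \<D> where \<D>: "countable \<D>" "\<Union>\<D> \<subseteq> cbox 0 1"
    "\<And>K. K \<in> \<D> \<Longrightarrow> interior K \<noteq> {} \<and> (\<exists>c d. K = cbox c d)"
    "pairwise (\<lambda>A B. interior A \<inter> interior B = {}) \<D>"
    "\<And>K. K \<in> \<D> \<Longrightarrow> \<exists>x \<in> E \<inter> K. K \<subseteq> g x"
    "\<And>u v. cbox u v \<in> \<D> \<Longrightarrow> \<exists>n. \<forall>i \<in> Basis. v \<bullet> i - u \<bullet> i = (1 \<bullet> i - 0 \<bullet> i) / 2 ^ n"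
    "E \<subseteq> \<Union>\<D>"
  proof (rule covering_lemma[OF assms(1) ne assms(2)])
  qed (rule that)
  have "\<exists>e. 0 < snd e \<and> ccube (fst e) (snd e) = K" if K_in: "K \<in> \<D>" for K
  proof -
    obtain c d where K: "K = cbox c d" using \<D>(3)[OF K_in] by blast
    obtain m where "\<forall>i\<in>Basis. d \<bullet> i - c \<bullet> i = (1 \<bullet> i - 0 \<bullet> i) / 2 ^ m"
      using \<D>(6)[OF K_in[unfolded K]] by blast
    then have "d $ i - c $ i = 1 / 2 ^ m" for i
      by (drule_tac x = "axis i 1" in bspec) (auto simp: inner_axis)
    then have d: "d = c + vec (1 / 2 ^ m)" by (simp add: vec_eq_iff algebra_simps)
    define r :: real where "r = 1 / 2 ^ Suc m"
    have "(c + vec r) - vec r = c" "(c + vec r) + vec r = d"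
      by (simp_all add: d r_def vec_eq_iff)
    then have "ccube (c + vec r) r = K" by (simp add: ccube_eq_cbox K)
    then show ?thesis by (intro exI[of _ "(c + vec r, r)"]) (simp add: r_def)
  qed
  then obtain h where h: "\<And>K. K \<in> \<D> \<Longrightarrow> 0 < snd (h K) \<and> ccube (fst (h K)) (snd (h K)) = K"
    by metis
  show ?thesis
  proof (rule that[of "h ` \<D>"])
    show "countable (h ` \<D>)" using \<D>(1) by simp
    fix x r assume "(x, r) \<in> h ` \<D>"
    then obtain K where K: "K \<in> \<D>" "(x, r) = h K" by auto
    then have xr: "0 < r" "ccube x r = K" using h[OF K(1)] by (metis fst_conv snd_conv)+
    then show "0 < r \<and> ccube x r \<subseteq> cbox 0 1 \<and> (\<exists>y\<in>E. ccube x r \<subseteq> g y)"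
      using \<D>(2,5) K(1) by blast
  next
    have "ocube (fst (h K)) (snd (h K)) \<inter> ocube (fst (h L)) (snd (h L)) = {}"
      if "K \<in> \<D>" "L \<in> \<D>" "h K \<noteq> h L" for K L
      using \<D>(4) that h[OF that(1)] h[OF that(2)] unfolding pairwise_def
      by (metis interior_ccube)
    then show "disjoint_family_on (\<lambda>(x, r). ocube x r) (h ` \<D>)"
      by (auto simp: disjoint_family_on_def case_prod_unfold)
    show "E \<subseteq> (\<Union>(x, r)\<in>h ` \<D>. ccube x r)"
      using \<D>(7) h by (auto simp: case_prod_unfold)
  qed
qed

text \<open>This takes the place of the Lebesgue density theorem. The uncovered set \<open>E\<close>
  is enclosed in an open set with small excess and covered by nonoverlapping cubes inside it. A
  fixed proportion of each cube lies in \<open>U\<close>, hence in the excess, so the cubes have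
  small total volume.\<close>

lemma negligible_if_density_bound:
  fixes U :: "(real ^ 'n) set"
  assumes U: "open U" and \<kappa>: "0 < \<kappa>"
    and dens: "\<And>x r. 0 < r \<Longrightarrow> ocube x r \<subseteq> box 0 1 \<Longrightarrow>
      \<kappa> * r ^ CARD('n) \<le> measure lebesgue (ocube x r \<inter> U)"
  shows "negligible (box 0 1 - U)"
  unfolding negligible_outer_le
proof (intro allI impI)
  fix e :: real assume e: "0 < e"
  define E where "E = box 0 1 - U"
  have E: "E \<in> lmeasurable"
    unfolding E_def using U by (intro fmeasurable_Diff) auto
  obtain T where T: "open T" "E \<subseteq> T" "T - E \<in> lmeasurable"
    "emeasure lebesgue (T - E) < ennreal (\<kappa> * e / 2 ^ CARD('n))"
    using sets_lebesgue_outer_open[of E "\<kappa> * e / 2 ^ CARD('n)"] E e \<kappa> by (auto dest: fmeasurableD)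
  have TE: "measure lebesgue (T - E) \<le> \<kappa> * e / 2 ^ CARD('n)"
    using T(3,4) \<kappa> e by (simp add: emeasure_eq_measure2 ennreal_less_iff)
  \<comment> \<open>Intersecting with the open unit box brings the interiors of the cubes into the
    range of \<open>dens\<close>.\<close>
  define G where "G = T \<inter> box 0 1"
  have G: "open G" "E \<subseteq> G" using T by (auto simp: G_def E_def)
  have g: "gauge (\<lambda>x. if x \<in> E then G else UNIV)" using G by (auto simp: gauge_def)
  have "E \<subseteq> cbox 0 1" using box_subset_cbox by (auto simp: E_def)
  obtain D where D: "countable D"
    "\<And>x r. (x, r) \<in> D \<Longrightarrow> 0 < r \<and> ccube x r \<subseteq> cbox 0 1 \<and> (\<exists>y\<in>E. ccube x r \<subseteq> (if y \<in> E then G else UNIV))"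
    "disjoint_family_on (\<lambda>(x, r). ocube x r) D" "E \<subseteq> (\<Union>(x, r)\<in>D. ccube x r)"
  proof (rule countable_cube_cover[OF \<open>E \<subseteq> cbox 0 1\<close> g])
  qed (rule that)
  define V where "V = (\<Union>(x, r)\<in>D. ccube x r)"
  have D2: "0 < snd d" "ccube (fst d) (snd d) \<subseteq> cbox 0 1" "ccube (fst d) (snd d) \<subseteq> G" if "d \<in> D" for d
    using D(2)[of "fst d" "snd d"] that by auto
  have fin: "measure lebesgue (\<Union>(x, r)\<in>D'. ccube x r) \<le> e" if D': "D' \<subseteq> D" "finite D'" for D'
  proof -
    have "\<kappa> * (\<Sum>d\<in>D'. snd d ^ CARD('n)) \<le> (\<Sum>d\<in>D'. measure lebesgue (ocube (fst d) (snd d) \<inter> U))"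
      unfolding sum_distrib_left
    proof (rule sum_mono)
      fix d assume "d \<in> D'"
      then have d: "d \<in> D" using D' by auto
      have "ocube (fst d) (snd d) \<subseteq> box 0 1"
        using D2(3)[OF d] interior_subset[of "ccube (fst d) (snd d)"] by (auto simp: G_def)
      then show "\<kappa> * snd d ^ CARD('n) \<le> measure lebesgue (ocube (fst d) (snd d) \<inter> U)"
        using D2(1)[OF d] dens by blast
    qed
    also have "\<dots> = measure lebesgue (\<Union>d\<in>D'. ocube (fst d) (snd d) \<inter> U)"
    proof (rule measure_finite_Union[symmetric])
      show "disjoint_family_on (\<lambda>d. ocube (fst d) (snd d) \<inter> U) D'"
        using D(3) D'(1) unfolding disjoint_family_on_def case_prod_unfold by blast
      show "(\<lambda>d. ocube (fst d) (snd d) \<inter> U) ` D' \<subseteq> sets lebesgue" using U by auto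
      fix d
      have "ocube (fst d) (snd d) \<inter> U \<in> lmeasurable"
        using U by (intro fmeasurable_Int_fmeasurable) auto
      then show "emeasure lebesgue (ocube (fst d) (snd d) \<inter> U) \<noteq> \<infinity>"
        unfolding infinity_ennreal_def by (rule fmeasurableD2)
    qed (use D' in auto)
    also have "\<dots> \<le> measure lebesgue (T - E)"
    proof (rule measure_mono_fmeasurable[OF _ _ T(3)])
      show "(\<Union>d\<in>D'. ocube (fst d) (snd d) \<inter> U) \<subseteq> T - E"
      proof (rule UN_least)
        fix d assume "d \<in> D'"
        then have "ocube (fst d) (snd d) \<subseteq> G"
          using D2(3)[of d] D'(1) interior_subset[of "ccube (fst d) (snd d)"] by auto
        then show "ocube (fst d) (snd d) \<inter> U \<subseteq> T - E" by (auto simp: G_def E_def)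
      qed
      show "(\<Union>d\<in>D'. ocube (fst d) (snd d) \<inter> U) \<in> sets lebesgue"
        using U D' by (intro sets.finite_UN) auto
    qed
    also have "\<dots> \<le> \<kappa> * e / 2 ^ CARD('n)" by (rule TE)
    finally have "\<kappa> * (2 ^ CARD('n) * (\<Sum>d\<in>D'. snd d ^ CARD('n))) \<le> \<kappa> * e"
      by (simp add: pos_le_divide_eq mult_ac)
    then have small: "2 ^ CARD('n) * (\<Sum>d\<in>D'. snd d ^ CARD('n)) \<le> e" using \<kappa> by simp
    have "measure lebesgue (\<Union>(x, r)\<in>D'. ccube x r) \<le> (\<Sum>d\<in>D'. measure lebesgue (ccube (fst d) (snd d)))"
      unfolding case_prod_unfold using D' by (intro measure_UNION_le) (auto intro: fmeasurableD)
    also have "\<dots> = (\<Sum>d\<in>D'. (2 * snd d) ^ CARD('n))"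
      using D2(1) D' by (intro sum.cong refl measure_ccube) (auto intro: less_imp_le)
    also have "\<dots> \<le> e" using small by (simp add: power_mult_distrib sum_distrib_left)
    finally show ?thesis .
  qed
  have V_sub: "V \<subseteq> cbox 0 1" using D(2) by (auto simp: V_def)
  have V_sets: "V \<in> sets lebesgue"
    unfolding V_def using D(1) by (intro sets.countable_UN'') (auto intro: fmeasurableD)
  have V: "V \<in> lmeasurable"
    by (rule fmeasurableI2[OF lmeasurable_cbox V_sub V_sets])
  have "measure lebesgue V \<le> e + e'" if "0 < e'" for e'
  proof -
    obtain \<D>' where D': "\<D>' \<subseteq> (\<lambda>(x, r). ccube x r) ` D" "finite \<D>'"
      "measure lebesgue (\<Union>((\<lambda>(x, r). ccube x r) ` D)) - e' < measure lebesgue (\<Union>\<D>')"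
    proof (rule measure_countable_Union_approachable)
      show "countable ((\<lambda>(x, r). ccube x r) ` D)" using D(1) by simp
      show "0 < e'" by fact
      show "d \<in> lmeasurable" if "d \<in> (\<lambda>(x, r). ccube x r) ` D" for d using that by auto
      fix \<D>' assume "\<D>' \<subseteq> (\<lambda>(x, r). ccube x r) ` D" "finite \<D>'"
      then obtain D' where "D' \<subseteq> D" "finite D'" "\<D>' = (\<lambda>(x, r). ccube x r) ` D'"
        by (meson finite_subset_image)
      then show "measure lebesgue (\<Union>\<D>') \<le> e" using fin by simp
    qed
    obtain D'' where "D'' \<subseteq> D" "finite D''" "\<D>' = (\<lambda>(x, r). ccube x r) ` D''"
      using D' by (meson finite_subset_image)
    then show ?thesis using fin[of D''] D'(3) by (simp add: V_def)
  qed
  then have "measure lebesgue V \<le> e" by (rule field_le_epsilon)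
  then show "\<exists>T. box 0 1 - U \<subseteq> T \<and> T \<in> lmeasurable \<and> measure lebesgue T \<le> e"
    using V D(4) by (auto simp: V_def E_def)
qed

section \<open>Hausdorff measures\<close>

lemma bounded_if_infnorm_bound:
  fixes U :: "(real ^ 'n) set"
  assumes "\<And>x y. x \<in> U \<Longrightarrow> y \<in> U \<Longrightarrow> infnorm (x - y) \<le> d"
  shows "bounded U"
proof (cases "U = {}")
  case False
  then obtain y where y: "y \<in> U" by auto
  have "norm (x - y) \<le> sqrt DIM(real ^ 'n) * d" if "x \<in> U" for x
    using norm_le_infnorm[of "x - y"] assms[OF that y]
    by (meson mult_left_mono order_trans real_sqrt_ge_zero of_nat_0_le_iff)
  then show ?thesis
    unfolding bounded_def by (metis dist_norm norm_minus_commute)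
qed simp

lemma max_diameter_le:
  assumes "0 \<le> d" "\<And>x y. x \<in> U \<Longrightarrow> y \<in> U \<Longrightarrow> infnorm (x - y) \<le> d"
  shows "max_diameter U \<le> d"
  using assms by (auto simp: max_diameter_def intro!: cSUP_least)

lemma infnorm_le_max_diameter:
  fixes U :: "(real ^ 'n) set"
  assumes "bounded U" "x \<in> U" "y \<in> U"
  shows "infnorm (x - y) \<le> max_diameter U"
proof -
  obtain B where B: "\<And>u. u \<in> U \<Longrightarrow> norm u \<le> B" using assms(1) by (auto simp: bounded_iff)
  have bdd: "bdd_above ((\<lambda>(x, y). infnorm (x - y)) ` (U \<times> U))"
  proof (rule bdd_aboveI2[of _ _ "2 * B"])
    fix w assume "w \<in> U \<times> U"
    then obtain u v where w: "w = (u, v)" "u \<in> U" "v \<in> U" by auto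
    have "infnorm (u - v) \<le> norm u + norm v"
      using infnorm_le_norm[of "u - v"] norm_triangle_ineq4[of u v] by linarith
    then show "(case w of (x, y) \<Rightarrow> infnorm (x - y)) \<le> 2 * B"
      using B[OF w(2)] B[OF w(3)] w(1) by simp
  qed
  then show ?thesis
    using cSUP_upper[OF _ bdd, of "(x, y)"] assms(2,3) by (auto simp: max_diameter_def)
qed

lemma max_diameter_nonneg:
  assumes "bounded U"
  shows "0 \<le> max_diameter U"
proof (cases "U = {}")
  case False
  then obtain x where "x \<in> U" by auto
  then show ?thesis using infnorm_le_max_diameter[OF assms, of x x] by (simp add: infnorm_0)
qed (simp add: max_diameter_def)

lemma dimension_functionD:
  assumes "dimension_function f"
  shows "0 \<le> r \<Longrightarrow> 0 \<le> f r" "0 \<le> r \<Longrightarrow> r \<le> s \<Longrightarrow> f r \<le> f s" "f 0 = 0"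
proof -
  have f: "\<forall>r\<ge>0. f r \<ge> 0" "continuous_on {0..} f" "mono_on {0..} f" "(f \<longlongrightarrow> 0) (at_right 0)"
    using assms by (auto simp: dimension_function_def)
  show "0 \<le> r \<Longrightarrow> 0 \<le> f r" using f by simp
  show "0 \<le> r \<Longrightarrow> r \<le> s \<Longrightarrow> f r \<le> f s" using f(3) by (auto simp: mono_on_def)
  have "(f \<longlongrightarrow> f 0) (at 0 within {0..})" using f(2) by (auto simp: continuous_on_def)
  then have "(f \<longlongrightarrow> f 0) (at_right 0)" by (rule tendsto_within_subset) auto
  then show "f 0 = 0" using f(4) by (intro tendsto_unique[of "at_right (0 :: real)" f]) auto
qed

text \<open>The numbers \<open>d i\<close> are diameters, hence the radius \<open>d i / 2\<close>.
  The countable family becomes a sequence through \<open>to_nat_on\<close>; positions without a cube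
  hold the empty set, of diameter 0 and cost \<open>f 0 = 0\<close>.\<close>

lemma hausdorff_premeasure_le_cubes:
  fixes c :: "'i \<Rightarrow> real ^ 'n"
  assumes f: "dimension_function f" and I: "countable I"
    and A: "A \<subseteq> (\<Union>i\<in>I. ccube (c i) (d i / 2))"
    and d: "\<And>i. i \<in> I \<Longrightarrow> 0 \<le> d i \<and> d i \<le> \<delta>" and "0 \<le> \<delta>"
    and sum: "\<And>J. J \<subseteq> I \<Longrightarrow> finite J \<Longrightarrow> (\<Sum>i\<in>J. f (d i)) \<le> b"
  shows "hausdorff_premeasure f \<delta> A \<le> ennreal b"
proof -
  define h where "h = to_nat_on I"
  have h: "inj_on h I" unfolding h_def using I by (rule inj_on_to_nat_on)
  define V where "V k = (\<Union>i\<in>{i \<in> I. h i = k}. ccube (c i) (d i / 2))" for k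
  have V_h: "V (h i) = ccube (c i) (d i / 2)" if "i \<in> I" for i
  proof -
    have "{j \<in> I. h j = h i} = {i}" using h that by (auto dest: inj_onD)
    then show ?thesis by (simp add: V_def)
  qed
  have V_empty: "V k = {}" if "k \<notin> h ` I" for k
    using that by (auto simp: V_def)
  have diam: "infnorm (x - y) \<le> d i" if "x \<in> V (h i)" "y \<in> V (h i)" "i \<in> I" for x y i
  proof -
    have "infnorm (x - c i) \<le> d i / 2" "infnorm (y - c i) \<le> d i / 2"
      using that V_h[OF that(3)] by (auto simp: ccube_def)
    then show ?thesis
      using infnorm_triangle3[of x y "c i"] infnorm_sub[of "c i" y] by simp
  qed
  have "bounded (V k) \<and> max_diameter (V k) \<le> \<delta>" for k
  proof (cases "k \<in> h ` I")
    case True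
    then obtain i where i: "i \<in> I" "k = h i" by auto
    then have "bounded (V k)" "max_diameter (V k) \<le> d i"
      using diam d by (auto intro!: bounded_if_infnorm_bound max_diameter_le)
    then show ?thesis using d[OF i(1)] by simp
  next
    case False
    then show ?thesis using V_empty \<open>0 \<le> \<delta>\<close> by (simp add: max_diameter_def)
  qed
  moreover have "A \<subseteq> (\<Union>k. V k)" using A V_h by fastforce
  ultimately have "hausdorff_premeasure f \<delta> A \<le> (\<Sum>k. ennreal (f (max_diameter (V k))))"
    unfolding hausdorff_premeasure_def by (intro INF_lower) auto
  also have "\<dots> \<le> ennreal b"
  proof (rule suminf_le_const)
    fix K
    define J where "J = {i \<in> I. h i < K}"
    have "h ` J \<subseteq> {..<K}" by (auto simp: J_def)
    then have "finite (h ` J)" using finite_subset by blast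
    moreover have injJ: "inj_on h J" by (rule inj_on_subset[OF h]) (auto simp: J_def)
    ultimately have finJ: "finite J" by (rule finite_imageD)
    have "(\<Sum>k<K. f (max_diameter (V k))) = (\<Sum>k\<in>h ` J. f (max_diameter (V k)))"
    proof (rule sum.mono_neutral_right)
      show "\<forall>k\<in>{..<K} - h ` J. f (max_diameter (V k)) = 0"
      proof
        fix k assume "k \<in> {..<K} - h ` J"
        then have "k \<notin> h ` I" by (auto simp: J_def)
        then show "f (max_diameter (V k)) = 0"
          using V_empty dimension_functionD(3)[OF f] by (simp add: max_diameter_def)
      qed
    qed (use \<open>h ` J \<subseteq> {..<K}\<close> in auto)
    also have "\<dots> = (\<Sum>i\<in>J. f (max_diameter (V (h i))))"
      by (subst sum.reindex[OF injJ]) simp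
    also have "\<dots> \<le> (\<Sum>i\<in>J. f (d i))"
    proof (rule sum_mono)
      fix i assume "i \<in> J"
      then have i: "i \<in> I" by (simp add: J_def)
      then have "bounded (V (h i))" using diam by (intro bounded_if_infnorm_bound) auto
      moreover have "max_diameter (V (h i)) \<le> d i"
        using diam d i by (intro max_diameter_le) auto
      ultimately show "f (max_diameter (V (h i))) \<le> f (d i)"
        by (intro dimension_functionD(2)[OF f] max_diameter_nonneg)
    qed
    also have "\<dots> \<le> b" using finJ by (intro sum) (auto simp: J_def)
    finally have "(\<Sum>k<K. f (max_diameter (V k))) \<le> b" .
    moreover have "0 \<le> f (max_diameter (V k))" for k
      using \<open>\<And>k. bounded (V k) \<and> max_diameter (V k) \<le> \<delta>\<close>
      by (intro dimension_functionD(1)[OF f] max_diameter_nonneg) auto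
    ultimately show "(\<Sum>k<K. ennreal (f (max_diameter (V k)))) \<le> ennreal b"
      by (subst sum_ennreal) (auto intro: ennreal_leI)
  qed auto
  finally show ?thesis .
qed

section \<open>Subadditivity and null sets of Hausdorff measure\<close>

lemma hausdorff_measure_eq_0I:
  assumes "\<And>\<delta> e. 0 < \<delta> \<Longrightarrow> 0 < e \<Longrightarrow> hausdorff_premeasure f \<delta> A \<le> ennreal e"
  shows "hausdorff_measure f A = 0"
proof -
  have "hausdorff_premeasure f \<delta> A \<le> 0" if "0 < \<delta>" for \<delta>
    by (rule ennreal_le_epsilon) (use assms that in auto)
  then show ?thesis
    by (auto simp: hausdorff_measure_def intro!: antisym SUP_least)
qed

lemma hausdorff_measure_mono:
  assumes "A \<subseteq> B"
  shows "hausdorff_measure f A \<le> hausdorff_measure f B"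
  unfolding hausdorff_measure_def hausdorff_premeasure_def
  using assms by (intro SUP_mono' INF_superset_mono) auto

text \<open>Two nearly optimal covers are interleaved on even and odd indices; a partial sum of even
  length splits into partial sums of the two.\<close>

lemma hausdorff_premeasure_Un:
  fixes A B :: "(real ^ 'n) set"
  shows "hausdorff_premeasure f \<delta> (A \<union> B) \<le> hausdorff_premeasure f \<delta> A + hausdorff_premeasure f \<delta> B"
proof (rule ennreal_le_epsilon)
  fix e :: real
  assume fin: "hausdorff_premeasure f \<delta> A + hausdorff_premeasure f \<delta> B < top" and e: "0 < e"
  define C where "C A = {U :: nat \<Rightarrow> (real ^ 'n) set. A \<subseteq> (\<Union>i. U i) \<and> (\<forall>i. bounded (U i) \<and> max_diameter (U i) \<le> \<delta>)}" for A
  define S where "S U = (\<Sum>i. ennreal (f (max_diameter (U i))))" for U :: "nat \<Rightarrow> (real ^ 'n) set"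
  have pre: "hausdorff_premeasure f \<delta> A = (INF U\<in>C A. S U)" for A
    by (simp add: hausdorff_premeasure_def C_def S_def)
  have approx: "\<exists>U\<in>C A. S U < hausdorff_premeasure f \<delta> A + ennreal (e / 2)"
    if "hausdorff_premeasure f \<delta> A < top" for A
  proof -
    have "hausdorff_premeasure f \<delta> A < hausdorff_premeasure f \<delta> A + ennreal (e / 2)"
      using that e by (simp add: ennreal_add_left_cancel_less[of _ 0, simplified])
    then show ?thesis by (simp add: pre INF_less_iff)
  qed
  obtain U where U: "U \<in> C A" "S U < hausdorff_premeasure f \<delta> A + ennreal (e / 2)"
    using approx[of A] fin by (auto simp: ennreal_add_eq_top less_top[symmetric])
  obtain V where V: "V \<in> C B" "S V < hausdorff_premeasure f \<delta> B + ennreal (e / 2)"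
    using approx[of B] fin by (auto simp: ennreal_add_eq_top less_top[symmetric])
  define W where "W k = (if even k then U (k div 2) else V (k div 2))" for k :: nat
  have "U i \<subseteq> (\<Union>k. W k)" "V i \<subseteq> (\<Union>k. W k)" for i
    using UN_upper[of "2 * i" UNIV W] UN_upper[of "2 * i + 1" UNIV W] by (auto simp: W_def)
  then have "(\<Union>i. U i) \<subseteq> (\<Union>k. W k)" "(\<Union>i. V i) \<subseteq> (\<Union>k. W k)" by blast+
  moreover have "A \<subseteq> (\<Union>i. U i)" "B \<subseteq> (\<Union>i. V i)" using U(1) V(1) by (simp_all add: C_def)
  ultimately have "A \<union> B \<subseteq> (\<Union>k. W k)" by (meson Un_least order_trans)
  moreover have "\<forall>k. bounded (W k) \<and> max_diameter (W k) \<le> \<delta>"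
    using U(1) V(1) by (simp add: C_def W_def)
  ultimately have "W \<in> C (A \<union> B)" by (simp add: C_def)
  then have "hausdorff_premeasure f \<delta> (A \<union> B) \<le> S W"
    unfolding pre by (rule INF_lower)
  also have "S W \<le> S U + S V"
    unfolding S_def[of W]
  proof (rule suminf_le_const)
    let ?w = "\<lambda>k. ennreal (f (max_diameter (W k)))"
    fix K
    have "(\<Sum>k<2 * K. ?w k)
      = (\<Sum>k<K. ennreal (f (max_diameter (U k)))) + (\<Sum>k<K. ennreal (f (max_diameter (V k))))"
      by (induction K) (simp_all add: W_def ac_simps)
    also have "\<dots> \<le> S U + S V"
      unfolding S_def by (intro add_mono sum_le_suminf) auto
    finally show "(\<Sum>k<K. ?w k) \<le> S U + S V"
      by (rule order_trans[rotated]) (intro sum_mono2, auto)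
  qed auto
  also have "\<dots> \<le> (hausdorff_premeasure f \<delta> A + ennreal (e / 2)) + (hausdorff_premeasure f \<delta> B + ennreal (e / 2))"
    using U(2) V(2) by (intro add_mono) auto
  also have "\<dots> = hausdorff_premeasure f \<delta> A + hausdorff_premeasure f \<delta> B + (ennreal (e / 2) + ennreal (e / 2))"
    by (simp add: ac_simps)
  also have "ennreal (e / 2) + ennreal (e / 2) = ennreal e"
    using e by (subst ennreal_plus[symmetric]) auto
  finally show "hausdorff_premeasure f \<delta> (A \<union> B)
    \<le> hausdorff_premeasure f \<delta> A + hausdorff_premeasure f \<delta> B + ennreal e" .
qed

lemma hausdorff_measure_Un_null:
  assumes "hausdorff_measure f B = 0"
  shows "hausdorff_measure f (A \<union> B) \<le> hausdorff_measure f A"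
  unfolding hausdorff_measure_def
proof (rule SUP_least)
  fix \<delta> :: real assume \<delta>: "\<delta> \<in> {0<..}"
  have "hausdorff_premeasure f \<delta> B \<le> hausdorff_measure f B"
    unfolding hausdorff_measure_def using \<delta> by (intro SUP_upper)
  then have "hausdorff_premeasure f \<delta> B = 0" using assms by simp
  then have "hausdorff_premeasure f \<delta> (A \<union> B) \<le> hausdorff_premeasure f \<delta> A"
    using hausdorff_premeasure_Un[of f \<delta> A B] by simp
  also have "\<dots> \<le> (SUP \<delta>\<in>{0<..}. hausdorff_premeasure f \<delta> A)"
    using \<delta> by (intro SUP_upper)
  finally show "hausdorff_premeasure f \<delta> (A \<union> B) \<le> (SUP \<delta>\<in>{0<..}. hausdorff_premeasure f \<delta> A)" .
qed

text \<open>Near 0 the cost is at most C times the volume, so nonoverlapping cubes inside an open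
  set of measure at most e / C cost at most e. The balls in the gauge make the cubes small enough
  both for \<delta> and for this comparison.\<close>

lemma hausdorff_measure_negligible:
  fixes N :: "(real ^ 'n) set"
  assumes f: "dimension_function f" and N: "negligible N" "N \<subseteq> cbox 0 1"
    and bound: "\<And>r. 0 < r \<Longrightarrow> r \<le> \<delta>\<^sub>0 \<Longrightarrow> f r \<le> C * r ^ CARD('n)" and \<delta>\<^sub>0: "0 < \<delta>\<^sub>0" and C: "0 < C"
  shows "hausdorff_measure f N = 0"
proof (rule hausdorff_measure_eq_0I)
  fix \<delta> e :: real assume \<delta>: "0 < \<delta>" and e: "0 < e"
  define \<eta> where "\<eta> = min \<delta> \<delta>\<^sub>0 / 2"
  have \<eta>: "0 < \<eta>" "2 * \<eta> \<le> \<delta>" "2 * \<eta> \<le> \<delta>\<^sub>0" using \<delta> \<delta>\<^sub>0 by (auto simp: \<eta>_def)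
  have N_sets: "N \<in> sets lebesgue" using N(1) by (rule negligible_imp_sets)
  obtain G where G: "open G" "N \<subseteq> G" "G - N \<in> lmeasurable" "emeasure lebesgue (G - N) < ennreal (e / C)"
    using sets_lebesgue_outer_open[OF N_sets, of "e / C"] e C by auto
  have "measure lebesgue (G - N) \<le> e / C"
    using G(3,4) e C by (simp add: emeasure_eq_measure2 ennreal_less_iff)
  moreover have "G = (G - N) \<union> N" using G by auto
  then have Gm: "G \<in> lmeasurable" "measure lebesgue G \<le> measure lebesgue (G - N) + measure lebesgue N"
    using G(3) N(1) by (metis fmeasurable.Un negligible_imp_measurable,
        metis measure_Un_le fmeasurableD negligible_imp_measurable)
  moreover have "measure lebesgue N = 0" using N(1) by (rule negligible_imp_measure0)
  ultimately have G_le: "measure lebesgue G \<le> e / C" by linarith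
  have g: "gauge (\<lambda>y. if y \<in> G then G \<inter> ball y \<eta> else ball y \<eta>)"
    using G(1) \<eta> by (auto simp: gauge_def)
  obtain D where D: "countable D"
    "\<And>x r. (x, r) \<in> D \<Longrightarrow> 0 < r \<and> ccube x r \<subseteq> cbox 0 1 \<and>
       (\<exists>y\<in>N. ccube x r \<subseteq> (if y \<in> G then G \<inter> ball y \<eta> else ball y \<eta>))"
    "disjoint_family_on (\<lambda>(x, r). ocube x r) D" "N \<subseteq> (\<Union>(x, r)\<in>D. ccube x r)"
  proof (rule countable_cube_cover[OF N(2) g])
  qed (rule that)
  have D2: "0 < snd i" "ccube (fst i) (snd i) \<subseteq> G" "2 * snd i \<le> 2 * \<eta>" if i: "i \<in> D" for i
  proof -
    obtain x r where xr: "i = (x, r)" by (cases i)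
    obtain y where y: "0 < r" "y \<in> N" "ccube x r \<subseteq> (if y \<in> G then G \<inter> ball y \<eta> else ball y \<eta>)"
      using D(2)[OF i[unfolded xr]] by blast
    then have sub: "ccube x r \<subseteq> G" "ccube x r \<subseteq> ball y \<eta>"
      using G(2) by (auto split: if_splits)
    then show "0 < snd i" "ccube (fst i) (snd i) \<subseteq> G" using y xr by auto
    \<comment> \<open>These opposite corners differ by 2 * r in every coordinate and lie in a
      Euclidean ball of radius \<open>\<eta>\<close>; any single coordinate, here
      \<open>undefined\<close>, bounds r.\<close>
    have "x + vec r \<in> ccube x r" "x - vec r \<in> ccube x r"
      using y(1) by (auto simp: ccube_def infnorm_le_iff)
    then have "dist y (x + vec r) < \<eta>" "dist y (x - vec r) < \<eta>" using sub(2) by auto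
    then have "dist (x + vec r) (x - vec r) < 2 * \<eta>"
      using dist_triangle[of "x + vec r" "x - vec r" y] by (simp add: dist_commute)
    moreover have "\<bar>((x + vec r) - (x - vec r)) $ undefined\<bar> \<le> norm ((x + vec r) - (x - vec r))"
      by (rule component_le_norm_cart)
    ultimately show "2 * snd i \<le> 2 * \<eta>" using y(1) by (simp add: xr dist_norm)
  qed
  show "hausdorff_premeasure f \<delta> N \<le> ennreal e"
  proof (rule hausdorff_premeasure_le_cubes[OF f D(1), of N fst "\<lambda>i. 2 * snd i"])
    show "N \<subseteq> (\<Union>i\<in>D. ccube (fst i) (2 * snd i / 2))" using D(4) by (simp add: case_prod_unfold)
    show "0 \<le> 2 * snd i \<and> 2 * snd i \<le> \<delta>" if "i \<in> D" for i
      using D2[OF that] \<eta> by simp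
    fix J assume J: "J \<subseteq> D" "finite J"
    have "(\<Sum>i\<in>J. f (2 * snd i)) \<le> (\<Sum>i\<in>J. C * (2 * snd i) ^ CARD('n))"
    proof (rule sum_mono)
      fix i assume "i \<in> J"
      then have "i \<in> D" using J(1) by auto
      then have "0 < snd i" "2 * snd i \<le> 2 * \<eta>" using D2(1,3) by blast+
      then show "f (2 * snd i) \<le> C * (2 * snd i) ^ CARD('n)"
        using \<eta> by (intro bound) auto
    qed
    also have "\<dots> = C * (\<Sum>i\<in>J. (2 * snd i) ^ CARD('n))" by (simp add: sum_distrib_left)
    also have "\<dots> \<le> C * measure lebesgue G"
    proof (intro mult_left_mono sum_cube_packing[OF J(2) _ _ Gm(1)])
      show "disjoint_family_on (\<lambda>i. ocube (fst i) (snd i)) J"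
        using disjoint_family_on_mono[OF J(1) D(3)] by (simp add: case_prod_unfold)
      show "0 \<le> snd i" if "i \<in> J" for i using D2(1)[of i] that J(1) by auto
      show "ocube (fst i) (snd i) \<subseteq> G" if "i \<in> J" for i
        using D2(2)[of i] that J(1) interior_subset[of "ccube (fst i) (snd i)"] by auto
    qed (use C in auto)
    also have "\<dots> \<le> e" using G_le C by (simp add: field_simps)
    finally show "(\<Sum>i\<in>J. f (2 * snd i)) \<le> e" .
  qed (use \<delta> in auto)
qed

text \<open>For r \<le> 1 a grid of mesh r covers the unit cube by at most (3 / r)^n cubes of
  diameter r, at cost at most 3^n * f(r) / r^n. The grid points are counted by packing.\<close>

lemma hausdorff_measure_unit_cube_eq_0:
  assumes f: "dimension_function f"
    and small: "\<And>e \<delta>. 0 < e \<Longrightarrow> 0 < \<delta> \<Longrightarrow> \<exists>r. 0 < r \<and> r \<le> \<delta> \<and> f r \<le> e * r ^ CARD('n)"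
  shows "hausdorff_measure f (cbox 0 (1 :: real ^ 'n)) = 0"
proof (rule hausdorff_measure_eq_0I)
  fix \<delta> e :: real assume \<delta>: "0 < \<delta>" and e: "0 < e"
  obtain r where r: "0 < r" "r \<le> min \<delta> 1" "f r \<le> e / 3 ^ CARD('n) * r ^ CARD('n)"
    using small[of "e / 3 ^ CARD('n)" "min \<delta> 1"] \<delta> e by auto
  define c where "c p = r *\<^sub>R int_vec p" for p :: "int ^ 'n"
  define I where "I = {p. infnorm (c p - vec (1 / 2)) \<le> 1 / 2 + r / 2}"
  have count: "real (card J) * f r \<le> e" if J: "J \<subseteq> I" "finite J" for J
  proof -
    have "(\<Sum>p\<in>J. (r / 2) ^ CARD('n)) \<le> (1 / 2 + r) ^ CARD('n)"
    proof (rule sum_cube_packing_ocube[OF J(2)])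
      show "ocube (c p) (r / 2) \<subseteq> ocube (vec (1 / 2)) (1 / 2 + r)" if "p \<in> J" for p
        using that J(1) by (intro ocube_subset) (auto simp: I_def)
      show "disjoint_family_on (\<lambda>p. ocube (c p) (r / 2)) J"
        unfolding disjoint_family_on_def
      proof (intro ballI impI, rule ccontr)
        fix p p' assume "p \<noteq> p'" "ocube (c p) (r / 2) \<inter> ocube (c p') (r / 2) \<noteq> {}"
        then have "infnorm (c p - c p') < r / 2 + r / 2" by (intro ocube_Int_imp)
        moreover obtain i where "p $ i \<noteq> p' $ i" using \<open>p \<noteq> p'\<close> by (auto simp: vec_eq_iff)
        then have "1 \<le> \<bar>p $ i - p' $ i\<bar>" by linarith
        then have "1 \<le> \<bar>real_of_int (p $ i) - real_of_int (p' $ i)\<bar>" by linarith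
        then have "r * 1 \<le> r * \<bar>real_of_int (p $ i) - real_of_int (p' $ i)\<bar>"
          using r(1) by (intro mult_left_mono) auto
        then have "r \<le> \<bar>(c p - c p') $ i\<bar>"
          using r(1) by (simp add: c_def int_vec_def right_diff_distrib[symmetric] abs_mult)
        ultimately show False using component_le_infnorm_cart[of "c p - c p'" i] by simp
      qed
    qed (use r in auto)
    then have "real (card J) * r ^ CARD('n) \<le> 2 ^ CARD('n) * (1 / 2 + r) ^ CARD('n)"
      by (simp add: power_divide field_simps)
    also have "\<dots> = (1 + 2 * r) ^ CARD('n)"
      unfolding power_mult_distrib[symmetric] by (simp add: distrib_left)
    also have "\<dots> \<le> 3 ^ CARD('n)" using r by (intro power_mono) auto
    finally have le: "real (card J) * r ^ CARD('n) \<le> 3 ^ CARD('n)" .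
    have "real (card J) * f r \<le> real (card J) * (e / 3 ^ CARD('n) * r ^ CARD('n))"
      using r(3) by (intro mult_left_mono) auto
    also have "\<dots> = e / 3 ^ CARD('n) * (real (card J) * r ^ CARD('n))" by simp
    also have "\<dots> \<le> e / 3 ^ CARD('n) * 3 ^ CARD('n)"
      using le e by (intro mult_left_mono) auto
    finally show ?thesis by simp
  qed
  show "hausdorff_premeasure f \<delta> (cbox 0 (1 :: real ^ 'n)) \<le> ennreal e"
  proof (rule hausdorff_premeasure_le_cubes[OF f, of I _ c "\<lambda>_. r"])
    show "cbox 0 1 \<subseteq> (\<Union>p\<in>I. ccube (c p) (r / 2))"
    proof
      fix x :: "real ^ 'n" assume x: "x \<in> cbox 0 1"
      define p :: "int ^ 'n" where "p = (\<chi> i. round (x $ i / r))"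
      have near: "\<bar>(x - c p) $ i\<bar> \<le> r / 2" for i
      proof -
        have "\<bar>(x - c p) $ i\<bar> = \<bar>r * (x $ i / r - of_int (round (x $ i / r)))\<bar>"
          using r(1) by (simp add: c_def p_def int_vec_def right_diff_distrib)
        also have "\<dots> = r * \<bar>of_int (round (x $ i / r)) - x $ i / r\<bar>"
          using r(1) by (simp only: abs_mult abs_of_pos abs_minus_commute)
        also have "\<dots> \<le> r * (1 / 2)"
          using of_int_round_abs_le[of "x $ i / r"] r(1) by (intro mult_left_mono) auto
        finally show ?thesis by simp
      qed
      have "\<bar>(c p - vec (1 / 2)) $ i\<bar> \<le> 1 / 2 + r / 2" for i
      proof -
        have "0 \<le> x $ i" "x $ i \<le> 1" using x by (auto simp: mem_box_cart)
        then show ?thesis using near[of i] by (simp only: vector_minus_component vec_component abs_le_iff) linarith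
      qed
      then have "p \<in> I" by (simp only: I_def mem_Collect_eq infnorm_le_iff) simp
      moreover have "x \<in> ccube (c p) (r / 2)" using near by (simp only: ccube_def mem_Collect_eq infnorm_le_iff) simp
      ultimately show "x \<in> (\<Union>p\<in>I. ccube (c p) (r / 2))" by blast
    qed
  qed (use r \<delta> count in auto)
qed

section \<open>The convergence case\<close>

text \<open>Dividing the inequality in \<open>W_set\<close> by q shows that its points are those of
  the unit cube that lie, for infinitely many (p, q), in the cube of radius
  \<open>\<psi> q / q\<close> about this centre.\<close>

definition shift_pt :: "(int ^ 'n \<Rightarrow> int \<Rightarrow> real ^ 'n) \<Rightarrow> int ^ 'n \<Rightarrow> nat \<Rightarrow> real ^ 'n" where
  "shift_pt \<gamma> p q = (1 / real q) *\<^sub>R (int_vec p - \<gamma> p (int q))"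

lemma shift_pt_diff: "shift_pt \<gamma> p q - rat_pt p q = (- 1 / real q) *\<^sub>R \<gamma> p (int q)"
  by (simp add: shift_pt_def rat_pt_def algebra_simps)

lemma infnorm_shift_pt_diff: "infnorm (shift_pt \<gamma> p q - rat_pt p q) = infnorm (\<gamma> p (int q)) / real q"
  by (simp add: shift_pt_diff infnorm_mul infnorm_neg)

lemma mem_ocube_shift_pt_iff:
  assumes "1 \<le> q"
  shows "x \<in> ocube (shift_pt \<gamma> p q) (\<psi> / real q)
    \<longleftrightarrow> infnorm (real q *\<^sub>R x - int_vec p + \<gamma> p (int q)) < \<psi>"
proof -
  have "real q *\<^sub>R x - int_vec p + \<gamma> p (int q) = real q *\<^sub>R (x - shift_pt \<gamma> p q)"
    using assms by (simp add: shift_pt_def algebra_simps)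
  then have "infnorm (real q *\<^sub>R x - int_vec p + \<gamma> p (int q)) = real q * infnorm (x - shift_pt \<gamma> p q)"
    by (simp only: infnorm_mul abs_of_nat)
  then show ?thesis
    using assms by (simp add: ocube_def pos_less_divide_eq mult.commute)
qed

lemma infnorm_half_box:
  assumes "(g :: real ^ 'n) \<in> cbox (vec (- 1/2)) (vec (1/2))"
  shows "infnorm g \<le> 1 / 2"
  unfolding infnorm_le_iff
proof
  fix i
  have "vec (- 1/2) $ i \<le> g $ i" "g $ i \<le> vec (1/2) $ i"
    using assms unfolding mem_box_cart by blast+
  then show "\<bar>g $ i\<bar> \<le> 1 / 2" by (simp add: abs_le_iff)
qed

text \<open>For fixed q only finitely many p occur, because \<open>\<gamma>\<close> moves a rational
  by at most 1 / 2; so infinitely many pairs means arbitrarily large q.\<close>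

lemma W_set_iff:
  fixes \<gamma> :: "int ^ 'n \<Rightarrow> int \<Rightarrow> real ^ 'n"
  assumes \<gamma>: "\<forall>p q. \<gamma> p q \<in> cbox (vec (- 1/2)) (vec (1/2))"
  shows "x \<in> W_set \<gamma> \<psi> \<longleftrightarrow> x \<in> cbox 0 1 \<and>
    (\<forall>Q. \<exists>q\<ge>Q. 1 \<le> q \<and> (\<exists>p. x \<in> ocube (shift_pt \<gamma> p q) (\<psi> q / real q)))"
proof -
  define S where "S = {(p, q). 1 \<le> q \<and> x \<in> ocube (shift_pt \<gamma> p q) (\<psi> q / real q)}"
  have W: "x \<in> W_set \<gamma> \<psi> \<longleftrightarrow> x \<in> cbox 0 1 \<and> infinite S"
  proof -
    have "S = {(p, q). q \<ge> 1 \<and> infnorm (real q *\<^sub>R x - int_vec p + \<gamma> p (int q)) < \<psi> q}"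
      by (auto simp: S_def mem_ocube_shift_pt_iff)
    then show ?thesis by (simp add: W_set_def)
  qed
  have fin: "finite {p. x \<in> ocube (shift_pt \<gamma> p q) (\<psi> q / real q)}" if q: "1 \<le> q" for q
  proof (rule finite_subset[OF _ finite_rat_pt[OF q, of x "\<psi> q / real q + 1 / 2"]], safe)
    fix p assume "x \<in> ocube (shift_pt \<gamma> p q) (\<psi> q / real q)"
    then have "infnorm (x - shift_pt \<gamma> p q) < \<psi> q / real q" by (simp add: ocube_def)
    moreover have "infnorm (shift_pt \<gamma> p q - rat_pt p q) \<le> 1 / 2"
    proof -
      have "infnorm (\<gamma> p (int q)) / real q \<le> infnorm (\<gamma> p (int q)) / 1"
        using q infnorm_pos_le by (intro divide_left_mono) auto
      moreover have "infnorm (\<gamma> p (int q)) \<le> 1 / 2" using \<gamma> by (intro infnorm_half_box) blast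
      ultimately show ?thesis unfolding infnorm_shift_pt_diff div_by_1 by (rule order_trans)
    qed
    ultimately show "infnorm (rat_pt p q - x) \<le> \<psi> q / real q + 1 / 2"
      using infnorm_triangle3[of "rat_pt p q" x "shift_pt \<gamma> p q"]
        infnorm_sub[of "rat_pt p q" "shift_pt \<gamma> p q"] infnorm_sub[of "shift_pt \<gamma> p q" x]
      by linarith
  qed
  have "infinite S \<longleftrightarrow> (\<forall>Q. \<exists>q\<ge>Q. 1 \<le> q \<and> (\<exists>p. x \<in> ocube (shift_pt \<gamma> p q) (\<psi> q / real q)))"
  proof
    assume inf: "infinite S"
    show "\<forall>Q. \<exists>q\<ge>Q. 1 \<le> q \<and> (\<exists>p. x \<in> ocube (shift_pt \<gamma> p q) (\<psi> q / real q))"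
    proof (rule ccontr)
      assume "\<not> (\<forall>Q. \<exists>q\<ge>Q. 1 \<le> q \<and> (\<exists>p. x \<in> ocube (shift_pt \<gamma> p q) (\<psi> q / real q)))"
      then obtain Q where "\<not> (\<exists>q\<ge>Q. 1 \<le> q \<and> (\<exists>p. x \<in> ocube (shift_pt \<gamma> p q) (\<psi> q / real q)))"
        by (rule not_all[THEN iffD1, THEN exE])
      then have Q: "q < Q" if "(p, q) \<in> S" for p q
        using that not_le by (auto simp: S_def)
      have "S \<subseteq> (\<Union>q\<in>{1..<Q}. (\<lambda>p. (p, q)) ` {p. x \<in> ocube (shift_pt \<gamma> p q) (\<psi> q / real q)})"
      proof
        fix e assume "e \<in> S"
        moreover obtain p q where "e = (p, q)" by (cases e)
        ultimately show "e \<in> (\<Union>q\<in>{1..<Q}. (\<lambda>p. (p, q)) ` {p. x \<in> ocube (shift_pt \<gamma> p q) (\<psi> q / real q)})"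
          using Q[of p q] by (auto simp: S_def)
      qed
      moreover have "finite (\<Union>q\<in>{1..<Q}. (\<lambda>p. (p, q)) ` {p. x \<in> ocube (shift_pt \<gamma> p q) (\<psi> q / real q)})"
        using fin by auto
      ultimately show False using inf finite_subset by blast
    qed
  next
    assume large: "\<forall>Q. \<exists>q\<ge>Q. 1 \<le> q \<and> (\<exists>p. x \<in> ocube (shift_pt \<gamma> p q) (\<psi> q / real q))"
    show "infinite S"
    proof
      assume "finite S"
      then have "finite (snd ` S)" by simp
      then obtain Q where Q: "\<And>q. q \<in> snd ` S \<Longrightarrow> q < Q"
        by (meson finite_nat_set_iff_bounded)
      obtain q p where "Q \<le> q" "1 \<le> q" "x \<in> ocube (shift_pt \<gamma> p q) (\<psi> q / real q)"
        using large[rule_format, of Q] by blast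
      then have "Q \<le> q" "(p, q) \<in> S" by (simp_all add: S_def)
      then show False using Q[of q] by force
    qed
  qed
  then show ?thesis using W by simp
qed

lemma card_unit_rationals_le:
  fixes P :: "(int ^ 'n) set"
  assumes q: "1 \<le> q" and P: "finite P" "\<And>p. p \<in> P \<Longrightarrow> infnorm (rat_pt p q - vec (1 / 2)) \<le> 1 / 2"
  shows "real (card P) \<le> 2 ^ CARD('n) * real q ^ CARD('n)"
proof -
  have "real (card P) \<le> (2 * real q * (1 / 2) + 1) ^ CARD('n)"
    using q P by (intro card_rat_pt_le[where x = "vec (1 / 2)"]) auto
  also have "\<dots> \<le> (2 * real q) ^ CARD('n)" using q by (intro power_mono) auto
  finally show ?thesis by (simp add: power_mult_distrib)
qed

text \<open>A cube of radius \<open>\<psi> q / q\<close> has diameter \<open>2 \<psi> q / q\<close>, and \<open>f\<close> need not be doubling;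
  it is therefore split into its \<open>2\<^sup>n\<close> orthants, of diameter \<open>\<psi> q / q\<close>, indexed by sets of coordinates.\<close>

lemma hausdorff_measure_W_set_convergence:
  fixes \<gamma> :: "int ^ 'n \<Rightarrow> int \<Rightarrow> real ^ 'n"
  assumes f: "dimension_function f"
    and \<gamma>: "\<forall>p q. \<gamma> p q \<in> cbox (vec (- 1/2)) (vec (1/2))"
    and \<psi>: "\<And>q. 1 \<le> q \<Longrightarrow> 0 \<le> \<psi> q" "\<psi> \<longlonglongrightarrow> 0"
    and sm: "summable (\<lambda>k. real (Suc k) ^ CARD('n) * f (\<psi> (Suc k) / real (Suc k)))"
  shows "hausdorff_measure f (W_set \<gamma> \<psi>) = 0"
proof (rule hausdorff_measure_eq_0I)
  fix \<delta> e :: real assume \<delta>: "0 < \<delta>" and e: "0 < e"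
  define n where "n = CARD('n)"
  define a where "a q = \<psi> q / real q" for q
  \<comment> \<open>One factor 2^n counts orthants; the other comes from (q + 1)^n \<le> 2^n * q^n,
    which bounds the number of rationals.\<close>
  define K where "K = (4 :: real) ^ n"
  have K: "0 < K" by (simp add: K_def)
  have sm': "summable (\<lambda>q. real q ^ n * f (a q))"
    using sm summable_Suc_iff[of "\<lambda>q. real q ^ n * f (a q)"] by (simp add: n_def a_def)
  obtain Q\<^sub>1 where Q\<^sub>1: "\<And>q M. Q\<^sub>1 \<le> q \<Longrightarrow> norm (\<Sum>q = q..<M. real q ^ n * f (a q)) < e / K"
    using sm' e K unfolding summable_Cauchy by (meson divide_pos_pos)
  \<comment> \<open>A value of \<psi> below 1 / 2, together with coordinates of \<gamma> of size at
    most 1 / 2, gives -1 < p < q + 1 in each coordinate. Since p is integral, p / q then lies in the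
    closed unit cube.\<close>
  have "\<forall>\<^sub>F q in sequentially. \<psi> q < min \<delta> (1 / 2)"
    using \<psi>(2) \<delta> by (intro order_tendstoD) auto
  then obtain Q\<^sub>2 where Q\<^sub>2: "\<And>q. Q\<^sub>2 \<le> q \<Longrightarrow> \<psi> q < min \<delta> (1 / 2)"
    by (auto simp: eventually_sequentially)
  define Q where "Q = max 1 (max Q\<^sub>1 Q\<^sub>2)"
  define P where "P q = {p :: int ^ 'n. infnorm (rat_pt p q - vec (1 / 2)) \<le> 1 / 2}" for q
  define I :: "(nat \<times> (int ^ 'n) \<times> 'n set) set" where "I = (SIGMA q:{Q..}. P q \<times> UNIV)"
  \<comment> \<open>Up to the factor \<open>a q / 2\<close>, this vector points from the centre of a
    cube to the centre of its orthant \<sigma>.\<close>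
  define sg where "sg \<sigma> = ((\<chi> i. if i \<in> \<sigma> then 1 else - 1) :: real ^ 'n)" for \<sigma> :: "'n set"
  define c where "c = (\<lambda>(q, p, \<sigma>). shift_pt \<gamma> p q + (a q / 2) *\<^sub>R sg \<sigma>)"
  have finP: "finite (P q)" "real (card (P q)) \<le> 2 ^ n * real q ^ n" if "1 \<le> q" for q
  proof -
    show *: "finite (P q)" unfolding P_def using that by (rule finite_rat_pt)
    show "real (card (P q)) \<le> 2 ^ n * real q ^ n"
      unfolding n_def using that * by (intro card_unit_rationals_le) (auto simp: P_def)
  qed
  have a: "0 \<le> a q" "a q \<le> \<delta>" if "Q \<le> q" for q
  proof -
    have q: "1 \<le> q" "Q\<^sub>2 \<le> q" using that by (auto simp: Q_def)
    then show "0 \<le> a q" using \<psi>(1) by (simp add: a_def)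
    have "a q \<le> \<psi> q / 1" unfolding a_def using q \<psi>(1)[of q] by (intro divide_left_mono) auto
    then show "a q \<le> \<delta>" using Q\<^sub>2[OF q(2)] by simp
  qed
  have inP: "p \<in> P q" if q: "Q \<le> q" and x: "x \<in> cbox 0 1" "x \<in> ocube (shift_pt \<gamma> p q) (a q)" for p q x
  proof -
    have q': "1 \<le> q" "Q\<^sub>2 \<le> q" using q by (auto simp: Q_def)
    have lt: "infnorm (real q *\<^sub>R x - int_vec p + \<gamma> p (int q)) < 1 / 2"
      using x(2) Q\<^sub>2[OF q'(2)] unfolding a_def mem_ocube_shift_pt_iff[OF q'(1)] by simp
    have "\<bar>(rat_pt p q - vec (1 / 2)) $ i\<bar> \<le> 1 / 2" for i
    proof -
      have "\<bar>real q * x $ i - real_of_int (p $ i) + \<gamma> p (int q) $ i\<bar> < 1 / 2"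
        using lt unfolding infnorm_less_iff by (simp add: int_vec_def)
      moreover have "\<bar>\<gamma> p (int q) $ i\<bar> \<le> 1 / 2"
        using infnorm_half_box[of "\<gamma> p (int q)"] \<gamma> unfolding infnorm_le_iff by blast
      moreover have "0 \<le> x $ i" "x $ i \<le> 1" using x(1) by (auto simp: mem_box_cart)
      then have "0 \<le> real q * x $ i" "real q * x $ i \<le> real q"
        using mult_left_mono[of "x $ i" 1 "real q"] by simp_all
      ultimately have "- 1 < real_of_int (p $ i)" "real_of_int (p $ i) < real q + 1" by linarith+
      then have "- 1 < p $ i" "p $ i < int q + 1"
        by (simp_all flip: of_int_less_iff[where 'a = real])
      then have "0 \<le> p $ i" "p $ i \<le> int q" by simp_all
      then have "0 \<le> real_of_int (p $ i)" by simp
      moreover have "real_of_int (p $ i) \<le> real_of_int (int q)"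
        using \<open>p $ i \<le> int q\<close> by (simp only: of_int_le_iff)
      ultimately have "0 \<le> real_of_int (p $ i) / real q" "real_of_int (p $ i) / real q \<le> 1"
        using q' by auto
      then show ?thesis
        unfolding vector_minus_component rat_pt_nth vec_component abs_le_iff by linarith
    qed
    then show ?thesis unfolding P_def mem_Collect_eq infnorm_le_iff by blast
  qed
  show "hausdorff_premeasure f \<delta> (W_set \<gamma> \<psi>) \<le> ennreal e"
  proof (rule hausdorff_premeasure_le_cubes[OF f, of I _ c "\<lambda>(q, p, \<sigma>). a q"])
    show "countable I" using finP by (auto simp: I_def Q_def intro!: countable_SIGMA countable_finite)
    show "W_set \<gamma> \<psi> \<subseteq> (\<Union>i\<in>I. ccube (c i) ((case i of (q, p, \<sigma>) \<Rightarrow> a q) / 2))"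
    proof
      fix x assume "x \<in> W_set \<gamma> \<psi>"
      then obtain q p where q: "Q \<le> q" "x \<in> cbox 0 1" "x \<in> ocube (shift_pt \<gamma> p q) (a q)"
        unfolding W_set_iff[OF \<gamma>] a_def by blast
      define \<sigma> where "\<sigma> = {i. shift_pt \<gamma> p q $ i \<le> x $ i}"
      have "\<bar>(x - c (q, p, \<sigma>)) $ i\<bar> \<le> a q / 2" for i
      proof -
        have "\<bar>x $ i - shift_pt \<gamma> p q $ i\<bar> < a q"
          using q(3) by (simp add: ocube_def infnorm_less_iff)
        then show ?thesis
          by (cases "shift_pt \<gamma> p q $ i \<le> x $ i")
            (simp_all add: c_def sg_def \<sigma>_def, (simp add: abs_if split: if_splits)+)
      qed
      then have "x \<in> ccube (c (q, p, \<sigma>)) (a q / 2)"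
        unfolding ccube_def mem_Collect_eq infnorm_le_iff by blast
      moreover have "(q, p, \<sigma>) \<in> I" using inP q by (simp add: I_def)
      ultimately show "x \<in> (\<Union>i\<in>I. ccube (c i) ((case i of (q, p, \<sigma>) \<Rightarrow> a q) / 2))"
        by (intro UN_I[of "(q, p, \<sigma>)"]) auto
    qed
    show "0 \<le> (case i of (q, p, \<sigma>) \<Rightarrow> a q) \<and> (case i of (q, p, \<sigma>) \<Rightarrow> a q) \<le> \<delta>" if "i \<in> I" for i
      using that a by (auto simp: I_def)
    fix J assume J: "J \<subseteq> I" "finite J"
    obtain M where M: "\<And>q. q \<in> fst ` J \<Longrightarrow> q < M"
      using J(2) by (meson finite_imageI finite_nat_set_iff_bounded)
    define J' where "J' = (SIGMA q:{Q..<M}. P q \<times> (UNIV :: 'n set set))"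
    have fJ: "0 \<le> f (a q)" if "Q \<le> q" for q using a[OF that] dimension_functionD(1)[OF f] by simp
    have finJ': "finite J'" using finP by (auto simp: J'_def Q_def)
    have "J \<subseteq> J'" using J(1) M by (force simp: I_def J'_def)
    then have "(\<Sum>i\<in>J. f (case i of (q, p, \<sigma>) \<Rightarrow> a q)) \<le> (\<Sum>i\<in>J'. f (case i of (q, p, \<sigma>) \<Rightarrow> a q))"
      using finJ' fJ by (intro sum_mono2) (auto simp: J'_def)
    also have "\<dots> = (\<Sum>(q, y)\<in>J'. f (a q))" by (simp add: case_prod_unfold)
    also have "\<dots> = (\<Sum>q = Q..<M. \<Sum>y\<in>P q \<times> (UNIV :: 'n set set). f (a q))"
      unfolding J'_def using finP by (intro sum.Sigma[symmetric]) (auto simp: Q_def)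
    also have "\<dots> = (\<Sum>q = Q..<M. 2 ^ n * (real (card (P q)) * f (a q)))"
      by (simp add: card_cartesian_product card_UNIV_set n_def mult_ac)
    also have "\<dots> \<le> (\<Sum>q = Q..<M. 2 ^ n * (2 ^ n * real q ^ n * f (a q)))"
      using finP fJ by (intro sum_mono mult_left_mono mult_right_mono) (auto simp: Q_def)
    also have "\<dots> = K * (\<Sum>q = Q..<M. real q ^ n * f (a q))"
    proof -
      have "2 ^ n * (2 ^ n * y) = K * y" for y :: real
        unfolding K_def mult.assoc[symmetric] power_mult_distrib[symmetric] by simp
      then show ?thesis unfolding sum_distrib_left by (simp only: mult.assoc)
    qed
    also have "\<dots> \<le> K * (e / K)"
    proof (rule mult_left_mono)
      have "Q\<^sub>1 \<le> Q" by (simp add: Q_def)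
      then show "(\<Sum>q = Q..<M. real q ^ n * f (a q)) \<le> e / K"
        using Q\<^sub>1[of Q M] by (simp add: abs_less_iff)
    qed (use K in simp)
    also have "\<dots> = e" using K by simp
    finally show "(\<Sum>i\<in>J. f (case i of (q, p, \<sigma>) \<Rightarrow> a q)) \<le> e" .
  qed (use \<delta> in simp)
qed

section \<open>Mass transference\<close>

text \<open>The children are cells of side \<open>a q\<close> inside disjoint cubes of radius
  \<open>s * \<rho> q\<close>; since \<open>s ^ n = r ^ n / (6 ^ n * (2 * M))\<close>, Vitali
  selection gives them total weight at least M. A set meeting two cells has to cross the gap around
  each cell it meets, so its diameter d dominates \<open>s * \<rho> q\<close>, and the cubes around
  these cells pack into a cube of radius 3 * d. The quantifiers over B and d stand in the conclusion
  because one J has to serve all covering sets.\<close>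

lemma ocube_children:
  fixes z :: "int ^ 'n \<Rightarrow> nat \<Rightarrow> real ^ 'n" and \<rho> a :: "nat \<Rightarrow> real"
  defines "n \<equiv> CARD('n)"
  assumes full: "\<And>s Q. 0 < s \<Longrightarrow> negligible (box 0 1 - (\<Union>q\<in>{Q..}. \<Union>p. ocube (z p q) (s * \<rho> q)))"
    and lim: "\<rho> \<longlonglongrightarrow> 0" and \<rho>_pos: "\<And>q. 1 \<le> q \<Longrightarrow> 0 < \<rho> q"
    and ratio: "\<And>K. \<forall>\<^sub>F q in sequentially. K * a q \<le> \<rho> q"
    and a_pos: "\<And>q. 1 \<le> q \<Longrightarrow> 0 < a q"
    and r: "0 < r" "ocube x r \<subseteq> box 0 1" and M: "0 < M"
  obtains J where "finite J" "\<And>p q. (p, q) \<in> J \<Longrightarrow> Q \<le> q \<and> 1 \<le> q \<and> ccube (z p q) (a q / 2) \<subseteq> ocube x r"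
    "M \<le> (\<Sum>(p, q)\<in>J. \<rho> q ^ n)"
    "\<forall>B d. \<forall>j\<in>J. \<forall>k\<in>J. (\<forall>u\<in>B. \<forall>v\<in>B. infnorm (u - v) \<le> d) \<longrightarrow> j \<noteq> k \<longrightarrow>
       B \<inter> ccube (case_prod z j) (a (snd j) / 2) \<noteq> {} \<longrightarrow>
       B \<inter> ccube (case_prod z k) (a (snd k) / 2) \<noteq> {} \<longrightarrow>
       (\<Sum>(p, q)\<in>{j \<in> J. B \<inter> ccube (case_prod z j) (a (snd j) / 2) \<noteq> {}}. \<rho> q ^ n) \<le> 2 * 18 ^ n * M * d ^ n / r ^ n"
proof -
  have n: "0 < n" by (simp add: n_def)
  define s where "s = r / (6 * root n (2 * M))"
  have s: "0 < s" using r M n by (simp add: s_def)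
  have sn: "s ^ n = r ^ n / (6 ^ n * (2 * M))"
    using M n by (simp add: s_def power_divide power_mult_distrib)
  have "\<forall>\<^sub>F q in sequentially. \<rho> q < r / 4 / s"
    using lim r s by (intro order_tendstoD) auto
  moreover have "\<forall>\<^sub>F q in sequentially. 2 / s * a q \<le> \<rho> q" by (rule ratio)
  ultimately have "\<forall>\<^sub>F q in sequentially. \<rho> q < r / 4 / s \<and> 2 / s * a q \<le> \<rho> q"
    by (rule eventually_conj)
  then obtain Q\<^sub>1 where Q\<^sub>1: "\<And>q. Q\<^sub>1 \<le> q \<Longrightarrow> \<rho> q < r / 4 / s \<and> 2 / s * a q \<le> \<rho> q"
    by (auto simp: eventually_sequentially)
  define Q\<^sub>2 where "Q\<^sub>2 = max 1 (max Q Q\<^sub>1)"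
  have small: "s * \<rho> q \<le> r / 4" "a q \<le> s * \<rho> q / 2" "0 < s * \<rho> q" "0 < a q" if "Q\<^sub>2 \<le> q" for q
  proof -
    have q: "Q\<^sub>1 \<le> q" "1 \<le> q" using that by (auto simp: Q\<^sub>2_def)
    then show "s * \<rho> q \<le> r / 4" "a q \<le> s * \<rho> q / 2"
      using Q\<^sub>1[OF q(1)] s by (auto simp: field_simps)
    show "0 < s * \<rho> q" "0 < a q" using \<rho>_pos[OF q(2)] a_pos[OF q(2)] s by auto
  qed
  \<comment> \<open>A cube of radius at most r / 4 that meets the half-size cube stays inside the
    full one.\<close>
  define G where "G = ocube x (r / 2)"
  define C where "C e = ocube (case_prod z e) (s * \<rho> (snd e))" for e :: "(int ^ 'n) \<times> nat"
  define I where "I = {e :: (int ^ 'n) \<times> nat. Q\<^sub>2 \<le> snd e}"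
  have G_meas: "measure lebesgue G = r ^ n"
    unfolding G_def n_def using r by (subst measure_ocube) auto
  have GC: "G \<inter> C e \<in> lmeasurable" for e
    unfolding G_def C_def by (intro fmeasurable.Int) auto
  have GU: "G \<inter> (\<Union>e\<in>I. C e) \<in> lmeasurable"
    by (intro lmeasurable_open bounded_Int) (auto simp: G_def C_def ocube_eq_box)
  have "r ^ n \<le> measure lebesgue (G \<inter> (\<Union>e\<in>I. C e))"
  proof -
    have "G \<subseteq> box 0 1" using r ocube_mono[of "r / 2" r x] by (auto simp: G_def)
    moreover have "(\<Union>e\<in>I. C e) = (\<Union>q\<in>{Q\<^sub>2..}. \<Union>p. ocube (z p q) (s * \<rho> q))"
      by (force simp: I_def C_def)
    ultimately have "G - (\<Union>e\<in>I. C e) \<subseteq> box 0 1 - (\<Union>q\<in>{Q\<^sub>2..}. \<Union>p. ocube (z p q) (s * \<rho> q))" by auto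
    then have null: "negligible (G - (\<Union>e\<in>I. C e))" using full[OF s] negligible_subset by blast
    have "measure lebesgue G \<le> measure lebesgue ((G \<inter> (\<Union>e\<in>I. C e)) \<union> (G - (\<Union>e\<in>I. C e)))"
      using GU null negligible_imp_measurable[OF null] fmeasurable.Un[OF GU negligible_imp_measurable[OF null]]
      by (intro measure_mono_fmeasurable) (auto simp: G_def)
    also have "\<dots> \<le> measure lebesgue (G \<inter> (\<Union>e\<in>I. C e)) + measure lebesgue (G - (\<Union>e\<in>I. C e))"
      using GU negligible_imp_measurable[OF null] by (intro measure_Un_le) (auto dest: fmeasurableD)
    finally show ?thesis using negligible_imp_measure0[OF null] G_meas by simp
  qed
  moreover have Un_eq: "\<Union>((\<lambda>e. G \<inter> C e) ` I) = G \<inter> (\<Union>e\<in>I. C e)" by auto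
  \<comment> \<open>Half of the volume of \<open>G\<close> is given up to pass to finitely many
    cubes, as the Vitali selection requires.\<close>
  moreover obtain \<D> where \<D>: "\<D> \<subseteq> (\<lambda>e. G \<inter> C e) ` I" "finite \<D>"
    "measure lebesgue (\<Union>((\<lambda>e. G \<inter> C e) ` I)) - r ^ n / 2 < measure lebesgue (\<Union>\<D>)"
  proof (rule measure_countable_Union_approachable[of "(\<lambda>e. G \<inter> C e) ` I" "r ^ n / 2" "measure lebesgue G"])
    show "countable ((\<lambda>e. G \<inter> C e) ` I)"
      by (rule countable_image) (rule countableI_type)
    show "0 < r ^ n / 2" using r by simp
    show "d \<in> lmeasurable" if "d \<in> (\<lambda>e. G \<inter> C e) ` I" for d using that GC by auto
    fix \<D>' assume D': "\<D>' \<subseteq> (\<lambda>e. G \<inter> C e) ` I" "finite \<D>'"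
    have "\<Union>\<D>' \<in> lmeasurable" using D' GC by (intro fmeasurable.finite_Union) auto
    then show "measure lebesgue (\<Union>\<D>') \<le> measure lebesgue G"
      using D' by (intro measure_mono_fmeasurable) (auto simp: G_def dest: fmeasurableD)
  qed
  ultimately have D_ge: "r ^ n / 2 < measure lebesgue (\<Union>\<D>)" by simp
  obtain I\<^sub>1 where I\<^sub>1: "I\<^sub>1 \<subseteq> I" "finite I\<^sub>1" "\<D> = (\<lambda>e. G \<inter> C e) ` I\<^sub>1"
    using \<D>(1,2) by (meson finite_subset_image)
  define I\<^sub>2 where "I\<^sub>2 = {e \<in> I\<^sub>1. G \<inter> C e \<noteq> {}}"
  have "\<Union>\<D> \<subseteq> (\<Union>e\<in>I\<^sub>2. ocube (case_prod z e) (s * \<rho> (snd e)))"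
    unfolding I\<^sub>1(3) I\<^sub>2_def C_def by blast
  moreover have "finite I\<^sub>2" using I\<^sub>1 by (simp add: I\<^sub>2_def)
  moreover have D_sets: "\<Union>\<D> \<in> sets lebesgue"
    using \<D>(2) GC unfolding I\<^sub>1(3) by (intro sets.finite_Union) (auto dest: fmeasurableD)
  moreover have I\<^sub>2_Q: "Q\<^sub>2 \<le> snd e" if "e \<in> I\<^sub>2" for e using that I\<^sub>1 by (auto simp: I\<^sub>2_def I_def)
  ultimately obtain J where J: "J \<subseteq> I\<^sub>2" "disjoint_family_on (\<lambda>e. ocube (case_prod z e) (s * \<rho> (snd e))) J"
    "measure lebesgue (\<Union>\<D>) \<le> (\<Sum>e\<in>J. (6 * (s * \<rho> (snd e))) ^ CARD('n))"
    using small(3) by (elim finite_Vitali_measure[rotated 2]) auto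
  have finJ: "finite J" using J(1) \<open>finite I\<^sub>2\<close> finite_subset by blast
  have JQ: "Q\<^sub>2 \<le> snd e" if "e \<in> J" for e using I\<^sub>2_Q[OF subsetD[OF J(1) that]] .
  have cc: "ccube (case_prod z e) (a (snd e) / 2) \<subseteq> ocube (case_prod z e) (s * \<rho> (snd e))" if "e \<in> J" for e
    using small[OF JQ[OF that]] by (auto simp: ccube_def ocube_def)
  have sub: "ocube (case_prod z e) (s * \<rho> (snd e)) \<subseteq> ocube x r" if "e \<in> J" for e
  proof (rule ocube_subset)
    have "G \<inter> C e \<noteq> {}" using that J(1) by (auto simp: I\<^sub>2_def)
    then have "infnorm (x - case_prod z e) < r / 2 + s * \<rho> (snd e)"
      unfolding G_def C_def by (rule ocube_Int_imp)
    then show "infnorm (case_prod z e - x) + s * \<rho> (snd e) \<le> r"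
      using small(1)[OF JQ[OF that]] infnorm_sub[of x "case_prod z e"] by linarith
  qed
  show ?thesis
  proof (rule that[of J])
    show "finite J" by fact
    show "Q \<le> q \<and> 1 \<le> q \<and> ccube (z p q) (a q / 2) \<subseteq> ocube x r" if "(p, q) \<in> J" for p q
    proof -
      have "ccube (z p q) (a q / 2) \<subseteq> ocube x r" using cc[OF that] sub[OF that] by simp
      then show ?thesis using JQ[OF that] by (simp add: Q\<^sub>2_def)
    qed
    have "r ^ n / 2 \<le> (\<Sum>e\<in>J. (6 * (s * \<rho> (snd e))) ^ n)"
      using D_ge J(3) by (simp add: n_def)
    also have "\<dots> = 6 ^ n * s ^ n * (\<Sum>e\<in>J. \<rho> (snd e) ^ n)"
      by (simp add: power_mult_distrib sum_distrib_left mult_ac)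
    also have "\<dots> = r ^ n / (2 * M) * (\<Sum>e\<in>J. \<rho> (snd e) ^ n)" by (simp add: sn)
    finally show "M \<le> (\<Sum>(p, q)\<in>J. \<rho> q ^ n)"
      using M r by (simp add: field_simps case_prod_unfold)
  next
    show "\<forall>B d. \<forall>j\<in>J. \<forall>k\<in>J. (\<forall>u\<in>B. \<forall>v\<in>B. infnorm (u - v) \<le> d) \<longrightarrow> j \<noteq> k \<longrightarrow>
       B \<inter> ccube (case_prod z j) (a (snd j) / 2) \<noteq> {} \<longrightarrow>
       B \<inter> ccube (case_prod z k) (a (snd k) / 2) \<noteq> {} \<longrightarrow>
       (\<Sum>(p, q)\<in>{j \<in> J. B \<inter> ccube (case_prod z j) (a (snd j) / 2) \<noteq> {}}. \<rho> q ^ n)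
         \<le> 2 * 18 ^ n * M * d ^ n / r ^ n"
    proof (intro allI ballI impI)
      fix B d j k
      assume B0: "\<forall>u\<in>B. \<forall>v\<in>B. infnorm (u - v) \<le> d"
        and jk: "j \<in> J" "k \<in> J" "j \<noteq> k" "B \<inter> ccube (case_prod z j) (a (snd j) / 2) \<noteq> {}"
          "B \<inter> ccube (case_prod z k) (a (snd k) / 2) \<noteq> {}"
      have B: "infnorm (u - v) \<le> d" if "u \<in> B" "v \<in> B" for u v using B0 that by blast
      define E where "E = {j \<in> J. B \<inter> ccube (case_prod z j) (a (snd j) / 2) \<noteq> {}}"
      obtain b where b: "b \<in> B" using jk by blast
      \<comment> \<open>The point \<open>w\<close> lies outside the cube about \<open>e\<close>, and
        \<open>y\<close> within a quarter of the radius of its centre, so d is at least 3 / 4 of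
        that radius. Everything in the cube is then within d + 5 / 4 * (4 / 3 * d) \<le> 3 * d of
        \<open>b\<close>.\<close>
      have far: "s * \<rho> (snd e) \<le> 4 / 3 * d" "infnorm (case_prod z e - b) \<le> d + s * \<rho> (snd e) / 4"
        if e: "e \<in> E" for e
      proof -
        obtain k' where k': "k' \<in> E" "k' \<noteq> e" using jk by (metis (mono_tags, lifting) E_def mem_Collect_eq)
        obtain y where y: "y \<in> B" "y \<in> ccube (case_prod z e) (a (snd e) / 2)" using e by (auto simp: E_def)
        obtain w where w: "w \<in> B" "w \<in> ccube (case_prod z k') (a (snd k') / 2)" using k' by (auto simp: E_def)
        have eJ: "e \<in> J" "k' \<in> J" using e k' by (auto simp: E_def)
        have "w \<notin> ocube (case_prod z e) (s * \<rho> (snd e))"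
          using J(2) eJ k'(2) cc[OF eJ(2)] w(2) unfolding disjoint_family_on_def by blast
        then have w1: "s * \<rho> (snd e) \<le> infnorm (w - case_prod z e)" by (simp add: ocube_def)
        have y1: "infnorm (y - case_prod z e) \<le> s * \<rho> (snd e) / 4"
          using y(2) small(2)[OF JQ[OF eJ(1)]] by (simp add: ccube_def)
        show "s * \<rho> (snd e) \<le> 4 / 3 * d"
          using w1 y1 infnorm_triangle3[of w "case_prod z e" y] B[OF w(1) y(1)] by linarith
        show "infnorm (case_prod z e - b) \<le> d + s * \<rho> (snd e) / 4"
          using y1 infnorm_triangle3[of "case_prod z e" b y] infnorm_sub[of y "case_prod z e"] B[OF y(1) b]
          by linarith
      qed
      have d: "0 \<le> d" using B[OF b b] by (simp add: infnorm_0)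
      have "(\<Sum>e\<in>E. (s * \<rho> (snd e)) ^ n) \<le> (3 * d) ^ n"
        unfolding n_def
      proof (rule sum_cube_packing_ocube)
        show "finite E" using finJ by (simp add: E_def)
        show "disjoint_family_on (\<lambda>e. ocube (case_prod z e) (s * \<rho> (snd e))) E"
          by (rule disjoint_family_on_mono[OF _ J(2)]) (auto simp: E_def)
        show "0 \<le> s * \<rho> (snd e)" if "e \<in> E" for e
          using small(3)[of "snd e"] JQ[of e] that by (auto simp: E_def)
        show "ocube (case_prod z e) (s * \<rho> (snd e)) \<subseteq> ocube b (3 * d)" if "e \<in> E" for e
          using far[OF that] d by (intro ocube_subset) linarith
      qed (use d in simp)
      then have "s ^ n * (\<Sum>e\<in>E. \<rho> (snd e) ^ n) \<le> 3 ^ n * d ^ n"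
        by (simp add: power_mult_distrib sum_distrib_left)
      then have "(\<Sum>e\<in>E. \<rho> (snd e) ^ n) \<le> 3 ^ n * d ^ n / s ^ n"
        using s by (simp add: field_simps)
      also have "\<dots> = 2 * (3 ^ n * 6 ^ n) * M * d ^ n / r ^ n" using M by (simp add: sn)
      also have "(3 :: real) ^ n * 6 ^ n = 18 ^ n" unfolding power_mult_distrib[symmetric] by simp
      finally show "(\<Sum>(p, q)\<in>{j \<in> J. B \<inter> ccube (case_prod z j) (a (snd j) / 2) \<noteq> {}}. \<rho> q ^ n)
          \<le> 2 * 18 ^ n * M * d ^ n / r ^ n"
        by (simp add: E_def case_prod_unfold)
    qed
  qed
qed

section \<open>Cost of the covering sets that meet a cell\<close>

definition cover_load :: "(nat \<Rightarrow> 'a set) \<Rightarrow> (nat \<Rightarrow> real) \<Rightarrow> 'a set \<Rightarrow> real" where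
  "cover_load A w L = (\<Sum>i. if A i \<inter> L \<noteq> {} then w i else 0)"

lemma summable_cover_load:
  fixes w :: "nat \<Rightarrow> real"
  assumes "summable w" "\<And>i. 0 \<le> w i"
  shows "summable (\<lambda>i. if A i \<inter> L \<noteq> {} then w i else 0)"
  by (rule summable_comparison_test'[OF assms(1), of 0]) (use assms in auto)

lemma cover_load_mono:
  assumes "summable w" "\<And>i. 0 \<le> w i" "L \<subseteq> L'"
  shows "cover_load A w L \<le> cover_load A w L'"
  unfolding cover_load_def
  using assms by (intro suminf_le summable_cover_load) auto

lemma cover_load_ge:
  assumes "summable w" "\<And>i. 0 \<le> w i" "A i \<inter> L \<noteq> {}"
  shows "w i \<le> cover_load A w L"
proof -
  have "(\<Sum>j\<in>{i}. if A j \<inter> L \<noteq> {} then w j else 0) \<le> cover_load A w L"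
    unfolding cover_load_def using assms by (intro sum_le_suminf summable_cover_load) auto
  then show ?thesis using assms by simp
qed

text \<open>If every child were overloaded, then so would be the parent: a covering set that meets one child is
  counted at most once, and one that meets several is large enough to pay for all of them, even when
  its contribution at each child is truncated at the threshold of that child.\<close>

lemma exists_light_child:
  fixes L :: "'j \<Rightarrow> 'a set" and v :: "'j \<Rightarrow> real"
  assumes w: "summable w" "\<And>i. 0 \<le> w i" and J: "finite J"
    and L: "\<And>j. j \<in> J \<Longrightarrow> L j \<subseteq> L\<^sub>0" "\<And>j. j \<in> J \<Longrightarrow> 0 \<le> v j"
    and total: "cover_load A w L\<^sub>0 < sum v J"
    and several: "\<And>i j k. j \<in> J \<Longrightarrow> k \<in> J \<Longrightarrow> j \<noteq> k \<Longrightarrow> A i \<inter> L j \<noteq> {} \<Longrightarrow> A i \<inter> L k \<noteq> {} \<Longrightarrow>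
      sum v {j \<in> J. A i \<inter> L j \<noteq> {}} \<le> w i"
  shows "\<exists>j\<in>J. cover_load A w (L j) \<le> v j"
proof (rule ccontr)
  assume "\<not> ?thesis"
  then have heavy: "v j < cover_load A w (L j)" if "j \<in> J" for j using that by force
  define m where "m i j = (if A i \<inter> L j \<noteq> {} then min (w i) (v j) else 0)" for i j
  have m: "0 \<le> m i j" "m i j \<le> w i" if "j \<in> J" for i j
    using w(2) L(2)[OF that] by (auto simp: m_def)
  have sm: "summable (\<lambda>i. m i j)" if "j \<in> J" for j
    by (rule summable_comparison_test'[OF w(1), of 0]) (use m[OF that] in auto)
  \<comment> \<open>Truncation is harmless below the threshold: either one covering set already
    contributes \<open>v j\<close>, or nothing is cut off and the load itself exceeds
    \<open>v j\<close>.\<close>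
  have "v j \<le> (\<Sum>i. m i j)" if j: "j \<in> J" for j
  proof (cases "\<exists>i. A i \<inter> L j \<noteq> {} \<and> v j \<le> w i")
    case True
    then obtain i where i: "A i \<inter> L j \<noteq> {}" "v j \<le> w i" by blast
    have "(\<Sum>i'\<in>{i}. m i' j) \<le> (\<Sum>i. m i j)"
      using m[OF j] sm[OF j] by (intro sum_le_suminf) auto
    then show ?thesis using i by (simp add: m_def min_def split: if_splits)
  next
    case False
    then have "m i j = (if A i \<inter> L j \<noteq> {} then w i else 0)" for i by (auto simp: m_def)
    then show ?thesis using heavy[OF j] by (simp add: cover_load_def)
  qed
  then have "sum v J \<le> (\<Sum>j\<in>J. \<Sum>i. m i j)" by (rule sum_mono)
  also have "\<dots> = (\<Sum>i. \<Sum>j\<in>J. m i j)" using sm by (intro suminf_sum[symmetric]) auto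
  also have "\<dots> \<le> cover_load A w L\<^sub>0"
    unfolding cover_load_def
  proof (rule suminf_le)
    fix i
    define E where "E = {j \<in> J. A i \<inter> L j \<noteq> {}}"
    have E: "finite E" "E \<subseteq> J" using J by (auto simp: E_def)
    have sumE: "(\<Sum>j\<in>J. m i j) = (\<Sum>j\<in>E. min (w i) (v j))"
    proof -
      have "(\<Sum>j\<in>J. m i j) = (\<Sum>j\<in>E. m i j)"
        using J by (intro sum.mono_neutral_right) (auto simp: E_def m_def)
      also have "\<dots> = (\<Sum>j\<in>E. min (w i) (v j))"
        by (intro sum.cong) (auto simp: E_def m_def)
      finally show ?thesis .
    qed
    show "(\<Sum>j\<in>J. m i j) \<le> (if A i \<inter> L\<^sub>0 \<noteq> {} then w i else 0)"
    proof (cases "E = {}")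
      case True
      then show ?thesis using sumE w(2) by simp
    next
      case False
      then obtain j where j: "j \<in> E" by blast
      have meet: "A i \<inter> L\<^sub>0 \<noteq> {}" using j L(1)[of j] by (auto simp: E_def)
      have "(\<Sum>j\<in>E. min (w i) (v j)) \<le> w i"
      proof (cases "E = {j}")
        case False
        then obtain k where k: "k \<in> E" "k \<noteq> j" using j by blast
        have "(\<Sum>j\<in>E. min (w i) (v j)) \<le> sum v E" by (intro sum_mono) simp
        also have "\<dots> \<le> w i" using several[of k j i] j k by (simp add: E_def)
        finally show ?thesis .
      qed simp
      then show ?thesis using sumE meet by simp
    qed
  next
    show "summable (\<lambda>i. \<Sum>j\<in>J. m i j)" using sm by (intro summable_sum) auto
    show "summable (\<lambda>i. if A i \<inter> L\<^sub>0 \<noteq> {} then w i else 0)" using w by (rule summable_cover_load)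
  qed
  finally show False using total by simp
qed

text \<open>Each light cell has a light child of larger denominator, because its load is below c
  times the total weight of its children. A covering set containing the common point of the cells
  would meet all of them, so its positive cost would be at most \<open>c * \<rho> q ^ n\<close> for
  arbitrarily large q, which tends to 0. The constant is 1 / c = 2 * 18^n * 2 * 2^n: the factor from
  \<open>ocube_children\<close>, the weight 2 * f l demanded from a cell of side l, and its radius l
  / 2.\<close>

lemma mass_transference_point:
  fixes z :: "int ^ 'n \<Rightarrow> nat \<Rightarrow> real ^ 'n" and \<rho> a :: "nat \<Rightarrow> real" and f :: "real \<Rightarrow> real"
  defines "n \<equiv> CARD('n)"
  defines "c \<equiv> 1 / (4 * 36 ^ n)"
  assumes full: "\<And>s Q. 0 < s \<Longrightarrow> negligible (box 0 1 - (\<Union>q\<in>{Q..}. \<Union>p. ocube (z p q) (s * \<rho> q)))"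
    and lim: "\<rho> \<longlonglongrightarrow> 0" and \<rho>_pos: "\<And>q. 1 \<le> q \<Longrightarrow> 0 < \<rho> q"
    and ratio: "\<And>K. \<forall>\<^sub>F q in sequentially. K * a q \<le> \<rho> q"
    and a_pos: "\<And>q. 1 \<le> q \<Longrightarrow> 0 < a q"
    and fa: "\<And>q. 1 \<le> q \<Longrightarrow> f (a q) = \<rho> q ^ n"
    and f: "mono_on {0..} f" "\<And>r. 0 < r \<Longrightarrow> 0 < f r" "antimono_on {0<..} (\<lambda>r. f r / r ^ n)"
    and A: "\<And>i u v. u \<in> A i \<Longrightarrow> v \<in> A i \<Longrightarrow> infnorm (u - v) \<le> d i" "\<And>i. 0 < d i"
    and sm: "summable (\<lambda>i. f (d i))" and M: "0 < M" "(\<Sum>i. f (d i)) < c * M"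
    and d_small: "\<And>i. c * (2 * 36 ^ n * M) * d i ^ n \<le> f (d i)"
  obtains x where "x \<in> box 0 1" "x \<notin> (\<Union>i. A i)" "\<And>Q. \<exists>q\<ge>Q. 1 \<le> q \<and> (\<exists>p. x \<in> ocube (z p q) (a q))"
proof -
  have c: "0 < c" by (simp add: c_def)
  define w where "w i = f (d i)" for i
  have w: "summable w" "\<And>i. 0 < w i"
    using sm f(2) A(2) by (simp_all add: w_def[abs_def])
  have w0: "\<And>i. 0 \<le> w i" using w(2) by (rule less_imp_le)
  define cell where "cell e = ccube (case_prod z e) (a (snd e) / 2)" for e :: "(int ^ 'n) \<times> nat"
  define good where "good e \<longleftrightarrow> 1 \<le> snd e \<and> cell e \<subseteq> box 0 1 \<and> cover_load A w (cell e) \<le> c * f (a (snd e))"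
    for e
  have step: "\<exists>e. Q \<le> snd e \<and> 1 \<le> snd e \<and> cell e \<subseteq> ocube x r \<and> cover_load A w (cell e) \<le> c * f (a (snd e))"
    if r: "0 < r" "ocube x r \<subseteq> box 0 1" and M': "0 < M'" "cover_load A w (ocube x r) < c * M'"
      and big: "\<And>i. A i \<inter> ocube x r \<noteq> {} \<Longrightarrow> c * (2 * 18 ^ n * M' * d i ^ n / r ^ n) \<le> w i"
    for x r M' Q
  proof -
    obtain J where J: "finite J"
      "\<And>p q. (p, q) \<in> J \<Longrightarrow> Q \<le> q \<and> 1 \<le> q \<and> ccube (z p q) (a q / 2) \<subseteq> ocube x r"
      "M' \<le> (\<Sum>(p, q)\<in>J. \<rho> q ^ n)"
      "\<forall>B d. \<forall>j\<in>J. \<forall>k\<in>J. (\<forall>u\<in>B. \<forall>v\<in>B. infnorm (u - v) \<le> d) \<longrightarrow> j \<noteq> k \<longrightarrow>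
       B \<inter> ccube (case_prod z j) (a (snd j) / 2) \<noteq> {} \<longrightarrow>
       B \<inter> ccube (case_prod z k) (a (snd k) / 2) \<noteq> {} \<longrightarrow>
       (\<Sum>(p, q)\<in>{j \<in> J. B \<inter> ccube (case_prod z j) (a (snd j) / 2) \<noteq> {}}. \<rho> q ^ n)
         \<le> 2 * 18 ^ n * M' * d ^ n / r ^ n"
    proof (rule ocube_children[where z = z and \<rho> = \<rho> and a = a and r = r and x = x and M = M' and Q = Q, folded n_def])
      show "negligible (box 0 1 - (\<Union>q\<in>{Q..}. \<Union>p. ocube (z p q) (s * \<rho> q)))" if "0 < s" for s Q
        using that by (rule full)
      show "\<rho> \<longlonglongrightarrow> 0" "0 < r" "ocube x r \<subseteq> box 0 1" "0 < M'" by fact+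
      show "0 < \<rho> q" "0 < a q" if "1 \<le> q" for q using that \<rho>_pos a_pos by blast+
      show "\<forall>\<^sub>F q in sequentially. K * a q \<le> \<rho> q" for K by (rule ratio)
    qed (rule that)
    have J2: "Q \<le> snd e" "1 \<le> snd e" "cell e \<subseteq> ocube x r" if "e \<in> J" for e
      using J(2)[of "fst e" "snd e"] that by (auto simp: cell_def case_prod_unfold)
    have "\<exists>j\<in>J. cover_load A w (cell j) \<le> c * \<rho> (snd j) ^ n"
    proof (rule exists_light_child[OF w(1) w0 J(1) J2(3)])
      show "0 \<le> c * \<rho> (snd j) ^ n" if "j \<in> J" for j
        using c \<rho>_pos[OF J2(2)[OF that]] by simp
      have "c * M' \<le> c * (\<Sum>j\<in>J. \<rho> (snd j) ^ n)"
        using c J(3) by (intro mult_left_mono) (auto simp: case_prod_unfold)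
      then show "cover_load A w (ocube x r) < (\<Sum>j\<in>J. c * \<rho> (snd j) ^ n)"
        using M'(2) by (simp add: sum_distrib_left)
      fix i j k assume jk: "j \<in> J" "k \<in> J" "j \<noteq> k" "A i \<inter> cell j \<noteq> {}" "A i \<inter> cell k \<noteq> {}"
      have "(\<Sum>(p, q)\<in>{j \<in> J. A i \<inter> cell j \<noteq> {}}. \<rho> q ^ n) \<le> 2 * 18 ^ n * M' * d i ^ n / r ^ n"
        using J(4)[rule_format, of j k "A i" "d i"] A(1) jk by (simp add: cell_def)
      then have "c * (\<Sum>(p, q)\<in>{j \<in> J. A i \<inter> cell j \<noteq> {}}. \<rho> q ^ n) \<le> c * (2 * 18 ^ n * M' * d i ^ n / r ^ n)"
        using c by (intro mult_left_mono) auto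
      also have "\<dots> \<le> w i" using jk J2(3)[OF jk(1)] by (intro big) auto
      finally show "(\<Sum>j\<in>{j \<in> J. A i \<inter> cell j \<noteq> {}}. c * \<rho> (snd j) ^ n) \<le> w i"
        by (simp add: sum_distrib_left case_prod_unfold)
    qed
    then obtain e where "e \<in> J" "cover_load A w (cell e) \<le> c * \<rho> (snd e) ^ n" by blast
    then show ?thesis using J2[of e] fa[of "snd e"] by (intro exI[of _ e]) simp
  qed
  have unit: "ocube (vec (1 / 2)) (1 / 2) = box 0 (1 :: real ^ 'n)"
  proof -
    have "vec (1 / 2) - vec (1 / 2) = (0 :: real ^ 'n)" "vec (1 / 2) + vec (1 / 2) = (1 :: real ^ 'n)"
      by (simp_all add: vec_eq_iff)
    then show ?thesis by (simp only: ocube_eq_box)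
  qed
  have "\<exists>e. 0 \<le> snd e \<and> 1 \<le> snd e \<and> cell e \<subseteq> ocube (vec (1 / 2)) (1 / 2) \<and>
      cover_load A w (cell e) \<le> c * f (a (snd e))"
  proof (rule step)
    have "cover_load A w (ocube (vec (1 / 2)) (1 / 2)) \<le> cover_load A w UNIV"
      by (intro cover_load_mono w(1) w0) auto
    also have "\<dots> \<le> (\<Sum>i. w i)"
      unfolding cover_load_def using w w0 by (intro suminf_le summable_cover_load) auto
    finally show "cover_load A w (ocube (vec (1 / 2)) (1 / 2)) < c * M" using M(2) by (simp add: w_def)
    fix i
    have "(2 :: real) * 18 ^ n * M * d i ^ n / (1 / 2) ^ n = 2 * (18 ^ n * 2 ^ n) * M * d i ^ n"
      by (simp add: power_divide)
    also have "(18 :: real) ^ n * 2 ^ n = 36 ^ n" unfolding power_mult_distrib[symmetric] by simp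
    finally show "c * (2 * 18 ^ n * M * d i ^ n / (1 / 2) ^ n) \<le> w i"
      using d_small[of i] by (simp add: w_def mult_ac)
  qed (use unit M in auto)
  then obtain e\<^sub>0 where e\<^sub>0: "good e\<^sub>0" unfolding good_def unit by blast
  have next_cell: "\<exists>e'. good e' \<and> snd e < snd e' \<and> cell e' \<subseteq> cell e" if e: "good e" for e
  proof -
    define l where "l = a (snd e)"
    have l: "0 < l" "0 < f l" using e a_pos f(2) by (auto simp: good_def l_def)
    have oc: "ocube (case_prod z e) (l / 2) \<subseteq> cell e" by (auto simp: ocube_def ccube_def cell_def l_def)
    have load: "cover_load A w (ocube (case_prod z e) (l / 2)) \<le> c * f l"
      using cover_load_mono[OF w(1) w0 oc, of A] e by (simp add: good_def l_def)
    have "\<exists>e'. Suc (snd e) \<le> snd e' \<and> 1 \<le> snd e' \<and> cell e' \<subseteq> ocube (case_prod z e) (l / 2) \<and>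
      cover_load A w (cell e') \<le> c * f (a (snd e'))"
    \<comment> \<open>The factor 2 makes the inherited load strictly smaller than c times the
      demanded weight.\<close>
    proof (rule step[of _ _ "2 * f l"])
      show "ocube (case_prod z e) (l / 2) \<subseteq> box 0 1" using oc e by (auto simp: good_def)
      show "cover_load A w (ocube (case_prod z e) (l / 2)) < c * (2 * f l)"
        using load mult_pos_pos[OF c l(2)] by simp
      \<comment> \<open>A covering set that meets a light cell costs less than \<open>f l\<close>,
        so its size is at most l, and the decreasing quotient gives
        \<open>f l / l ^ n * d i ^ n \<le> f (d i)\<close>. The size condition, assumed for the unit
        box as \<open>d_small\<close>, is thus automatic in later cells.\<close>
      fix i assume "A i \<inter> ocube (case_prod z e) (l / 2) \<noteq> {}"
      then have "w i \<le> c * f l" using cover_load_ge[OF w(1) w0] load by (meson order_trans)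
      moreover have "c < 1"
      proof -
        have "1 \<le> (36 :: real) ^ n" by (rule one_le_power) simp
        then have "1 < 4 * (36 :: real) ^ n" by linarith
        then show ?thesis by (simp add: c_def)
      qed
      then have "c * f l < 1 * f l" using l by (intro mult_strict_right_mono) auto
      ultimately have "f (d i) < f l" by (simp add: w_def)
      then have "d i \<le> l" using monotone_onD[OF f(1), of l "d i"] l A(2)[of i] by force
      then have "f l / l ^ n \<le> f (d i) / d i ^ n"
        using A(2)[of i] l by (intro monotone_onD[OF f(3)]) auto
      then have "f l / l ^ n * d i ^ n \<le> f (d i)" using A(2)[of i] by (simp add: pos_le_divide_eq)
      moreover have "c * (2 * 18 ^ n * (2 * f l) * d i ^ n / (l / 2) ^ n) = f l / l ^ n * d i ^ n"
      proof -
        have "c * (2 * 18 ^ n * (2 * f l) * d i ^ n / (l / 2) ^ n)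
          = c * (4 * (18 ^ n * 2 ^ n)) * (f l / l ^ n * d i ^ n)"
          by (simp add: power_divide)
        also have "(18 :: real) ^ n * 2 ^ n = 36 ^ n" unfolding power_mult_distrib[symmetric] by simp
        finally show ?thesis by (simp add: c_def)
      qed
      ultimately show "c * (2 * 18 ^ n * (2 * f l) * d i ^ n / (l / 2) ^ n) \<le> w i"
        by (simp add: w_def)
    qed (use l in auto)
    then obtain e' where e': "Suc (snd e) \<le> snd e'" "1 \<le> snd e'" "cell e' \<subseteq> ocube (case_prod z e) (l / 2)"
      "cover_load A w (cell e') \<le> c * f (a (snd e'))" by blast
    then have "cell e' \<subseteq> cell e" "cell e' \<subseteq> box 0 1" using oc e by (auto simp: good_def)
    then show ?thesis using e' unfolding good_def by (intro exI[of _ e']) auto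
  qed
  obtain E where E: "\<And>k. good (E k)" "\<And>k. snd (E k) < snd (E (Suc k))" "\<And>k. cell (E (Suc k)) \<subseteq> cell (E k)"
    using dependent_nat_choice[of "\<lambda>_. good" "\<lambda>_ e e'. snd e < snd e' \<and> cell e' \<subseteq> cell e"] e\<^sub>0 next_cell
    by metis
  have E_mono: "strict_mono (\<lambda>k. snd (E k))" using E(2) by (simp add: strict_mono_Suc_iff)
  have E_pos: "1 \<le> snd (E k)" for k using E(1)[of k] by (simp add: good_def)
  have "\<Inter>(range (\<lambda>k. cell (E k))) \<noteq> {}"
  proof (rule compact_nest)
    show "compact (cell (E k))" for k by (simp add: cell_def ccube_eq_cbox)
    show "cell (E k) \<noteq> {}" for k
    proof -
      have "case_prod z (E k) \<in> cell (E k)"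
        using a_pos[OF E_pos[of k]] by (simp add: cell_def ccube_def infnorm_0)
      then show ?thesis by blast
    qed
    show "cell (E k') \<subseteq> cell (E k)" if "k \<le> k'" for k k'
      using E(3) that by (rule lift_Suc_antimono_le)
  qed
  then obtain x where x: "\<And>k. x \<in> cell (E k)" by blast
  show ?thesis
  proof (rule that)
    show "x \<in> box 0 1" using x[of 0] E(1)[of 0] by (auto simp: good_def)
    show "x \<notin> (\<Union>i. A i)"
    proof
      assume "x \<in> (\<Union>i. A i)"
      then obtain i where i: "x \<in> A i" by blast
      have "w i \<le> c * \<rho> (snd (E k)) ^ n" for k
      proof -
        have "w i \<le> cover_load A w (cell (E k))" using i x by (intro cover_load_ge[OF w(1) w0]) auto
        then show ?thesis using E(1)[of k] fa[OF E_pos[of k]] by (simp add: good_def)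
      qed
      moreover have "(\<lambda>k. c * \<rho> (snd (E k)) ^ n) \<longlonglongrightarrow> c * 0 ^ n"
        using LIMSEQ_subseq_LIMSEQ[OF lim E_mono] by (intro tendsto_intros) (simp add: comp_def)
      ultimately have "w i \<le> c * 0 ^ n" by (intro LIMSEQ_le_const) auto
      then show False using w(2)[of i] by (simp add: n_def zero_power)
    qed
    fix Q
    have "Q \<le> snd (E Q)" using E_mono by (rule strict_mono_imp_increasing)
    moreover have "x \<in> ocube (z (fst (E Q)) (snd (E Q))) (a (snd (E Q)))"
      using x[of Q] a_pos[OF E_pos[of Q]] by (simp add: cell_def ccube_def ocube_def case_prod_unfold)
    ultimately show "\<exists>q\<ge>Q. 1 \<le> q \<and> (\<exists>p. x \<in> ocube (z p q) (a q))" using E_pos by blast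
  qed
qed

section \<open>The divergence case\<close>

text \<open>Only finitely many p satisfy |p| \<le> q, so \<open>Max\<close> bounds every element,
  and the finite limsup in [0, \<infinity>] becomes one real constant valid for all these p at
  once.\<close>

lemma gamma_bound:
  fixes \<psi> :: "nat \<Rightarrow> real"
    and \<gamma> :: "int ^ 'n \<Rightarrow> int \<Rightarrow> real ^ 'n"
    and b :: "nat \<Rightarrow> real"
  assumes lim: "Limsup (inf sequentially (principal {q. \<psi> q \<noteq> 0}))
           (\<lambda>q. ennreal (Max {infnorm (\<gamma> p (int q)) | p.
                               1 \<le> infnorm (int_vec p) \<and> infnorm (int_vec p) \<le> real q})
                / ennreal (b q)) < \<infinity>"
    and \<psi>: "\<And>q. 1 \<le> q \<Longrightarrow> \<psi> q \<noteq> 0" and b: "\<And>q. 1 \<le> q \<Longrightarrow> 0 < b q"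
  obtains C Q where "0 \<le> C" "1 \<le> Q"
    "\<And>p q. Q \<le> q \<Longrightarrow> 1 \<le> infnorm (int_vec p) \<Longrightarrow> infnorm (int_vec p) \<le> real q \<Longrightarrow>
      infnorm (\<gamma> p (int q)) \<le> C * b q"
proof -
  define S where "S q = {infnorm (\<gamma> p (int q)) | p. 1 \<le> infnorm (int_vec p) \<and> infnorm (int_vec p) \<le> real q}" for q
  obtain y where y: "Limsup (inf sequentially (principal {q. \<psi> q \<noteq> 0})) (\<lambda>q. ennreal (Max (S q)) / ennreal (b q)) < y"
    "y < \<infinity>"
    using dense[OF lim] unfolding S_def by blast
  then obtain c where c: "y = ennreal c" "0 \<le> c" by (cases y) auto
  have "\<forall>\<^sub>F q in sequentially. \<psi> q \<noteq> 0 \<longrightarrow> ennreal (Max (S q)) / ennreal (b q) < ennreal c"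
    using Limsup_lessD[OF y(1)] by (simp add: c eventually_inf_principal)
  then obtain Q where Q: "\<And>q. Q \<le> q \<Longrightarrow> \<psi> q \<noteq> 0 \<Longrightarrow> ennreal (Max (S q)) / ennreal (b q) < ennreal c"
    by (auto simp: eventually_sequentially)
  show ?thesis
  proof (rule that[of c "max 1 Q"])
    fix p :: "int ^ 'n" and q assume q: "max 1 Q \<le> q" and p: "1 \<le> infnorm (int_vec p)" "infnorm (int_vec p) \<le> real q"
    have "finite {p :: int ^ 'n. infnorm (int_vec p) \<le> real q}"
      using finite_rat_pt[of 1 0 "real q"] by (simp add: rat_pt_def)
    then have "finite ((\<lambda>p. infnorm (\<gamma> p (int q))) ` {p. infnorm (int_vec p) \<le> real q})" by simp
    then have "finite (S q)" by (rule finite_subset[rotated]) (auto simp: S_def)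
    moreover have "infnorm (\<gamma> p (int q)) \<in> S q" using p by (auto simp: S_def)
    ultimately have le: "infnorm (\<gamma> p (int q)) \<le> Max (S q)" by simp
    then have M0: "0 \<le> Max (S q)" using infnorm_pos_le[of "\<gamma> p (int q)"] by linarith
    then have "ennreal (Max (S q) / b q) < ennreal c"
      using Q[of q] q \<psi>[of q] b[of q] by (simp add: divide_ennreal)
    then have "Max (S q) / b q < c" using M0 b[of q] q by (subst (asm) ennreal_less_iff) auto
    then show "infnorm (\<gamma> p (int q)) \<le> c * b q" using le b[of q] q by (simp add: field_simps)
  qed (use c in auto)
qed

text \<open>Rationals in the open unit box have all coordinates of p between 1 and q - 1, so they
  fall under the limsup hypothesis. This is why the divergence argument takes place in the open
  box.\<close>

lemma infnorm_int_vec_if_rat_pt_mem_box: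
  assumes "rat_pt p q \<in> box 0 (1 :: real ^ 'n)" "1 \<le> q"
  shows "1 \<le> infnorm (int_vec p :: real ^ 'n)" "infnorm (int_vec p :: real ^ 'n) \<le> real q"
proof -
  have p: "0 < p $ i" "real_of_int (p $ i) < real q" for i
    using assms by (auto simp: mem_box_cart zero_less_divide_iff)
  then have "\<bar>(int_vec p :: real ^ 'n) $ i\<bar> \<le> real q" for i
    using less_imp_le[OF p(2)] less_imp_le[OF p(1)] by (simp add: int_vec_def)
  then show "infnorm (int_vec p :: real ^ 'n) \<le> real q" unfolding infnorm_le_iff by blast
  have "1 \<le> \<bar>(int_vec p :: real ^ 'n) $ i\<bar>" for i using p(1)[of i] by (simp add: int_vec_def)
  then show "1 \<le> infnorm (int_vec p :: real ^ 'n)"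
    using component_le_infnorm_cart order_trans by blast
qed

section \<open>Infinite measure and full measure of limsup sets\<close>

text \<open>A one-point covering set has diameter 0 and cost \<open>f 0 = 0\<close>, so the
  pigeonhole argument would not see it. By continuity of f there are positive sizes with costs
  larger by at most (1 / 2)^i, hence by 2 in total.\<close>

lemma exists_larger_diameters:
  fixes m :: "nat \<Rightarrow> real"
  assumes f: "dimension_function f" and m: "\<And>i. 0 \<le> m i \<and> m i \<le> \<delta>" and "0 < \<delta>"
    and sum: "(\<Sum>i. ennreal (f (m i))) < ennreal \<eta>" and "0 < \<eta>"
  obtains d where "\<And>i. 0 < d i" "\<And>i. m i \<le> d i" "\<And>i. d i \<le> 2 * \<delta>"
    "summable (\<lambda>i. f (d i))" "(\<Sum>i. f (d i)) < \<eta> + 2"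
proof -
  have "\<exists>d. 0 < d \<and> m i \<le> d \<and> d \<le> 2 * \<delta> \<and> f d \<le> f (m i) + (1 / 2) ^ i" for i
  proof -
    have "continuous_on {0..} f" using f by (simp add: dimension_function_def)
    then obtain t where t: "0 < t" "\<And>r. r \<in> {0..} \<Longrightarrow> dist r (m i) < t \<Longrightarrow> dist (f r) (f (m i)) < (1 / 2) ^ i"
      using m[of i] unfolding continuous_on_iff by (metis atLeast_iff zero_less_power half_gt_zero zero_less_one)
    define d where "d = m i + min (t / 2) \<delta>"
    have "dist (f d) (f (m i)) < (1 / 2) ^ i"
      using m[of i] t(1) \<open>0 < \<delta>\<close> by (intro t(2)) (auto simp: d_def dist_real_def)
    then have "f d \<le> f (m i) + (1 / 2) ^ i" by (simp add: dist_real_def abs_less_iff)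
    moreover have "0 < d" "m i \<le> d" "d \<le> 2 * \<delta>"
      using m[of i] t(1) \<open>0 < \<delta>\<close> by (auto simp: d_def)
    ultimately show ?thesis by blast
  qed
  then obtain d where d: "\<And>i. 0 < d i \<and> m i \<le> d i \<and> d i \<le> 2 * \<delta> \<and> f (d i) \<le> f (m i) + (1 / 2) ^ i"
    by metis
  have fm: "0 \<le> f (m i)" "0 \<le> f (d i)" for i
    using m[of i] d[of i] by (intro dimension_functionD(1)[OF f]; simp)+
  have sm: "summable (\<lambda>i. f (m i))" using fm sum by (intro summable_suminf_not_top) auto
  then have "ennreal (\<Sum>i. f (m i)) < ennreal \<eta>"
    using sum by (simp only: suminf_ennreal[OF fm(1) ennreal_suminf_neq_top[OF sm fm(1)]])
  then have lt: "(\<Sum>i. f (m i)) < \<eta>" using suminf_nonneg[OF sm fm(1)] by (simp only: ennreal_less_iff)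
  have geo: "summable (\<lambda>i. (1 / 2 :: real) ^ i)" "(\<Sum>i. (1 / 2 :: real) ^ i) = 2"
    using summable_geometric[of "1 / 2 :: real"] suminf_geometric[of "1 / 2 :: real"] by auto
  have sd: "summable (\<lambda>i. f (d i))"
    by (rule summable_comparison_test'[OF summable_add[OF sm geo(1)], of 0]) (use fm d in auto)
  have "(\<Sum>i. f (d i)) \<le> (\<Sum>i. f (m i) + (1 / 2) ^ i)"
    using d sd summable_add[OF sm geo(1)] by (intro suminf_le) auto
  also have "\<dots> = (\<Sum>i. f (m i)) + 2" using suminf_add[OF sm geo(1)] geo(2) by simp
  finally have "(\<Sum>i. f (d i)) < \<eta> + 2" using lt by simp
  then show ?thesis using that[of d] d sd by blast
qed

lemma hausdorff_measure_mass_transference: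
  fixes z :: "int ^ 'n \<Rightarrow> nat \<Rightarrow> real ^ 'n" and \<rho> a :: "nat \<Rightarrow> real" and f :: "real \<Rightarrow> real"
  assumes full: "\<And>s Q. 0 < s \<Longrightarrow> negligible (box 0 1 - (\<Union>q\<in>{Q..}. \<Union>p. ocube (z p q) (s * \<rho> q)))"
    and lim: "\<rho> \<longlonglongrightarrow> 0" and \<rho>_pos: "\<And>q. 1 \<le> q \<Longrightarrow> 0 < \<rho> q"
    and a: "a \<longlonglongrightarrow> 0" "\<And>q. 1 \<le> q \<Longrightarrow> 0 < a q" "\<And>q. 1 \<le> q \<Longrightarrow> f (a q) = \<rho> q ^ CARD('n)"
    and f: "dimension_function f" "\<And>r. 0 < r \<Longrightarrow> 0 < f r" "antimono_on {0<..} (\<lambda>r. f r / r ^ CARD('n))"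
    and f_large: "\<And>K. \<exists>\<delta>>0. \<forall>r. 0 < r \<longrightarrow> r \<le> \<delta> \<longrightarrow> K * r ^ CARD('n) \<le> f r"
    and W: "\<And>x. x \<in> box 0 1 \<Longrightarrow> (\<And>Q. \<exists>q\<ge>Q. 1 \<le> q \<and> (\<exists>p. x \<in> ocube (z p q) (a q))) \<Longrightarrow> x \<in> W"
  shows "hausdorff_measure f W = \<infinity>"
proof -
  define n where "n = CARD('n)"
  define c :: real where "c = 1 / (4 * 36 ^ n)"
  have c: "0 < c" by (simp add: c_def)
  have ratio: "\<forall>\<^sub>F q in sequentially. K * a q \<le> \<rho> q" for K
  proof -
    obtain \<delta> where \<delta>: "0 < \<delta>" "\<And>r. 0 < r \<Longrightarrow> r \<le> \<delta> \<Longrightarrow> \<bar>K\<bar> ^ n * r ^ n \<le> f r"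
      using f_large unfolding n_def by meson
    have "\<forall>\<^sub>F q in sequentially. a q < \<delta>" using a(1) \<delta>(1) by (rule order_tendstoD)
    then show ?thesis
      using eventually_ge_at_top[of 1]
    proof eventually_elim
      case (elim q)
      have "(\<bar>K\<bar> * a q) ^ n \<le> \<rho> q ^ n"
        using \<delta>(2)[of "a q"] a(2,3)[of q] elim by (simp add: power_mult_distrib n_def)
      then have "\<bar>K\<bar> * a q \<le> \<rho> q"
        using \<rho>_pos[of q] a(2)[of q] elim
        by (intro power_mono_iff[THEN iffD1, of "\<bar>K\<bar> * a q" "\<rho> q" n]) (auto simp: n_def)
      moreover have "K * a q \<le> \<bar>K\<bar> * a q" using a(2)[of q] elim by (intro mult_right_mono) auto
      ultimately show ?case by simp
    qed
  qed
  have mono: "mono_on {0..} f" using f(1) by (simp add: dimension_function_def)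
  have large: "ennreal \<eta> \<le> hausdorff_measure f W" if \<eta>: "0 < \<eta>" for \<eta>
  proof -
    \<comment> \<open>The enlarged sizes cost less than \<eta> + 2 in total, so a weight M with c *
      M = \<eta> + 3 exceeds what the cover can pay. Covers of mesh \<delta> / 2 leave room for
      doubling the diameters.\<close>
    define M where "M = (\<eta> + 3) / c"
    have M: "0 < M" "\<eta> + 3 = c * M" using \<eta> c by (simp_all add: M_def)
    obtain \<delta> where \<delta>: "0 < \<delta>" "\<And>r. 0 < r \<Longrightarrow> r \<le> \<delta> \<Longrightarrow> c * (2 * 36 ^ n * M) * r ^ n \<le> f r"
      using f_large unfolding n_def by meson
    have "ennreal \<eta> \<le> hausdorff_premeasure f (\<delta> / 2) W"
      unfolding hausdorff_premeasure_def
    proof (rule INF_greatest, rule ccontr)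
      fix U assume U: "U \<in> {U. W \<subseteq> (\<Union>i. U i) \<and> (\<forall>i. bounded (U i) \<and> max_diameter (U i) \<le> \<delta> / 2)}"
        and "\<not> ennreal \<eta> \<le> (\<Sum>i. ennreal (f (max_diameter (U i))))"
      then have lt: "(\<Sum>i. ennreal (f (max_diameter (U i)))) < ennreal \<eta>" by simp
      have U': "bounded (U i)" "max_diameter (U i) \<le> \<delta> / 2" for i using U by auto
      obtain d where d: "\<And>i. 0 < d i" "\<And>i. max_diameter (U i) \<le> d i" "\<And>i. d i \<le> 2 * (\<delta> / 2)"
        "summable (\<lambda>i. f (d i))" "(\<Sum>i. f (d i)) < \<eta> + 2"
      proof (rule exists_larger_diameters[OF f(1) _ _ lt \<eta>, of "\<delta> / 2"])
        show "0 \<le> max_diameter (U i) \<and> max_diameter (U i) \<le> \<delta> / 2" for i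
          using U' max_diameter_nonneg by blast
      qed (use \<delta>(1) that in auto)
      obtain x where x: "x \<in> box 0 1" "x \<notin> (\<Union>i. U i)"
        "\<And>Q. \<exists>q\<ge>Q. 1 \<le> q \<and> (\<exists>p. x \<in> ocube (z p q) (a q))"
      proof (rule mass_transference_point[where z = z and \<rho> = \<rho> and a = a and f = f and A = U and d = d and M = M,
            folded n_def, folded c_def])
        show "negligible (box 0 1 - (\<Union>q\<in>{Q..}. \<Union>p. ocube (z p q) (s * \<rho> q)))" if "0 < s" for s Q
          using that by (rule full)
        show "\<rho> \<longlonglongrightarrow> 0" "mono_on {0..} f" "0 < M" "summable (\<lambda>i. f (d i))" by fact+
        show "0 < \<rho> q" "0 < a q" "f (a q) = \<rho> q ^ n" if "1 \<le> q" for q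
          using that \<rho>_pos a by (simp_all add: n_def)
        show "\<forall>\<^sub>F q in sequentially. K * a q \<le> \<rho> q" for K by (rule ratio)
        show "0 < f r" if "0 < r" for r using that by (rule f(2))
        show "antimono_on {0<..} (\<lambda>r. f r / r ^ n)" using f(3) by (simp add: n_def)
        show "infnorm (u - v) \<le> d i" if "u \<in> U i" "v \<in> U i" for i u v
          using infnorm_le_max_diameter[OF U'(1) that] d(2)[of i] by simp
        show "0 < d i" for i by (rule d(1))
        show "(\<Sum>i. f (d i)) < c * M" using d(5) M(2) by simp
        show "c * (2 * 36 ^ n * M) * d i ^ n \<le> f (d i)" for i
          using \<delta>(2)[OF d(1)] d(3)[of i] by simp
      qed (rule that)
      then have "x \<in> W" using W by blast
      then show False using x(2) U by blast
    qed
    also have "\<dots> \<le> hausdorff_measure f W"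
      unfolding hausdorff_measure_def using \<delta>(1) by (intro SUP_upper) auto
    finally show ?thesis .
  qed
  show ?thesis
  proof (cases "hausdorff_measure f W")
    case (real y)
    have "ennreal (y + 1) \<le> ennreal y" using large[of "y + 1"] real by simp
    then show ?thesis using real by (simp add: ennreal_le_iff)
  qed simp
qed

text \<open>For s = C^(-1/n) the bound f(a q) \<le> C * a(q)^n reads s * \<rho>(q) \<le> a(q), so W
  contains a limsup set of full Lebesgue measure. Its complement in the cube is negligible, hence
  null for the Hausdorff measure by the same bound on f, and subadditivity gives W the measure of
  the whole cube.\<close>

lemma hausdorff_measure_full_if_comparable:
  fixes z :: "int ^ 'n \<Rightarrow> nat \<Rightarrow> real ^ 'n" and \<rho> a :: "nat \<Rightarrow> real" and f :: "real \<Rightarrow> real"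
  assumes full: "\<And>s Q. 0 < s \<Longrightarrow> negligible (box 0 1 - (\<Union>q\<in>{Q..}. \<Union>p. ocube (z p q) (s * \<rho> q)))"
    and \<rho>_pos: "\<And>q. 1 \<le> q \<Longrightarrow> 0 < \<rho> q"
    and a: "a \<longlonglongrightarrow> 0" "\<And>q. 1 \<le> q \<Longrightarrow> 0 < a q" "\<And>q. 1 \<le> q \<Longrightarrow> f (a q) = \<rho> q ^ CARD('n)"
    and f: "dimension_function f"
    and bound: "\<And>r. 0 < r \<Longrightarrow> r \<le> \<delta> \<Longrightarrow> f r \<le> C * r ^ CARD('n)" "0 < \<delta>" "0 < C"
    and W: "W \<subseteq> cbox 0 1"
      "\<And>x. x \<in> box 0 1 \<Longrightarrow> (\<And>Q. \<exists>q\<ge>Q. 1 \<le> q \<and> (\<exists>p. x \<in> ocube (z p q) (a q))) \<Longrightarrow> x \<in> W"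
  shows "hausdorff_measure f W = hausdorff_measure f (cbox 0 (1 :: real ^ 'n))"
proof (rule antisym)
  show "hausdorff_measure f W \<le> hausdorff_measure f (cbox 0 (1 :: real ^ 'n))"
    using W(1) by (rule hausdorff_measure_mono)
  define s where "s = 1 / root CARD('n) C"
  have s: "0 < s" using bound(3) by (simp add: s_def)
  have sn: "s ^ CARD('n) * C = 1" using bound(3) by (simp add: s_def power_divide)
  have "\<forall>\<^sub>F q in sequentially. a q < \<delta>" using a(1) bound(2) by (rule order_tendstoD)
  then obtain Q\<^sub>1 where Q\<^sub>1: "\<And>q. Q\<^sub>1 \<le> q \<Longrightarrow> a q < \<delta>" by (auto simp: eventually_sequentially)
  define Q\<^sub>2 where "Q\<^sub>2 Q = max 1 (max Q Q\<^sub>1)" for Q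
  have le: "s * \<rho> q \<le> a q" if "Q\<^sub>2 Q \<le> q" for q Q
  proof -
    have q: "1 \<le> q" "Q\<^sub>1 \<le> q" using that by (auto simp: Q\<^sub>2_def)
    have "(s * \<rho> q) ^ CARD('n) = s ^ CARD('n) * f (a q)" using a(3)[OF q(1)] by (simp add: power_mult_distrib)
    also have "\<dots> \<le> s ^ CARD('n) * (C * a q ^ CARD('n))"
      using a(2)[OF q(1)] Q\<^sub>1[OF q(2)] s by (intro mult_left_mono bound(1)) auto
    also have "\<dots> = a q ^ CARD('n)" using sn by (simp flip: mult.assoc)
    finally show ?thesis
      using a(2)[OF q(1)] \<rho>_pos[OF q(1)] s
      by (intro power_mono_iff[THEN iffD1, of "s * \<rho> q" "a q" "CARD('n)"]) auto
  qed
  define X where "X Q = box 0 1 - (\<Union>q\<in>{Q\<^sub>2 Q..}. \<Union>p. ocube (z p q) (s * \<rho> q))" for Q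
  define N where "N = cbox 0 1 - W"
  have "N \<subseteq> (cbox 0 1 - box 0 1) \<union> (\<Union>Q. X Q)"
  proof
    fix x assume x: "x \<in> N"
    show "x \<in> (cbox 0 1 - box 0 1) \<union> (\<Union>Q. X Q)"
    proof (rule ccontr)
      assume "x \<notin> (cbox 0 1 - box 0 1) \<union> (\<Union>Q. X Q)"
      then have x': "x \<in> box 0 1" "\<And>Q. x \<notin> X Q" using x by (auto simp: N_def)
      have "\<exists>q\<ge>Q. 1 \<le> q \<and> (\<exists>p. x \<in> ocube (z p q) (a q))" for Q
      proof -
        obtain q p where qp: "Q\<^sub>2 Q \<le> q" "x \<in> ocube (z p q) (s * \<rho> q)"
          using x'(1) x'(2)[of Q] by (auto simp: X_def)
        then have "x \<in> ocube (z p q) (a q)" using ocube_mono[OF le[OF qp(1)]] by blast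
        then show ?thesis using qp(1) by (auto simp: Q\<^sub>2_def)
      qed
      then have "x \<in> W" using W(2) x'(1) by blast
      then show False using x by (simp add: N_def)
    qed
  qed
  moreover have "negligible ((cbox 0 1 - box 0 1) \<union> (\<Union>Q. X Q) :: (real ^ 'n) set)"
    using full[OF s] by (intro negligible_Un negligible_frontier_interval negligible_countable_Union)
      (auto simp: X_def)
  ultimately have "negligible N" using negligible_subset by blast
  then have "hausdorff_measure f N = 0"
    using bound by (intro hausdorff_measure_negligible[OF f, where C = C and \<delta>\<^sub>0 = \<delta>]) (auto simp: N_def)
  then have "hausdorff_measure f (W \<union> N) \<le> hausdorff_measure f W" by (rule hausdorff_measure_Un_null)
  moreover have "W \<union> N = cbox 0 1" using W(1) by (auto simp: N_def)
  ultimately show "hausdorff_measure f (cbox 0 (1 :: real ^ 'n)) \<le> hausdorff_measure f W" by simp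
qed

lemma volume_sum_eq: "volume_sum n f \<psi> = (\<Sum>k. ennreal (real (Suc k) ^ n * f (\<psi> (Suc k) / real (Suc k))))"
  by (simp add: volume_sum_def Let_def)

lemma hausdorff_measure_W_set_divergence:
  fixes \<psi> :: "nat \<Rightarrow> real" and \<gamma> :: "int ^ 'n \<Rightarrow> int \<Rightarrow> real ^ 'n" and f :: "real \<Rightarrow> real"
  assumes \<psi>: "\<forall>q\<ge>1. \<psi> q \<ge> 0" "antimono_on {1..} \<psi>" "\<psi> \<longlonglongrightarrow> 0"
    and \<gamma>: "\<forall>p q. \<gamma> p q \<in> cbox (vec (- 1/2)) (vec (1/2))"
    and f: "dimension_function f"
    and quot: "mono_on {0<..} (\<lambda>r. f r / r ^ CARD('n)) \<or> antimono_on {0<..} (\<lambda>r. f r / r ^ CARD('n))"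
    and lim: "Limsup (inf sequentially (principal {q. \<psi> q \<noteq> 0}))
           (\<lambda>q. ennreal (Max {infnorm (\<gamma> p (int q)) | p.
                               1 \<le> infnorm (int_vec p) \<and> infnorm (int_vec p) \<le> real q})
                / ennreal (real q * root CARD('n) (f (\<psi> q / real q)))) < \<infinity>"
    and div: "\<not> summable (\<lambda>k. real (Suc k) ^ CARD('n) * f (\<psi> (Suc k) / real (Suc k)))"
  shows "hausdorff_measure f (W_set \<gamma> \<psi>) = hausdorff_measure f (cbox 0 (1 :: real ^ 'n))"
proof -
  define n where "n = CARD('n)"
  have n: "0 < n" by (simp add: n_def)
  define a where "a q = \<psi> q / real q" for q
  define \<rho> where "\<rho> q = root n (f (a q))" for q
  define z where "z = shift_pt \<gamma>"
  have W_sub: "W_set \<gamma> \<psi> \<subseteq> cbox 0 1" by (auto simp: W_set_def)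
  have W_mem: "x \<in> W_set \<gamma> \<psi>"
    if "x \<in> box 0 1" "\<And>Q. \<exists>q\<ge>Q. 1 \<le> q \<and> (\<exists>p. x \<in> ocube (z p q) (a q))" for x
    using that box_subset_cbox[of "0 :: real ^ 'n" 1] unfolding W_set_iff[OF \<gamma>] z_def a_def by blast
  show ?thesis
  \<comment> \<open>If f r / r^n has lower limit 0 at 0, the unit cube is null and the claim reads 0
    = 0. Otherwise f is at least a multiple of r^n near 0, hence positive.\<close>
  proof (cases "\<forall>e>0. \<forall>\<delta>>0. \<exists>r. 0 < r \<and> r \<le> \<delta> \<and> f r \<le> e * r ^ n")
    case True
    then have "hausdorff_measure f (cbox 0 (1 :: real ^ 'n)) = 0"
      unfolding n_def by (intro hausdorff_measure_unit_cube_eq_0[OF f]) blast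
    then show ?thesis using hausdorff_measure_mono[OF W_sub, of f] by simp
  next
    case False
    then obtain e \<delta>\<^sub>0 where e: "0 < e" "0 < \<delta>\<^sub>0" "\<And>r. 0 < r \<Longrightarrow> r \<le> \<delta>\<^sub>0 \<Longrightarrow> e * r ^ n < f r"
      by (metis not_le)
    have f_pos: "0 < f r" if "0 < r" for r
    proof -
      have "0 < e * min r \<delta>\<^sub>0 ^ n" using that e by simp
      also have "\<dots> < f (min r \<delta>\<^sub>0)" using that e by (intro e(3)) auto
      also have "\<dots> \<le> f r" using that e by (intro dimension_functionD(2)[OF f]) auto
      finally show ?thesis .
    qed
    \<comment> \<open>One zero of \<psi> forces all later values to vanish, and
      \<open>f 0 = 0\<close> then leaves a finite sum.\<close>
    have \<psi>_pos: "0 < \<psi> q" if q: "1 \<le> q" for q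
    proof (rule ccontr)
      assume "\<not> 0 < \<psi> q"
      have "\<psi> k = 0" if "q \<le> k" for k
      proof -
        have "\<psi> k \<le> \<psi> q" using q that by (intro monotone_onD[OF \<psi>(2)]) auto
        moreover have "0 \<le> \<psi> k" using \<psi>(1) q that by simp
        ultimately show ?thesis using \<open>\<not> 0 < \<psi> q\<close> by simp
      qed
      then have "real (Suc k) ^ CARD('n) * f (\<psi> (Suc k) / real (Suc k)) = 0" if "k \<notin> {..<q}" for k
        using that dimension_functionD(3)[OF f] by simp
      then have "summable (\<lambda>k. real (Suc k) ^ CARD('n) * f (\<psi> (Suc k) / real (Suc k)))"
        by (rule summable_finite[OF finite_lessThan])
      with div show False by contradiction
    qed
    have a_pos: "0 < a q" if "1 \<le> q" for q using \<psi>_pos[OF that] that by (simp add: a_def)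
    have \<rho>_pos: "0 < \<rho> q" if "1 \<le> q" for q using f_pos[OF a_pos[OF that]] n by (simp add: \<rho>_def)
    have \<rho>n: "f (a q) = \<rho> q ^ n" if "1 \<le> q" for q
      using f_pos[OF a_pos[OF that]] n by (simp add: \<rho>_def)
    have \<rho>_mono: "antimono_on {1..} \<rho>"
    proof (rule monotone_onI)
      fix q q' :: nat assume q: "q \<in> {1..}" "q' \<in> {1..}" "q \<le> q'"
      have "a q' \<le> \<psi> q / real q'"
        unfolding a_def using q by (intro divide_right_mono monotone_onD[OF \<psi>(2)]) auto
      also have "\<dots> \<le> a q"
        unfolding a_def using q \<psi>_pos[of q] by (intro divide_left_mono) auto
      finally have "f (a q') \<le> f (a q)"
        using a_pos[of q'] q by (intro dimension_functionD(2)[OF f]) auto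
      then show "\<rho> q \<ge> \<rho> q'" using n by (simp add: \<rho>_def)
    qed
    have a_lim: "a \<longlonglongrightarrow> 0"
      unfolding a_def using \<psi>(3) filterlim_real_sequentially
      by (rule tendsto_divide_0[OF _ filterlim_at_top_imp_at_infinity])
    have "\<forall>\<^sub>F q in sequentially. 0 < a q"
      using eventually_ge_at_top[of 1] by (rule eventually_mono) (rule a_pos)
    then have "filterlim a (at_right 0) sequentially"
      unfolding filterlim_at using a_lim by (auto elim: eventually_mono)
    moreover have "(f \<longlongrightarrow> 0) (at_right 0)" using f by (simp add: dimension_function_def)
    ultimately have "(\<lambda>q. f (a q)) \<longlonglongrightarrow> 0" by (rule filterlim_compose[rotated])
    then have \<rho>_lim: "\<rho> \<longlonglongrightarrow> 0"
      unfolding \<rho>_def using tendsto_real_root[of "\<lambda>q. f (a q)" 0 sequentially n] by simp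
    have div': "\<not> summable (\<lambda>k. real (Suc k) ^ n * \<rho> (Suc k) ^ n)"
    proof -
      have "f (\<psi> (Suc k) / real (Suc k)) = \<rho> (Suc k) ^ n" for k
        using \<rho>n[of "Suc k"] unfolding a_def by simp
      then show ?thesis using div unfolding n_def by (simp only: not_False_eq_True)
    qed
    obtain C Q\<^sub>0 where C: "0 \<le> C" "1 \<le> Q\<^sub>0"
      "\<And>p q. Q\<^sub>0 \<le> q \<Longrightarrow> 1 \<le> infnorm (int_vec p) \<Longrightarrow> infnorm (int_vec p) \<le> real q \<Longrightarrow>
        infnorm (\<gamma> p (int q)) \<le> C * (real q * \<rho> q)"
    proof (rule gamma_bound[OF lim[folded n_def, folded a_def, folded \<rho>_def]])
      show "\<psi> q \<noteq> 0" "0 < real q * \<rho> q" if "1 \<le> q" for q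
        using \<psi>_pos[OF that] \<rho>_pos[OF that] that by auto
    qed (rule that)
    \<comment> \<open>The proportion depends on s but neither on the cube nor on Q, so a positive
      proportion becomes full measure for every s.\<close>
    have full: "negligible (box 0 1 - (\<Union>q\<in>{Q..}. \<Union>p. ocube (z p q) (s * \<rho> q)))" if s: "0 < s" for s Q
    proof (rule negligible_if_density_bound)
      show "0 < (s / (36 * (C + s + 1))) ^ n / 8" using s C(1) by simp
      fix x :: "real ^ 'n" and r :: real assume r: "0 < r" "ocube x r \<subseteq> box 0 1"
      have near: "infnorm (z p q - rat_pt p q) \<le> C * \<rho> q" if q: "Q\<^sub>0 \<le> q" and p: "rat_pt p q \<in> ocube x r" for p q
      proof -
        have "1 \<le> q" using C(2) q by simp
        then have "infnorm (\<gamma> p (int q)) \<le> C * (real q * \<rho> q)"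
          using r(2) p q by (intro C(3) infnorm_int_vec_if_rat_pt_mem_box) auto
        then show ?thesis
          using \<open>1 \<le> q\<close> by (simp add: z_def infnorm_shift_pt_diff pos_divide_le_eq mult_ac)
      qed
      show "(s / (36 * (C + s + 1))) ^ n / 8 * r ^ CARD('n)
        \<le> measure lebesgue (ocube x r \<inter> (\<Union>q\<in>{Q..}. \<Union>p. ocube (z p q) (s * \<rho> q)))"
        using shifted_rational_density[OF r(1) \<rho>_pos \<rho>_mono div'[unfolded n_def] \<rho>_lim C(1) s near]
        by (simp add: n_def)
    qed (intro open_UN ballI open_ocube)
    show ?thesis
    proof (cases "\<exists>C>0. \<exists>\<delta>>0. \<forall>r. 0 < r \<longrightarrow> r \<le> \<delta> \<longrightarrow> f r \<le> C * r ^ n")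
      case True
      then obtain C' \<delta> where "0 < C'" "0 < \<delta>" "\<And>r. 0 < r \<Longrightarrow> r \<le> \<delta> \<Longrightarrow> f r \<le> C' * r ^ n" by blast
      then show ?thesis
        using hausdorff_measure_full_if_comparable[OF full \<rho>_pos a_lim a_pos \<rho>n[unfolded n_def] f _ _ _ W_sub W_mem]
        unfolding n_def by blast
    next
      case False
      have unbounded: "\<exists>r. 0 < r \<and> r \<le> \<delta> \<and> C * r ^ n < f r" if "0 < C" "0 < \<delta>" for C \<delta>
        using False that by (meson not_le)
      \<comment> \<open>An increasing quotient would be bounded by f(1) on (0, 1]. Hence it
        decreases, and one large value at \<delta> bounds it from below on all of (0,
        \<delta>].\<close>
      have "\<not> mono_on {0<..} (\<lambda>r. f r / r ^ n)"
      proof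
        assume m: "mono_on {0<..} (\<lambda>r. f r / r ^ n)"
        obtain r where r: "0 < r" "r \<le> 1" "f 1 * r ^ n < f r" using unbounded[of "f 1" 1] f_pos by auto
        have "f r / r ^ n \<le> f 1 / 1 ^ n" using r by (intro monotone_onD[OF m]) auto
        then show False using r by (simp add: pos_divide_le_eq)
      qed
      then have anti: "antimono_on {0<..} (\<lambda>r. f r / r ^ n)" using quot by (simp add: n_def)
      have f_large: "\<exists>\<delta>>0. \<forall>r. 0 < r \<longrightarrow> r \<le> \<delta> \<longrightarrow> K * r ^ n \<le> f r" for K
      proof -
        have "0 < \<bar>K\<bar> + 1" by linarith
        then obtain \<delta> where \<delta>: "0 < \<delta>" "(\<bar>K\<bar> + 1) * \<delta> ^ n < f \<delta>"
          using unbounded[of "\<bar>K\<bar> + 1" 1] by auto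
        have "K * r ^ n \<le> f r" if r: "0 < r" "r \<le> \<delta>" for r
        proof -
          have "K \<le> \<bar>K\<bar> + 1" by simp
          also have "\<dots> \<le> f \<delta> / \<delta> ^ n" using \<delta> by (simp add: pos_le_divide_eq)
          also have "\<dots> \<le> f r / r ^ n" using r \<delta>(1) by (intro monotone_onD[OF anti]) auto
          finally show ?thesis using r by (simp add: pos_le_divide_eq)
        qed
        then show ?thesis using \<delta>(1) by blast
      qed
      have "hausdorff_measure f (W_set \<gamma> \<psi>) = \<infinity>"
        using full \<rho>_lim \<rho>_pos a_lim a_pos \<rho>n[unfolded n_def] f f_pos anti[unfolded n_def] f_large[unfolded n_def] W_mem
        by (rule hausdorff_measure_mass_transference)
      then show ?thesis using hausdorff_measure_mono[OF W_sub, of f] by (simp add: top_unique)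
    qed
  qed
qed

theorem theorem2p1:
  fixes \<psi> :: "nat \<Rightarrow> real"
    and \<gamma> :: "int ^ 'n \<Rightarrow> int \<Rightarrow> real ^ 'n"
    and f :: "real \<Rightarrow> real"
  assumes "\<forall>q\<ge>1. \<psi> q \<ge> 0"
    and "antimono_on {1..} \<psi>"
    and "\<psi> \<longlonglongrightarrow> 0"
    and "\<forall>p q. \<gamma> p q \<in> cbox (vec (- 1/2)) (vec (1/2))"
    and "\<forall>p. ((\<lambda>q. infnorm (\<gamma> p q)) \<longlongrightarrow> 0) at_top"
    and "dimension_function f"
    and "mono_on {0<..} (\<lambda>r. f r / r ^ CARD('n)) \<or> antimono_on {0<..} (\<lambda>r. f r / r ^ CARD('n))"
    and "Limsup (inf sequentially (principal {q. \<psi> q \<noteq> 0}))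
           (\<lambda>q. ennreal (Max {infnorm (\<gamma> p (int q)) | p.
                               1 \<le> infnorm (int_vec p) \<and> infnorm (int_vec p) \<le> real q})
                / ennreal (real q * root CARD('n) (f (\<psi> q / real q)))) < \<infinity>"
  shows "(volume_sum CARD('n) f \<psi> < \<infinity> \<longrightarrow> hausdorff_measure f (W_set \<gamma> \<psi>) = 0) \<and>
         (volume_sum CARD('n) f \<psi> = \<infinity> \<longrightarrow>
            hausdorff_measure f (W_set \<gamma> \<psi>) = hausdorff_measure f (cbox 0 (1 :: real ^ 'n)))"
proof -
  define b where "b k = real (Suc k) ^ CARD('n) * f (\<psi> (Suc k) / real (Suc k))" for k
  have pos: "0 \<le> b k" for k
    using assms(1) dimension_functionD(1)[OF assms(6)] by (simp add: b_def)
  have vol: "volume_sum CARD('n) f \<psi> = (\<Sum>k. ennreal (b k))"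
    by (simp only: volume_sum_eq b_def)
  have b: "volume_sum CARD('n) f \<psi> < \<infinity> \<longleftrightarrow> summable b"
    unfolding vol infinity_ennreal_def less_top[symmetric]
    using summable_suminf_not_top[of b, OF pos] ennreal_suminf_neq_top[of b, OF _ pos] by (rule iffI)
  show ?thesis
  proof (intro conjI impI)
    assume "volume_sum CARD('n) f \<psi> < \<infinity>"
    then show "hausdorff_measure f (W_set \<gamma> \<psi>) = 0"
      using assms(1) unfolding b b_def[abs_def]
      by (intro hausdorff_measure_W_set_convergence[OF assms(6) assms(4) _ assms(3)]) blast+
  next
    assume "volume_sum CARD('n) f \<psi> = \<infinity>"
    then have "\<not> summable b" using b by simp
    then show "hausdorff_measure f (W_set \<gamma> \<psi>) = hausdorff_measure f (cbox 0 (1 :: real ^ 'n))"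
      unfolding b_def[abs_def] by (rule hausdorff_measure_W_set_divergence[OF assms(1-4,6-8)])
  qed
qed

end
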